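(* Let $V$ be an $n$-dimensional real vector space with a lattice $\Lambda$, and let $X=[a_1,\dots,a_N]$ be a finite sequence (multiset) of nonzero vectors of $\Lambda$ that generates $V$. Let $f$ be a smooth function on $V$. Then $$B(X)*_d f - B(X)*_c f=\sum_{\mathbf{s}\in\mathcal R'}\ \sum_{I\subset X\setminus \mathbf{s}}(-1)^{|I|}\, B\big((X\cap \mathbf{s})\sqcup I\big)*_c\big(W(X/\mathbf{s})\,\partial_I\nabla_J f\big),$$ where the inner sum runs over all subsequences $I$ of $X\setminus\mathbf{s}$ and $J$ denotes the complement of $I$ in the sequence $X\setminus \mathbf{s}$. This equality holds in the space of piecewise smooth distributions on $V$ (relative to $(X,\Lambda)$).
   Context: Lebesgue measure $dv$ on $V$ is the one associated to the lattice $\Lambda$ (a fundamental domain of $\Lambda$ has volume $1$). $U=V^*$ is the dual space, and $\Gamma=\{\gamma\in U:\langle\gamma,\lambda\rangle\in\mathbb Z\ \forall \lambda\in\Lambda\}$ is the dual lattice. Functions are complex valued; a test function is a smooth compactly supported function on $V$. Using $dv$, generalized functions $F$ are identified with distributions $F\,dv$. Sequences: subsequences of $X$ are taken with multiplicity, i.e. they are indexed by subsets of the index set $\{1,\dots,N\}$; $|I|$ is the number of terms of $I$. For a subspace $\mathbf{s}\subset V$, $X\cap\mathbf{s}$ is the subsequence of elements of $X$ lying in $\mathbf{s}$, and $X\setminus\mathbf{s}$ is the subsequence of elements of $X$ not lying in $\mathbf{s}$. Box spline: for a subsequence $Y=[b_1,\dots,b_k]$ of $X$, $B(Y)$ is the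 distribution on $V$ given by $\langle B(Y),\phi\rangle=\int_0^1\cdots\int_0^1\phi(\sum_{i=1}^k t_ib_i)\,dt_1\cdots dt_k$ for test functions $\phi$; $B(\emptyset)$ is the $\delta$ distribution at $0$. Convolutions: for a smooth function $f$, $$\langle B(X)*_d f,\phi\rangle=\sum_{\lambda\in\Lambda}f(\lambda)\int_0^1\cdots\int_0^1\phi\Big(\lambda+\sum_{i=1}^N t_ia_i\Big)dt_1\cdots dt_N .$$ For a locally $L^1$ function $F$ on $V$ (in particular a smooth one) and a subsequence $Y=[b_1,\dots,b_k]$ of $X$, $B(Y)*_c F$ is the convolution of $B(Y)$ with $F\,dv$: $$\langle B(Y)*_c F,\phi\rangle=\int_V F(v)\int_0^1\cdots\int_0^1\phi\Big(v+\sum_{i=1}^k t_ib_i\Big)dt_1\cdots dt_k\,dv .$$ Operators: $(\partial_a f)(v)=\frac{d}{d\epsilon}f(v+\epsilon a)|_{\epsilon=0}$, $(\nabla_a f)(v)=f(v)-f(v-a)$, $\partial_I=\prod_{a\in I}\partial_a$, $\nabla_J=\prod_{b\in J}\nabla_b$ (products with multiplicity; the empty product is the identity). Admissible subspaces: $\mathcal R$ is the set of subspaces of $V$ generated by a subsequence of elements of $X$ (including $\{0\}$ and $V$), and $\mathcal R'=\mathcal R\setminus\{V\}$. Bernoulli series: for $\mathbf{s}\in\mathcal R$, let $\Gamma_{\mathrm{reg}}(X/\mathbf{s})$ be the set of $\gamma\in\Gamma$ such that $\langle\gamma,s\rangle=0$ for all $s\in\mathbf{s}$ and $\langle\gamma,a\rangle\ne0$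 for all $a\in X\setminus\mathbf{s}$. Then $$W(X/\mathbf{s})(v)=\sum_{\gamma\in\Gamma_{\mathrm{reg}}(X/\mathbf{s})}\frac{e^{2i\pi\langle v,\gamma\rangle}}{\prod_{a\in X\setminus\mathbf{s}}2i\pi\langle a,\gamma\rangle},$$ a series converging in the sense of generalized functions on $V$. It is a known fact that, since $X$ generates $V$, $W(X/\mathbf{s})$ is a locally $L^1$ function which is piecewise polynomial relative to $(X,\Lambda)$ (defined as piecewise smooth below, with polynomials in place of smooth functions). Piecewise smooth: an admissible hyperplane is a hyperplane of $V$ generated by a subsequence of elements of $X$. A tope is a connected component of the complement in $V$ of the union of all $\Lambda$-translates of admissible hyperplanes. A generalized function $b$ on $V$ is piecewise smooth (relative to $(X,\Lambda)$) if it is locally $L^1$ and for each tope $\tau$ there is a smooth function $b(\tau)$ on all of $V$ whose restriction to $\tau$ coincides with $b|_\tau$; the distribution $b(v)\,dv$ is then called piecewise smooth. *)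

theory Defs
  imports "HOL-Analysis.Analysis"
begin

section \<open>Lattices, the associated Lebesgue measure, the dual lattice\<close>

definition lattice_basis :: "'a::euclidean_space set \<Rightarrow> 'a set \<Rightarrow> bool" where
  "lattice_basis \<Lambda> B \<longleftrightarrow>
     independent B \<and> span B = UNIV \<and> \<Lambda> = {\<Sum>b\<in>B. of_int (c b) *\<^sub>R b |c::'a \<Rightarrow> int. True}"

definition is_lattice :: "'a::euclidean_space set \<Rightarrow> bool" where
  "is_lattice \<Lambda> \<longleftrightarrow> (\<exists>B. lattice_basis \<Lambda> B)"

text \<open>The volume of the parallelepiped below does not depend on the chosen lattice basis.\<close>

definition covolume :: "'a::euclidean_space set \<Rightarrow> real" where
  "covolume \<Lambda> = measure lborel
     {\<Sum>b\<in>(SOME B. lattice_basis \<Lambda> B). t b *\<^sub>R b |t::'a \<Rightarrow> real. \<forall>b. 0 \<le> t b \<and> t b < 1}"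

text \<open>The measure \<open>dv\<close>: Lebesgue measure scaled so that a fundamental domain of
  \<open>\<Lambda>\<close> has volume 1.\<close>

definition dvol :: "'a::euclidean_space set \<Rightarrow> 'a measure" where
  "dvol \<Lambda> = density lborel (\<lambda>_. ennreal (1 / covolume \<Lambda>))"

text \<open>The dual space of \<open>'a\<close> is the type of (bounded) linear functionals on \<open>'a\<close>.\<close>

definition dual_lattice :: "'a::euclidean_space set \<Rightarrow> ('a \<Rightarrow>\<^sub>L real) set" where
  "dual_lattice \<Lambda> = {\<gamma>. \<forall>l\<in>\<Lambda>. blinfun_apply \<gamma> l \<in> \<int>}"

section \<open>Differential and difference operators, smooth functions\<close>

definition pderiv_dir :: "'a::euclidean_space \<Rightarrow> ('a \<Rightarrow> complex) \<Rightarrow> 'a \<Rightarrow> complex" where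
  "pderiv_dir a f v = vector_derivative (\<lambda>\<epsilon>. f (v + \<epsilon> *\<^sub>R a)) (at 0)"

definition nabla :: "'a::euclidean_space \<Rightarrow> ('a \<Rightarrow> complex) \<Rightarrow> 'a \<Rightarrow> complex" where
  "nabla a f v = f v - f (v - a)"

definition pderivs :: "'a::euclidean_space list \<Rightarrow> ('a \<Rightarrow> complex) \<Rightarrow> 'a \<Rightarrow> complex" where
  "pderivs Y f = foldr pderiv_dir Y f"

definition nablas :: "'a::euclidean_space list \<Rightarrow> ('a \<Rightarrow> complex) \<Rightarrow> 'a \<Rightarrow> complex" where
  "nablas Y f = foldr nabla Y f"

primrec C_k :: "nat \<Rightarrow> ('a::euclidean_space \<Rightarrow> complex) \<Rightarrow> bool" where
  "C_k 0 f \<longleftrightarrow> continuous_on UNIV f"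
| "C_k (Suc k) f \<longleftrightarrow> (\<forall>v. f differentiable (at v)) \<and> (\<forall>a. C_k k (pderiv_dir a f))"

definition smooth :: "('a::euclidean_space \<Rightarrow> complex) \<Rightarrow> bool" where
  "smooth f \<longleftrightarrow> (\<forall>k. C_k k f)"

definition test_fun :: "('a::euclidean_space \<Rightarrow> complex) \<Rightarrow> bool" where
  "test_fun \<phi> \<longleftrightarrow> smooth \<phi> \<and> compact (closure {v. \<phi> v \<noteq> 0})"

section \<open>Distributions given by locally integrable functions\<close>

text \<open>Distributions are represented by functionals \<open>('a \<Rightarrow> complex) \<Rightarrow> complex\<close>, of
  which only the values on test functions are meaningful.\<close>

definition loc_L1 :: "'a::euclidean_space set \<Rightarrow> ('a \<Rightarrow> complex) \<Rightarrow> bool" where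
  "loc_L1 \<Lambda> F \<longleftrightarrow> (\<forall>K. compact K \<longrightarrow> set_integrable (dvol \<Lambda>) K F)"

definition dist_of :: "'a::euclidean_space set \<Rightarrow> ('a \<Rightarrow> complex) \<Rightarrow> ('a \<Rightarrow> complex) \<Rightarrow> complex" where
  "dist_of \<Lambda> F \<phi> = (LINT v|dvol \<Lambda>. F v * \<phi> v)"

section \<open>Box splines and convolutions\<close>

text \<open>Subsequences of a list \<open>X\<close> are the lists \<open>nths X I\<close> with
  \<open>I \<subseteq> {..<length X}\<close>.\<close>

primrec box_spline :: "'a::euclidean_space list \<Rightarrow> ('a \<Rightarrow> complex) \<Rightarrow> complex" where
  "box_spline [] \<phi> = \<phi> 0"
| "box_spline (b # Y) \<phi> = integral {0..1} (\<lambda>t. box_spline Y (\<lambda>v. \<phi> (t *\<^sub>R b + v)))"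

text \<open>For a test function \<open>\<phi>\<close> only finitely many terms of the sum over the lattice are
  nonzero.\<close>

definition conv_d ::
  "'a::euclidean_space set \<Rightarrow> 'a list \<Rightarrow> ('a \<Rightarrow> complex) \<Rightarrow> ('a \<Rightarrow> complex) \<Rightarrow> complex" where
  "conv_d \<Lambda> X f \<phi> = (\<Sum>\<^sub>\<infinity>l\<in>\<Lambda>. f l * box_spline X (\<lambda>v. \<phi> (l + v)))"

definition conv_c ::
  "'a::euclidean_space set \<Rightarrow> 'a list \<Rightarrow> ('a \<Rightarrow> complex) \<Rightarrow> ('a \<Rightarrow> complex) \<Rightarrow> complex" where
  "conv_c \<Lambda> Y F \<phi> = (LINT v|dvol \<Lambda>. F v * box_spline Y (\<lambda>w. \<phi> (v + w)))"

section \<open>Admissible subspaces, topes, piecewise smooth distributions\<close>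

definition adm_subspaces :: "'a::euclidean_space list \<Rightarrow> 'a set set" where
  "adm_subspaces X = {span (set (nths X I)) |I. I \<subseteq> {..<length X}}"

definition adm_hyperplanes :: "'a::euclidean_space list \<Rightarrow> 'a set set" where
  "adm_hyperplanes X = {H \<in> adm_subspaces X. dim H + 1 = DIM('a)}"

definition topes :: "'a::euclidean_space set \<Rightarrow> 'a list \<Rightarrow> 'a set set" where
  "topes \<Lambda> X = components (- (\<Union>H\<in>adm_hyperplanes X. \<Union>l\<in>\<Lambda>. (+) l ` H))"

definition pw_smooth :: "'a::euclidean_space set \<Rightarrow> 'a list \<Rightarrow> ('a \<Rightarrow> complex) \<Rightarrow> bool" where
  "pw_smooth \<Lambda> X b \<longleftrightarrow>
     loc_L1 \<Lambda> b \<and> (\<forall>\<tau>\<in>topes \<Lambda> X. \<exists>g. smooth g \<and> (\<forall>v\<in>\<tau>. b v = g v))"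

definition pw_smooth_dist ::
  "'a::euclidean_space set \<Rightarrow> 'a list \<Rightarrow> (('a \<Rightarrow> complex) \<Rightarrow> complex) \<Rightarrow> bool" where
  "pw_smooth_dist \<Lambda> X D \<longleftrightarrow>
     (\<exists>b. pw_smooth \<Lambda> X b \<and> (\<forall>\<phi>. test_fun \<phi> \<longrightarrow> D \<phi> = dist_of \<Lambda> b \<phi>))"

definition eq_pw_smooth_dist ::
  "'a::euclidean_space set \<Rightarrow> 'a list \<Rightarrow> (('a \<Rightarrow> complex) \<Rightarrow> complex)
     \<Rightarrow> (('a \<Rightarrow> complex) \<Rightarrow> complex) \<Rightarrow> bool" where
  "eq_pw_smooth_dist \<Lambda> X D E \<longleftrightarrow>
     pw_smooth_dist \<Lambda> X D \<and> pw_smooth_dist \<Lambda> X E \<and> (\<forall>\<phi>. test_fun \<phi> \<longrightarrow> D \<phi> = E \<phi>)"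

section \<open>Multiple Bernoulli series\<close>

text \<open>The indices of the terms of the subsequences of elements of \<open>X\<close> lying in
  \<open>\<ss>\<close>, respectively not lying in \<open>\<ss>\<close>.\<close>

definition idx_in :: "'a list \<Rightarrow> 'a set \<Rightarrow> nat set" where
  "idx_in X \<ss> = {i. i < length X \<and> X ! i \<in> \<ss>}"

definition idx_out :: "'a list \<Rightarrow> 'a set \<Rightarrow> nat set" where
  "idx_out X \<ss> = {i. i < length X \<and> X ! i \<notin> \<ss>}"

definition Gamma_reg ::
  "'a::euclidean_space set \<Rightarrow> 'a list \<Rightarrow> 'a set \<Rightarrow> ('a \<Rightarrow>\<^sub>L real) set" where
  "Gamma_reg \<Lambda> X \<ss> = {\<gamma> \<in> dual_lattice \<Lambda>.
     (\<forall>v\<in>\<ss>. blinfun_apply \<gamma> v = 0) \<and> (\<forall>i\<in>idx_out X \<ss>. blinfun_apply \<gamma> (X ! i) \<noteq> 0)}"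

text \<open>The series as a generalized function: its terms are paired with a test function, and the
  resulting series of complex numbers is absolutely convergent.\<close>

definition W_series ::
  "'a::euclidean_space set \<Rightarrow> 'a list \<Rightarrow> 'a set \<Rightarrow> ('a \<Rightarrow> complex) \<Rightarrow> complex" where
  "W_series \<Lambda> X \<ss> \<phi> =
     (\<Sum>\<^sub>\<infinity>\<gamma>\<in>Gamma_reg \<Lambda> X \<ss>.
        dist_of \<Lambda> (\<lambda>v. exp (2 * \<i> * of_real pi * of_real (blinfun_apply \<gamma> v)) /
          (\<Prod>i\<in>idx_out X \<ss>. 2 * \<i> * of_real pi * of_real (blinfun_apply \<gamma> (X ! i)))) \<phi>)"

text \<open>The locally \<open>L\<^sup>1\<close> function representing this generalized function; it exists when
  \<open>X\<close> generates the space, and is unique up to null sets.\<close>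

definition W :: "'a::euclidean_space set \<Rightarrow> 'a list \<Rightarrow> 'a set \<Rightarrow> 'a \<Rightarrow> complex" where
  "W \<Lambda> X \<ss> =
     (SOME F. loc_L1 \<Lambda> F \<and> (\<forall>\<phi>. test_fun \<phi> \<longrightarrow> dist_of \<Lambda> F \<phi> = W_series \<Lambda> X \<ss> \<phi>))"

end

theory Submission
  imports Defs
begin

text \<open>
  Tested against \<open>\<phi>\<close>, the discrete convolution is \<open>\<Sum>\<^sub>l \<psi>(l)\<close> for the test function
  \<open>\<psi> = f \<cdot> (B(X) * \<phi>)\<close> (with \<open>B(X)\<close> reflected), and Poisson summation turns it into the sum of the
  Fourier coefficients of \<open>\<psi>\<close> over the dual lattice. Group the frequencies \<open>\<gamma>\<close> by the subspace spanned
  by the \<open>a \<in> X\<close> with \<open>\<gamma>(a) = 0\<close>; the whole space corresponds to \<open>\<gamma> = 0\<close>, that is to \<open>B(X) *\<^sub>c f\<close>. For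
  the others, \<open>\<partial>\<^sub>a B(a) = \<nabla>\<^sub>a\<close> and an integration by parts give
  \<open>2\<pi>i \<gamma>(a) B(a) *\<^sub>c (e\<^sub>\<gamma> G) = e\<^sub>\<gamma> \<nabla>\<^sub>a G - B(a) *\<^sub>c (e\<^sub>\<gamma> \<partial>\<^sub>a G)\<close>; iterating over the \<open>a\<close> with
  \<open>\<gamma>(a) \<noteq> 0\<close> and summing over \<open>\<gamma>\<close> produces the Bernoulli series. The coefficients of the latter are
  square summable, since a frequency is determined by its values on \<open>X\<close>; by Riesz and Fischer the
  series is a locally integrable function.

  Piecewise smoothness is only needed for one side. It follows by induction on \<open>X\<close> from the recurrence
  of de Boor and Hoellig, which expresses a box spline through those with one vector less; for a basis the
  box spline is a multiple of the indicator function of a parallelepiped, whose facets lie on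
  translates of admissible hyperplanes.
\<close>

section \<open>Smooth functions\<close>

text \<open>Multiplication by smooth functions and averaging along box splines map test functions to
  test functions. \<open>W\<close>, which is fixed only up to null sets, therefore enters solely
  through its pairings with test functions. The coefficients of the Bernoulli series decay like a
  product of first powers of the values \<open>\<gamma>(a)\<close>, in general too slowly for
  absolute convergence, whereas their squares are summable. Hence the function is built from L2
  bounds, while sums over frequencies paired with a test function converge absolutely and may be
  regrouped. The obstacle in the recurrence is that deleting a vector may leave a sequence that no
  longer spans and whose box spline is singular. The recurrence is therefore expanded along a basis
  B taken from the sequence, and the three terms that belong to a vector b of B are kept together:
  when the rest does not span, it lies in the kernel of the b-coordinate and the three terms
  cancel.\<close>

lemma smooth_coinduct:
  assumes "f \<in> F"
    and "\<And>g v. g \<in> F \<Longrightarrow> g differentiable (at v)"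
    and "\<And>g a. g \<in> F \<Longrightarrow> pderiv_dir a g \<in> F"
  shows "smooth f"
proof -
  \<comment> \<open>The induction on \<open>k\<close> runs over all of \<open>F\<close> at once,
    since the derivative of a member is another member. This turns the tower of conditions
    \<open>C_k\<close> into one closure condition.\<close>
  have "\<forall>g\<in>F. C_k k g" for k
    by (induction k) (use assms in \<open>auto intro!: differentiable_imp_continuous_on
      simp: differentiable_on_def differentiable_at_withinI\<close>)
  then show ?thesis
    using assms(1) by (auto simp: smooth_def)
qed

lemma smooth_differentiable: "smooth f \<Longrightarrow> f differentiable (at v)"
  unfolding smooth_def by (metis C_k.simps(2))

lemma smooth_pderiv_dir: "smooth f \<Longrightarrow> smooth (pderiv_dir a f)"
  unfolding smooth_def by (metis C_k.simps(2))

lemma smooth_continuous_on: "smooth f \<Longrightarrow> continuous_on S f"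
  unfolding smooth_def by (metis C_k.simps(1) continuous_on_subset subset_UNIV)

lemma has_derivative_line:
  assumes "(f has_derivative f') (at (v + s *\<^sub>R a))"
  shows "((\<lambda>t. f (v + t *\<^sub>R a)) has_vector_derivative f' a) (at s)"
proof -
  have "((\<lambda>t. v + t *\<^sub>R a) has_derivative (\<lambda>t. t *\<^sub>R a)) (at s)"
    by (auto intro!: derivative_eq_intros)
  from has_derivative_compose[OF this, of f f'] assms
  have "((\<lambda>t. f (v + t *\<^sub>R a)) has_derivative (\<lambda>t. f' (t *\<^sub>R a))) (at s)"
    by simp
  moreover have "(\<lambda>t. f' (t *\<^sub>R a)) = (\<lambda>t. t *\<^sub>R f' a)"
    using assms by (simp add: has_derivative_bounded_linear linear_cmul bounded_linear.linear)
  ultimately show ?thesis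
    by (simp add: has_vector_derivative_def)
qed

lemma pderiv_dir_eq:
  assumes "(f has_derivative f') (at v)"
  shows "pderiv_dir a f v = f' a"
  unfolding pderiv_dir_def
  using has_derivative_line[of f f' v 0 a] assms by (simp add: vector_derivative_at)

text \<open>\<open>pderiv_dir\<close> is a limit along a single line. At a point of
  differentiability these limits assemble into the full derivative, which gives access to the chain
  and product rules of \<open>has_derivative\<close>.\<close>

lemma differentiable_has_derivative:
  assumes "f differentiable (at v)"
  shows "(f has_derivative (\<lambda>h. pderiv_dir h f v)) (at v)"
proof -
  obtain f' where f': "(f has_derivative f') (at v)"
    using assms by (auto simp: differentiable_def)
  then have "f' = (\<lambda>h. pderiv_dir h f v)"
    by (auto simp: pderiv_dir_eq)
  with f' show ?thesis by simp
qed

lemma smooth_has_derivative: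
  "smooth f \<Longrightarrow> (f has_derivative (\<lambda>h. pderiv_dir h f v)) (at v)"
  by (intro differentiable_has_derivative smooth_differentiable)

lemma smooth_has_vector_derivative_line:
  assumes "smooth f"
  shows "((\<lambda>t. f (v + t *\<^sub>R a)) has_vector_derivative pderiv_dir a f (v + s *\<^sub>R a)) (at s within T)"
  using has_derivative_line[OF smooth_has_derivative[OF assms]] has_vector_derivative_at_within
  by blast

lemma linear_pderiv_dir:
  assumes "smooth f"
  shows "linear (\<lambda>h. pderiv_dir h f v)"
  using smooth_has_derivative[OF assms] has_derivative_linear by blast

text \<open>The product rule leaves one factor undifferentiated, so \<open>C_k_mult\<close> has to
  descend from \<open>Suc k\<close> to \<open>k\<close>.\<close>

lemma C_k_Suc_D: "C_k (Suc k) f \<Longrightarrow> C_k k f"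
proof (induction k arbitrary: f)
  case 0
  then show ?case
    by (auto intro!: differentiable_imp_continuous_on simp: differentiable_on_def differentiable_at_withinI)
next
  case (Suc k)
  then show ?case by (meson C_k.simps(2))
qed

lemma C_k_add: "C_k k f \<Longrightarrow> C_k k g \<Longrightarrow> C_k k (\<lambda>v. f v + g v)"
proof (induction k arbitrary: f g)
  case 0
  then show ?case by (auto intro: continuous_intros)
next
  case (Suc k)
  have "pderiv_dir a (\<lambda>v. f v + g v) = (\<lambda>v. pderiv_dir a f v + pderiv_dir a g v)" for a
    using Suc.prems by (auto intro!: pderiv_dir_eq has_derivative_add differentiable_has_derivative)
  with Suc show ?case by auto
qed

lemma C_k_mult: "C_k k f \<Longrightarrow> C_k k g \<Longrightarrow> C_k k (\<lambda>v. f v * g v)"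
proof (induction k arbitrary: f g)
  case 0
  then show ?case by (auto intro: continuous_intros)
next
  case (Suc k)
  have *: "pderiv_dir a (\<lambda>v. f v * g v) = (\<lambda>v. f v * pderiv_dir a g v + pderiv_dir a f v * g v)" for a
    using Suc.prems by (auto intro!: pderiv_dir_eq has_derivative_mult differentiable_has_derivative)
  have "C_k k (\<lambda>v. f v * pderiv_dir a g v)" "C_k k (\<lambda>v. pderiv_dir a f v * g v)" for a
    using Suc.prems Suc.IH C_k_Suc_D by (metis C_k.simps(2))+
  with Suc.prems show ?case
    by (auto simp: * intro!: C_k_add)
qed

lemma smooth_add: "smooth f \<Longrightarrow> smooth g \<Longrightarrow> smooth (\<lambda>v. f v + g v)"
  by (simp add: smooth_def C_k_add)

lemma smooth_mult: "smooth f \<Longrightarrow> smooth g \<Longrightarrow> smooth (\<lambda>v. f v * g v)"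
  by (simp add: smooth_def C_k_mult)

lemma pderiv_dir_diff:
  "smooth f \<Longrightarrow> smooth g \<Longrightarrow> pderiv_dir a (\<lambda>v. f v - g v) v = pderiv_dir a f v - pderiv_dir a g v"
  by (auto intro!: pderiv_dir_eq has_derivative_diff smooth_has_derivative)

lemma pderiv_dir_mult:
  "smooth f \<Longrightarrow> smooth g \<Longrightarrow>
    pderiv_dir a (\<lambda>v. f v * g v) v = f v * pderiv_dir a g v + pderiv_dir a f v * g v"
  by (auto intro!: pderiv_dir_eq has_derivative_mult smooth_has_derivative)

lemma pderiv_dir_const: "pderiv_dir a (\<lambda>_. c) v = 0"
  by (rule pderiv_dir_eq) (rule has_derivative_const)

lemma smooth_const: "smooth (\<lambda>_. c)"
proof (rule smooth_coinduct[where F = "range (\<lambda>c _. c)"])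
  fix g :: "'a \<Rightarrow> complex" and a assume "g \<in> range (\<lambda>c _. c)"
  then have "pderiv_dir a g = (\<lambda>_. 0)"
    by (auto simp: pderiv_dir_const)
  then show "pderiv_dir a g \<in> range (\<lambda>c _. c)" by auto
qed auto

lemma smooth_diff: "smooth f \<Longrightarrow> smooth g \<Longrightarrow> smooth (\<lambda>v. f v - g v)"
  using smooth_add[of f "\<lambda>v. (-1) * g v"] smooth_mult[OF smooth_const[of "-1"], of g] by simp

lemma smooth_cmult: "smooth f \<Longrightarrow> smooth (\<lambda>v. c * f v)"
  by (intro smooth_mult smooth_const)

lemma smooth_sum: "(\<And>i. i \<in> A \<Longrightarrow> smooth (f i)) \<Longrightarrow> smooth (\<lambda>v. \<Sum>i\<in>A. f i v)"
  by (induction A rule: infinite_finite_induct) (auto intro: smooth_const smooth_add)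

lemma pderiv_dir_bounded_linear: "bounded_linear g \<Longrightarrow> pderiv_dir a g v = g a"
  by (rule pderiv_dir_eq) (rule bounded_linear_imp_has_derivative)

lemma smooth_bounded_linear:
  assumes "bounded_linear g"
  shows "smooth g"
proof (rule smooth_coinduct[where F = "insert g (range (\<lambda>c _. c))"])
  fix h a assume "h \<in> insert g (range (\<lambda>c _. c))"
  then have "pderiv_dir a h = (\<lambda>_. g a) \<or> pderiv_dir a h = (\<lambda>_. 0)"
    using pderiv_dir_bounded_linear[OF assms] by (auto simp: pderiv_dir_const)
  then show "pderiv_dir a h \<in> insert g (range (\<lambda>c _. c))" by auto
qed (auto intro: bounded_linear_imp_differentiable assms)

lemma pderiv_dir_affine:
  assumes "smooth f"
  shows "pderiv_dir a (\<lambda>v. f (s *\<^sub>R v + w)) v = of_real s * pderiv_dir a f (s *\<^sub>R v + w)"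
    and "(\<lambda>v. f (s *\<^sub>R v + w)) differentiable (at v)"
proof -
  have 1: "((\<lambda>v. s *\<^sub>R v + w) has_derivative (\<lambda>h. s *\<^sub>R h)) (at v)"
    by (auto intro!: derivative_eq_intros)
  have 2: "((\<lambda>v. f (s *\<^sub>R v + w)) has_derivative (\<lambda>h. pderiv_dir (s *\<^sub>R h) f (s *\<^sub>R v + w))) (at v)"
    using has_derivative_compose[OF 1 smooth_has_derivative[OF assms]] by simp
  then show "(\<lambda>v. f (s *\<^sub>R v + w)) differentiable (at v)"
    by (auto simp: differentiable_def)
  show "pderiv_dir a (\<lambda>v. f (s *\<^sub>R v + w)) v = of_real s * pderiv_dir a f (s *\<^sub>R v + w)"
    using pderiv_dir_eq[OF 2] linear_cmul[OF linear_pderiv_dir[OF assms]]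
    by (simp add: scaleR_conv_of_real)
qed

lemma smooth_affine:
  assumes "smooth f"
  shows "smooth (\<lambda>v. f (s *\<^sub>R v + w))"
proof (rule smooth_coinduct[where F = "{\<lambda>v. g (s *\<^sub>R v + w) |g. smooth g}"])
  fix h a assume "h \<in> {\<lambda>v. g (s *\<^sub>R v + w) |g. smooth g}"
  then obtain g where g: "smooth g" "h = (\<lambda>v. g (s *\<^sub>R v + w))" by auto
  have "pderiv_dir a h = (\<lambda>v. (\<lambda>v. of_real s * pderiv_dir a g v) (s *\<^sub>R v + w))"
    using g by (auto simp: pderiv_dir_affine)
  moreover have "smooth (\<lambda>v. of_real s * pderiv_dir a g v)"
    using g by (intro smooth_cmult smooth_pderiv_dir)
  ultimately have "\<exists>g. pderiv_dir a h = (\<lambda>v. g (s *\<^sub>R v + w)) \<and> smooth g" by fast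
  then show "pderiv_dir a h \<in> {\<lambda>v. g (s *\<^sub>R v + w) |g. smooth g}" by simp
qed (use assms in \<open>auto intro: pderiv_dir_affine\<close>)

lemma smooth_translate: "smooth f \<Longrightarrow> smooth (\<lambda>v. f (v + w))"
  using smooth_affine[of f 1 w] by simp

lemma pderiv_dir_translate: "smooth f \<Longrightarrow> pderiv_dir a (\<lambda>v. f (v + w)) v = pderiv_dir a f (v + w)"
  using pderiv_dir_affine(1)[of f a 1 w] by simp

lemma smooth_nabla: "smooth f \<Longrightarrow> smooth (nabla a f)"
  using smooth_diff[OF _ smooth_translate[of f "-a"]] by (simp add: nabla_def[abs_def])

lemma pderiv_dir_nabla: "smooth f \<Longrightarrow> pderiv_dir b (nabla a f) = nabla a (pderiv_dir b f)"
  using smooth_translate[of f "-a"] pderiv_dir_translate[of f b "-a"]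
  by (auto simp: nabla_def[abs_def] pderiv_dir_diff)

lemma smooth_pderivs: "smooth f \<Longrightarrow> smooth (pderivs Y f)"
  by (induction Y) (auto simp: pderivs_def intro: smooth_pderiv_dir)

lemma smooth_nablas: "smooth f \<Longrightarrow> smooth (nablas Y f)"
  by (induction Y) (auto simp: nablas_def intro: smooth_nabla)

section \<open>Exponential characters\<close>

definition echar :: "('a::euclidean_space \<Rightarrow>\<^sub>L real) \<Rightarrow> 'a \<Rightarrow> complex" where
  "echar \<gamma> v = exp (2 * \<i> * of_real pi * of_real (blinfun_apply \<gamma> v))"

lemma echar_has_derivative:
  "(echar \<gamma> has_derivative (\<lambda>h. 2 * \<i> * of_real pi * of_real (blinfun_apply \<gamma> h) * echar \<gamma> v)) (at v)"
proof -
  have 1: "((\<lambda>v. 2 * \<i> * of_real pi * of_real (blinfun_apply \<gamma> v)) has_derivative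
      (\<lambda>h. 2 * \<i> * of_real pi * of_real (blinfun_apply \<gamma> h))) (at v)"
    by (intro bounded_linear_imp_has_derivative bounded_linear_const_mult
        bounded_linear_compose[OF bounded_linear_of_real] blinfun.bounded_linear_right)
  have 2: "(exp has_derivative (*) (exp (2 * \<i> * of_real pi * of_real (blinfun_apply \<gamma> v))))
      (at (2 * \<i> * of_real pi * complex_of_real (blinfun_apply \<gamma> v)))"
    using DERIV_exp has_field_derivative_def by blast
  show ?thesis
    using has_derivative_compose[OF 1 2] by (simp add: echar_def[abs_def] mult_ac)
qed

lemma pderiv_dir_echar:
  "pderiv_dir a (echar \<gamma>) v = 2 * \<i> * of_real pi * of_real (blinfun_apply \<gamma> a) * echar \<gamma> v"
  by (rule pderiv_dir_eq) (rule echar_has_derivative)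

lemma smooth_echar: "smooth (echar \<gamma>)"
proof -
  have der: "((\<lambda>v. c * echar \<gamma> v) has_derivative
      (\<lambda>h. c * (2 * \<i> * of_real pi * of_real (blinfun_apply \<gamma> h) * echar \<gamma> v))) (at v)" for c v
    by (intro has_derivative_mult_right echar_has_derivative)
  show ?thesis
  \<comment> \<open>Characters are joint eigenfunctions of all directional derivatives, so the
    multiples of one character form a closed family.\<close>
  proof (rule smooth_coinduct[where F = "range (\<lambda>c v. c * echar \<gamma> v)"])
    show "echar \<gamma> \<in> range (\<lambda>c v. c * echar \<gamma> v)"
      by (auto intro!: image_eqI[of _ _ 1])
  next
    fix g :: "'a \<Rightarrow> complex" and v assume "g \<in> range (\<lambda>c v. c * echar \<gamma> v)"
    then show "g differentiable (at v)"
      using der by (auto simp: differentiable_def)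
  next
    fix g :: "'a \<Rightarrow> complex" and a assume "g \<in> range (\<lambda>c v. c * echar \<gamma> v)"
    then obtain c where "g = (\<lambda>v. c * echar \<gamma> v)" by auto
    then have "pderiv_dir a g = (\<lambda>v. (c * (2 * \<i> * of_real pi * of_real (blinfun_apply \<gamma> a))) * echar \<gamma> v)"
      using pderiv_dir_eq[OF der] by (auto simp: mult_ac)
    then show "pderiv_dir a g \<in> range (\<lambda>c v. c * echar \<gamma> v)"
      by (rule image_eqI) simp
  qed
qed

lemma echar_add: "echar \<gamma> (v + w) = echar \<gamma> v * echar \<gamma> w"
  by (simp add: echar_def blinfun.add_right distrib_left exp_add)

lemma echar_plus: "echar (\<gamma> + \<delta>) v = echar \<gamma> v * echar \<delta> v"
  by (simp add: echar_def blinfun.add_left distrib_left exp_add)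

lemma echar_zero [simp]: "echar 0 v = 1"
  by (simp add: echar_def)

lemma echar_Ints:
  assumes "blinfun_apply \<gamma> l \<in> \<int>"
  shows "echar \<gamma> l = 1"
proof -
  obtain k where "blinfun_apply \<gamma> l = of_int k" using assms by (auto elim: Ints_cases)
  then show ?thesis
    by (simp add: echar_def exp_eq_1)
qed

lemma norm_echar [simp]: "norm (echar \<gamma> v) = 1"
  by (simp add: echar_def norm_exp_eq_Re)

lemma cnj_echar: "cnj (echar \<gamma> v) = echar (- \<gamma>) v"
  by (simp add: echar_def exp_cnj blinfun.minus_left)

section \<open>Averages along segments\<close>

text \<open>The box spline of \<open>[b]\<close> acting on the test function side. The average runs
  from \<open>v\<close> to \<open>v + b\<close>, so on densities the same operation goes along
  \<open>- b\<close>.\<close>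

definition avg :: "'a::euclidean_space \<Rightarrow> ('a \<Rightarrow> complex) \<Rightarrow> 'a \<Rightarrow> complex" where
  "avg b F v = integral {0..1} (\<lambda>t. F (v + t *\<^sub>R b))"

text \<open>Correlation of the box spline of \<open>Y\<close> with \<open>F\<close>. Keeping the
  base point variable makes it possible to differentiate, translate and integrate in it.\<close>

definition spl :: "'a::euclidean_space list \<Rightarrow> ('a \<Rightarrow> complex) \<Rightarrow> 'a \<Rightarrow> complex" where
  "spl Y F = foldr avg Y F"

lemma spl_simps [simp]: "spl [] F = F" "spl (b # Y) F = avg b (spl Y F)"
  by (simp_all add: spl_def)

text \<open>Bridge from the pairings of the statement to \<open>spl\<close>: through it
  \<open>conv_d\<close> and \<open>conv_c\<close> become a lattice sum and an integral against
  \<open>spl Y \<phi>\<close>.\<close>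

lemma box_spline_shift: "box_spline Y (\<lambda>w. F (v + w)) = spl Y F v"
proof (induction Y arbitrary: v)
  case (Cons b Y)
  have "box_spline Y (\<lambda>w. F (v + (t *\<^sub>R b + w))) = spl Y F (v + t *\<^sub>R b)" for t
    using Cons[of "v + t *\<^sub>R b"] by (simp add: add.assoc)
  then show ?case by (simp add: avg_def)
qed simp

lemma continuous_on_avg:
  assumes "continuous_on UNIV F"
  shows "continuous_on S (avg b F)"
proof -
  have "continuous_on (UNIV \<times> cbox 0 1) (\<lambda>(v, t). F (v + t *\<^sub>R b))"
    using continuous_on_compose2[OF assms]
    by (auto intro!: continuous_intros continuous_on_compose2[OF assms] simp: case_prod_beta)
  from integral_continuous_on_param[OF this]
  have "continuous_on UNIV (avg b F)"
    by (simp add: avg_def[abs_def])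
  then show ?thesis by (rule continuous_on_subset) simp
qed

lemma continuous_on_spl: "continuous_on UNIV F \<Longrightarrow> continuous_on UNIV (spl Y F)"
  by (induction Y) (auto intro: continuous_on_avg)

lemma continuous_on_line:
  fixes F :: "'a::real_normed_vector \<Rightarrow> 'b::topological_space"
  assumes "continuous_on UNIV F"
  shows "continuous_on S (\<lambda>t. F (v + t *\<^sub>R b))"
  by (intro continuous_on_compose2[OF assms] continuous_intros) auto

lemma avg_integrable:
  fixes F :: "'a::euclidean_space \<Rightarrow> complex"
  assumes "continuous_on UNIV F"
  shows "(\<lambda>t. F (v + t *\<^sub>R b)) integrable_on {0..1}"
  by (intro integrable_continuous_interval continuous_on_line assms)

lemma avg_swap:
  assumes "continuous_on UNIV F"
  shows "avg a (avg b F) = avg b (avg a F)"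
proof
  fix v
  have "continuous_on (cbox (0::real, 0::real) (1, 1)) (\<lambda>(s, t). F (v + s *\<^sub>R a + t *\<^sub>R b))"
    by (auto intro!: continuous_intros continuous_on_compose2[OF assms] simp: case_prod_beta)
  from integral_swap_continuous[OF this]
  have "integral {0..1} (\<lambda>s. integral {0..1} (\<lambda>t. F (v + s *\<^sub>R a + t *\<^sub>R b))) =
        integral {0..1} (\<lambda>t. integral {0..1} (\<lambda>s. F (v + s *\<^sub>R a + t *\<^sub>R b)))"
    by simp
  then show "avg a (avg b F) v = avg b (avg a F) v"
    by (simp add: avg_def add_ac)
qed

lemma avg_add:
  assumes "continuous_on UNIV F" "continuous_on UNIV G"
  shows "avg b (\<lambda>v. F v + G v) v = avg b F v + avg b G v"
  unfolding avg_def by (intro Henstock_Kurzweil_Integration.integral_add avg_integrable assms)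

lemma avg_cmult: "avg b (\<lambda>v. c * F v) v = c * avg b F v"
  unfolding avg_def by simp

lemma avg_translate: "avg b (\<lambda>v. F (v + w)) v = avg b F (v + w)"
  unfolding avg_def by (simp add: add_ac)

lemma spl_add:
  assumes "continuous_on UNIV F" "continuous_on UNIV G"
  shows "spl Y (\<lambda>v. F v + G v) = (\<lambda>v. spl Y F v + spl Y G v)"
  by (induction Y) (auto simp: avg_add continuous_on_spl assms)

lemma spl_cmult: "spl Y (\<lambda>v. c * F v) = (\<lambda>v. c * spl Y F v)"
  by (induction Y) (auto simp: avg_cmult)

lemma spl_translate: "spl Y (\<lambda>v. F (v + w)) = (\<lambda>v. spl Y F (v + w))"
  by (induction Y) (auto simp: avg_translate)

lemma spl_sum:
  "finite A \<Longrightarrow> (\<And>i. i \<in> A \<Longrightarrow> continuous_on UNIV (F i)) \<Longrightarrow>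
    spl Y (\<lambda>v. \<Sum>i\<in>A. F i v) = (\<lambda>v. \<Sum>i\<in>A. spl Y (F i) v)"
proof (induction A rule: finite_induct)
  case empty
  then show ?case using spl_cmult[of Y 0 "\<lambda>_. 0"] by simp
next
  case (insert i A)
  then show ?case by (simp add: spl_add continuous_on_sum)
qed

lemma spl_append_Cons:
  assumes "continuous_on UNIV F"
  shows "spl (Y @ b # Z) F = avg b (spl (Y @ Z) F)"
  by (induction Y) (auto simp: avg_swap continuous_on_spl assms)

text \<open>By Fubini a box spline depends on the multiset only. \<open>nths\<close> orders vectors
  by index, while the inductions pull out one chosen vector; this is how it is moved to the
  front.\<close>

lemma spl_mset:
  assumes "continuous_on UNIV F" "mset Y = mset Z"
  shows "spl Y F = spl Z F"
  using assms(2)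
proof (induction Y arbitrary: Z)
  case (Cons b Y)
  then have "b \<in> set Z" by (metis list.set_intros(1) set_mset_mset)
  then obtain Z1 Z2 where Z: "Z = Z1 @ b # Z2" by (meson split_list)
  with Cons have "spl Y F = spl (Z1 @ Z2) F" by auto
  then show ?case by (simp add: Z spl_append_Cons assms)
qed simp

lemma avg_has_derivative:
  assumes "smooth F"
  shows "(avg b F has_derivative (\<lambda>h. avg b (pderiv_dir h F) v)) (at v)"
proof -
  \<comment> \<open>The Leibniz rule asks for the derivative as a continuous map into bounded linear
    maps; in finite dimension continuity can be checked direction by direction.\<close>
  define D where "D x = Blinfun (\<lambda>h. pderiv_dir h F x)" for x
  have D: "blinfun_apply (D x) = (\<lambda>h. pderiv_dir h F x)" for x :: 'a
    unfolding D_def using smooth_has_derivative[OF assms]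
    by (intro bounded_linear_Blinfun_apply has_derivative_bounded_linear)
  have cD: "continuous_on UNIV D"
    by (intro continuous_on_blinfun_componentwise)
      (simp add: D smooth_continuous_on smooth_pderiv_dir assms)
  have line: "((\<lambda>x. x + t *\<^sub>R b) has_derivative (\<lambda>h. h)) (at x)" for t x
    by (auto intro!: derivative_eq_intros)
  have cont: "continuous_on (UNIV \<times> cbox (0::real) 1) (\<lambda>(x, t). D (x + t *\<^sub>R b))"
    by (auto intro!: continuous_intros continuous_on_compose2[OF cD] simp: case_prod_beta)
  have "((\<lambda>x. integral (cbox 0 1) (\<lambda>t. F (x + t *\<^sub>R b))) has_derivative
      blinfun_apply (integral (cbox 0 1) (\<lambda>t. D (v + t *\<^sub>R b)))) (at v within UNIV)"
  proof (rule leibniz_rule[OF _ _ cont])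
    show "((\<lambda>x. F (x + t *\<^sub>R b)) has_derivative blinfun_apply (D (x + t *\<^sub>R b))) (at x)" for x t
      using has_derivative_compose[OF line smooth_has_derivative[OF assms]] by (simp add: D)
    show "(\<lambda>t. F (x + t *\<^sub>R b)) integrable_on cbox 0 1" for x
      using avg_integrable smooth_continuous_on[OF assms] by auto
  qed auto
  moreover have "blinfun_apply (integral (cbox 0 1) (\<lambda>t. D (v + t *\<^sub>R b))) = (\<lambda>h. avg b (pderiv_dir h F) v)"
  proof
    fix h
    have "(\<lambda>t. D (v + t *\<^sub>R b)) integrable_on cbox 0 1"
      using continuous_on_line[OF cD, of _ v b] by (intro integrable_continuous)
    then show "blinfun_apply (integral (cbox 0 1) (\<lambda>t. D (v + t *\<^sub>R b))) h = avg b (pderiv_dir h F) v"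
      using blinfun_apply_integral[of "\<lambda>t. D (v + t *\<^sub>R b)" "cbox 0 1" h]
      by (simp add: D avg_def)
  qed
  ultimately show ?thesis
    by (simp add: avg_def[abs_def])
qed

lemma pderiv_dir_avg: "smooth F \<Longrightarrow> pderiv_dir a (avg b F) = avg b (pderiv_dir a F)"
  by (auto intro!: pderiv_dir_eq avg_has_derivative)

lemma smooth_avg:
  assumes "smooth F"
  shows "smooth (avg b F)"
proof (rule smooth_coinduct[where F = "{avg b g |g. smooth g}"])
  show "g differentiable (at v)" if "g \<in> {avg b g |g. smooth g}" for g v
    using that avg_has_derivative by (auto simp: differentiable_def)
qed (use assms in \<open>auto simp: pderiv_dir_avg intro: smooth_pderiv_dir\<close>)

lemma smooth_spl: "smooth F \<Longrightarrow> smooth (spl Y F)"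
  by (induction Y) (auto intro: smooth_avg)

text \<open>The fundamental theorem of calculus on the segment. On the test function side the
  difference is a forward one; it becomes the backward \<open>nabla\<close> after a change of
  variables.\<close>

lemma avg_pderiv_dir:
  assumes "smooth F"
  shows "avg b (pderiv_dir b F) v = F (v + b) - F v"
proof -
  have "((\<lambda>t. pderiv_dir b F (v + t *\<^sub>R b)) has_integral (F (v + 1 *\<^sub>R b) - F (v + 0 *\<^sub>R b))) {0..1}"
    by (rule fundamental_theorem_of_calculus)
      (auto intro: smooth_has_vector_derivative_line assms)
  then show ?thesis
    by (simp add: avg_def integral_unique)
qed

lemma pderiv_dir_spl: "smooth F \<Longrightarrow> pderiv_dir a (spl Y F) = spl Y (pderiv_dir a F)"
  by (induction Y) (auto simp: pderiv_dir_avg smooth_spl)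

section \<open>Bounded supports and test functions\<close>

definition bsupp :: "('a::euclidean_space \<Rightarrow> complex) \<Rightarrow> bool" where
  "bsupp F \<longleftrightarrow> (\<exists>R. \<forall>v. norm v > R \<longrightarrow> F v = 0)"

lemma test_fun_iff: "test_fun F \<longleftrightarrow> smooth F \<and> bsupp F"
proof -
  have "bounded {v. F v \<noteq> 0} \<longleftrightarrow> bsupp F"
    unfolding bounded_iff bsupp_def by (auto simp: not_less[symmetric])
  then show ?thesis
    by (simp add: test_fun_def compact_closure)
qed

lemma bsupp_mult_left: "bsupp F \<Longrightarrow> bsupp (\<lambda>v. G v * F v)"
  by (auto simp: bsupp_def)

lemma bsupp_mult_right: "bsupp F \<Longrightarrow> bsupp (\<lambda>v. F v * G v)"
  by (auto simp: bsupp_def)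

lemma bsupp_add: "bsupp F \<Longrightarrow> bsupp G \<Longrightarrow> bsupp (\<lambda>v. F v + G v)"
  unfolding bsupp_def
proof (elim exE)
  fix R S assume "\<forall>v. norm v > R \<longrightarrow> F v = 0" "\<forall>v. norm v > S \<longrightarrow> G v = 0"
  then show "\<exists>R. \<forall>v. norm v > R \<longrightarrow> F v + G v = 0"
    by (intro exI[of _ "max R S"]) auto
qed

lemma bsupp_shift:
  assumes "\<forall>v. norm v > R \<longrightarrow> F v = 0" "norm v > R + norm w"
  shows "F (v + w) = 0"
proof -
  have "norm v \<le> norm (v + w) + norm w"
    by (metis add_diff_cancel norm_triangle_ineq4)
  with assms show ?thesis by auto
qed

lemma bsupp_translate: "bsupp F \<Longrightarrow> bsupp (\<lambda>v. F (v + w))"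
  unfolding bsupp_def using bsupp_shift[of _ F w] by meson

lemma bsupp_avg:
  assumes "bsupp F"
  shows "bsupp (avg b F)"
proof -
  obtain R where R: "\<forall>v. norm v > R \<longrightarrow> F v = 0" using assms by (auto simp: bsupp_def)
  have "avg b F v = 0" if "norm v > R + norm b" for v
  proof -
    have "F (v + t *\<^sub>R b) = 0" if "t \<in> {0..1}" for t
    proof (rule bsupp_shift[OF R])
      have "\<bar>t\<bar> * norm b \<le> norm b" using that by (simp add: mult_left_le_one_le)
      then show "norm v > R + norm (t *\<^sub>R b)" using \<open>norm v > R + norm b\<close> by simp
    qed
    then have "avg b F v = integral {0..1} (\<lambda>t::real. 0)"
      unfolding avg_def by (intro Henstock_Kurzweil_Integration.integral_cong) auto
    then show ?thesis by simp
  qed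
  then show ?thesis unfolding bsupp_def by blast
qed

lemma bsupp_spl: "bsupp F \<Longrightarrow> bsupp (spl Y F)"
  by (induction Y) (auto intro: bsupp_avg)

lemma bsupp_pderiv_dir:
  assumes "bsupp F"
  shows "bsupp (pderiv_dir a F)"
proof -
  obtain R where R: "\<And>v. norm v > R \<Longrightarrow> F v = 0" using assms by (auto simp: bsupp_def)
  have "pderiv_dir a F v = 0" if "norm v > R" for v
  proof -
    \<comment> \<open>The exterior of the closed ball is open, so \<open>F\<close> vanishes near
      \<open>v\<close> and not just at \<open>v\<close>.\<close>
    have ev: "\<forall>\<^sub>F x in nhds v. F x = 0"
      using eventually_nhds_in_open[of "- cball 0 R" v] that
      by (auto elim!: eventually_mono intro: R simp: open_Compl)
    then have "(F has_derivative (\<lambda>_. 0)) (at v)"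
      using has_derivative_transform_eventually[of "\<lambda>_. 0" "\<lambda>_. 0" v UNIV F] R[OF that]
      by (auto simp: eventually_nhds_conv_at elim!: eventually_mono)
    then show ?thesis by (rule pderiv_dir_eq)
  qed
  then show ?thesis unfolding bsupp_def by blast
qed

lemma test_fun_spl: "test_fun F \<Longrightarrow> test_fun (spl Y F)"
  by (auto simp: test_fun_iff intro: smooth_spl bsupp_spl)

lemma test_fun_mult: "smooth G \<Longrightarrow> test_fun F \<Longrightarrow> test_fun (\<lambda>v. G v * F v)"
  by (auto simp: test_fun_iff intro: smooth_mult bsupp_mult_left)

lemma test_fun_pderiv_dir: "test_fun F \<Longrightarrow> test_fun (pderiv_dir a F)"
  by (auto simp: test_fun_iff intro: smooth_pderiv_dir bsupp_pderiv_dir)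

lemma test_fun_translate: "test_fun F \<Longrightarrow> test_fun (\<lambda>v. F (v + w))"
  by (auto simp: test_fun_iff intro: smooth_translate bsupp_translate)

section \<open>Coordinates with respect to a basis\<close>

text \<open>Packaged as an element of the dual space: the same object then serves as a coordinate,
  as a continuous function and, for a lattice basis, as a frequency.\<close>

definition coord :: "'a::euclidean_space set \<Rightarrow> 'a \<Rightarrow> 'a \<Rightarrow>\<^sub>L real" where
  "coord B b = Blinfun (\<lambda>v. representation B v b)"

lemma coord_apply:
  assumes "independent B" "span B = UNIV"
  shows "coord B b v = representation B v b"
proof -
  have "linear (\<lambda>v. representation B v b)"
    by (rule linearI) (simp_all add: assms real_vector.representation_add real_vector.representation_scale)
  then show ?thesis
    unfolding coord_def by (subst bounded_linear_Blinfun_apply) (auto simp: linear_conv_bounded_linear)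
qed

lemma coord_sum:
  assumes "independent B" "span B = UNIV"
  shows "(\<Sum>b\<in>B. coord B b v *\<^sub>R b) = v"
  using real_vector.sum_representation_eq[of B v B] assms
  by (simp add: coord_apply independent_imp_finite)

lemma coord_basis:
  assumes "independent B" "span B = UNIV" "c \<in> B"
  shows "coord B b c = (if b = c then 1 else 0)"
  using assms by (simp add: coord_apply real_vector.representation_basis)

lemma coord_comb:
  assumes "independent B" "span B = UNIV" "b \<in> B"
  shows "coord B b (\<Sum>c\<in>B. x c *\<^sub>R c) = x b"
proof -
  have "coord B b (\<Sum>c\<in>B. x c *\<^sub>R c) = (\<Sum>c\<in>B. x c * (if b = c then 1 else 0))"
    using assms by (simp add: blinfun.sum_right blinfun.scaleR_right coord_basis)
  also have "\<dots> = x b"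
    using assms independent_imp_finite[OF assms(1)] by (simp add: if_distrib cong: if_cong)
  finally show ?thesis .
qed

lemma coord_bounded:
  assumes "independent B" "span B = UNIV" "\<And>v b. v \<in> S \<Longrightarrow> b \<in> B \<Longrightarrow> \<bar>coord B b v\<bar> \<le> R"
  shows "bounded S"
proof -
  have "norm v \<le> (\<Sum>b\<in>B. R * norm b)" if "v \<in> S" for v
  proof -
    have "norm v = norm (\<Sum>b\<in>B. coord B b v *\<^sub>R b)"
      using coord_sum[OF assms(1,2)] by simp
    also have "\<dots> \<le> (\<Sum>b\<in>B. \<bar>coord B b v\<bar> * norm b)"
      by (rule order_trans[OF norm_sum]) simp
    also have "\<dots> \<le> (\<Sum>b\<in>B. R * norm b)"
      using assms(3)[OF that] by (intro sum_mono mult_right_mono) auto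
    finally show ?thesis .
  qed
  then show ?thesis by (auto simp: bounded_iff)
qed

section \<open>The lattice and its measure\<close>

locale euclidean_lattice =
  fixes \<Lambda> :: "'a::euclidean_space set"
  assumes is_lattice: "is_lattice \<Lambda>"
begin

text \<open>The choice made inside \<open>covolume\<close>, so that \<open>fd\<close> below is
  exactly the parallelepiped measured there.\<close>

definition Bs :: "'a set" where "Bs = (SOME B. lattice_basis \<Lambda> B)"

abbreviation crd :: "'a \<Rightarrow> 'a \<Rightarrow>\<^sub>L real" where "crd b \<equiv> coord Bs b"

lemma lattice_basis_Bs: "lattice_basis \<Lambda> Bs"
  using is_lattice someI_ex unfolding is_lattice_def Bs_def by metis

lemma Bs: "independent Bs" "span Bs = UNIV" "finite Bs"
  using lattice_basis_Bs independent_imp_finite by (auto simp: lattice_basis_def)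

lemma lattice_iff: "l \<in> \<Lambda> \<longleftrightarrow> (\<forall>b\<in>Bs. crd b l \<in> \<int>)"
proof
  assume "l \<in> \<Lambda>"
  then obtain c :: "'a \<Rightarrow> int" where "l = (\<Sum>b\<in>Bs. of_int (c b) *\<^sub>R b)"
    using lattice_basis_Bs by (auto simp: lattice_basis_def)
  then show "\<forall>b\<in>Bs. crd b l \<in> \<int>"
    using coord_comb[OF Bs(1,2)] by simp
next
  assume l: "\<forall>b\<in>Bs. crd b l \<in> \<int>"
  then have "l = (\<Sum>b\<in>Bs. of_int \<lfloor>crd b l\<rfloor> *\<^sub>R b)"
    using coord_sum[OF Bs(1,2), of l] by (simp cong: sum.cong)
  then show "l \<in> \<Lambda>"
    using lattice_basis_Bs by (auto simp: lattice_basis_def)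
qed

lemma lattice_add: "l \<in> \<Lambda> \<Longrightarrow> m \<in> \<Lambda> \<Longrightarrow> l + m \<in> \<Lambda>"
  and lattice_diff: "l \<in> \<Lambda> \<Longrightarrow> m \<in> \<Lambda> \<Longrightarrow> l - m \<in> \<Lambda>"
  and lattice_minus: "l \<in> \<Lambda> \<Longrightarrow> - l \<in> \<Lambda>"
  by (auto simp: lattice_iff blinfun.zero_right blinfun.add_right blinfun.diff_right blinfun.minus_right)

lemma lattice_scale: "l \<in> \<Lambda> \<Longrightarrow> of_int k *\<^sub>R l \<in> \<Lambda>"
  by (auto simp: lattice_iff blinfun.scaleR_right)

lemma dual_lattice_iff: "\<gamma> \<in> dual_lattice \<Lambda> \<longleftrightarrow> (\<forall>b\<in>Bs. blinfun_apply \<gamma> b \<in> \<int>)"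
proof
  assume "\<gamma> \<in> dual_lattice \<Lambda>"
  moreover have "Bs \<subseteq> \<Lambda>"
    using coord_basis[OF Bs(1,2)] by (auto simp: lattice_iff)
  ultimately show "\<forall>b\<in>Bs. blinfun_apply \<gamma> b \<in> \<int>"
    by (auto simp: dual_lattice_def)
next
  assume *: "\<forall>b\<in>Bs. blinfun_apply \<gamma> b \<in> \<int>"
  have "blinfun_apply \<gamma> l \<in> \<int>" if "l \<in> \<Lambda>" for l
  proof -
    have "blinfun_apply \<gamma> l = blinfun_apply \<gamma> (\<Sum>b\<in>Bs. crd b l *\<^sub>R b)"
      by (simp add: coord_sum Bs)
    also have "\<dots> = (\<Sum>b\<in>Bs. crd b l * blinfun_apply \<gamma> b)"
      by (simp add: blinfun.sum_right blinfun.scaleR_right)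
    also have "\<dots> \<in> \<int>"
      using * that by (intro Ints_sum Ints_mult) (auto simp: lattice_iff)
    finally show ?thesis .
  qed
  then show "\<gamma> \<in> dual_lattice \<Lambda>" by (auto simp: dual_lattice_def)
qed

lemma crd_dual: "b \<in> Bs \<Longrightarrow> crd b \<in> dual_lattice \<Lambda>"
  using coord_basis[OF Bs(1,2)] by (auto simp: dual_lattice_iff)

lemma dual_zero: "0 \<in> dual_lattice \<Lambda>"
  and dual_add: "\<gamma> \<in> dual_lattice \<Lambda> \<Longrightarrow> \<delta> \<in> dual_lattice \<Lambda> \<Longrightarrow> \<gamma> + \<delta> \<in> dual_lattice \<Lambda>"
  and dual_minus: "\<gamma> \<in> dual_lattice \<Lambda> \<Longrightarrow> - \<gamma> \<in> dual_lattice \<Lambda>"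
  by (auto simp: dual_lattice_def blinfun.add_left blinfun.minus_left blinfun.diff_left)

lemma echar_lattice: "\<gamma> \<in> dual_lattice \<Lambda> \<Longrightarrow> l \<in> \<Lambda> \<Longrightarrow> echar \<gamma> l = 1"
  by (rule echar_Ints) (auto simp: dual_lattice_def)

lemma echar_periodic: "\<gamma> \<in> dual_lattice \<Lambda> \<Longrightarrow> l \<in> \<Lambda> \<Longrightarrow> echar \<gamma> (v + l) = echar \<gamma> v"
  by (simp add: echar_add echar_lattice)

text \<open>Half open, so that the lattice translates partition the space without overlaps on the
  faces.\<close>

definition fd :: "'a set" where
  "fd = {v. \<forall>b\<in>Bs. 0 \<le> crd b v \<and> crd b v < 1}"

lemma covolume_eq: "covolume \<Lambda> = measure lborel fd"
proof -
  have "{\<Sum>b\<in>Bs. t b *\<^sub>R b |t::'a \<Rightarrow> real. \<forall>b. 0 \<le> t b \<and> t b < 1} = fd"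
  proof (intro equalityI subsetI)
    fix v assume "v \<in> fd"
    then have "v = (\<Sum>b\<in>Bs. (if b \<in> Bs then crd b v else 0) *\<^sub>R b)"
      "\<forall>b. 0 \<le> (if b \<in> Bs then crd b v else 0) \<and>
           (if b \<in> Bs then crd b v else 0) < 1"
      using coord_sum[OF Bs(1,2), of v] by (auto simp: fd_def cong: sum.cong)
    then have "\<exists>t. v = (\<Sum>b\<in>Bs. t b *\<^sub>R b) \<and> (\<forall>b. 0 \<le> t b \<and> t b < 1)"
      by (intro exI[of _ "\<lambda>b. if b \<in> Bs then crd b v else 0"]) simp
    then show "v \<in> {\<Sum>b\<in>Bs. t b *\<^sub>R b |t::'a \<Rightarrow> real. \<forall>b. 0 \<le> t b \<and> t b < 1}"
      by simp
  qed (auto simp: fd_def coord_comb Bs)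
  then show ?thesis by (simp add: covolume_def Bs_def)
qed

lemma bounded_fd: "bounded fd"
  by (rule coord_bounded[OF Bs(1,2), of _ 1]) (auto simp: fd_def)

lemma coord_slab_borel:
  fixes g :: "'i \<Rightarrow> 'a \<Rightarrow>\<^sub>L real"
  assumes "finite A"
  shows "{v. \<forall>b\<in>A. 0 \<le> blinfun_apply (g b) v \<and> blinfun_apply (g b) v < 1} \<in> sets borel"
  using assms
proof (induction A rule: finite_induct)
  case (insert a A)
  have eq: "{v. \<forall>b\<in>insert a A. 0 \<le> blinfun_apply (g b) v \<and> blinfun_apply (g b) v < 1} =
      ({v. 0 \<le> blinfun_apply (g a) v} \<inter> {v. blinfun_apply (g a) v < 1}) \<inter>
      {v. \<forall>b\<in>A. 0 \<le> blinfun_apply (g b) v \<and> blinfun_apply (g b) v < 1}"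
    by auto
  moreover have "closed {v. 0 \<le> blinfun_apply (g a) v}"
    by (intro closed_Collect_le continuous_on_const linear_continuous_on[OF blinfun.bounded_linear_right])
  moreover have "open {v. blinfun_apply (g a) v < 1}"
    by (intro open_Collect_less continuous_on_const linear_continuous_on[OF blinfun.bounded_linear_right])
  ultimately have "({v. 0 \<le> blinfun_apply (g a) v} \<inter> {v. blinfun_apply (g a) v < 1}) \<inter>
      {v. \<forall>b\<in>A. 0 \<le> blinfun_apply (g b) v \<and> blinfun_apply (g b) v < 1} \<in> sets borel"
    using insert.IH by (auto intro: sets.Int)
  then show ?case by (simp only: eq)
qed simp

lemma fd_borel [measurable]: "fd \<in> sets borel"
  unfolding fd_def by (rule coord_slab_borel[OF Bs(3)])

lemma covolume_pos: "0 < covolume \<Lambda>"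
proof -
  let ?U = "{v. \<forall>b\<in>Bs. 0 < crd b v \<and> crd b v < 1}"
  have "?U = (\<Inter>b\<in>Bs. {v. 0 < crd b v} \<inter> {v. crd b v < 1})"
    by auto
  also have "open \<dots>"
    using Bs(3) by (intro open_INT ballI open_Int open_Collect_less continuous_intros) auto
  finally have "open ?U" .
  \<comment> \<open>The centre of the parallelepiped witnesses that its open part is nonempty, hence
    not negligible.\<close>
  moreover have "(\<Sum>b\<in>Bs. (1/2) *\<^sub>R b) \<in> ?U"
  proof (intro CollectI ballI)
    fix b assume "b \<in> Bs"
    then have "crd b (\<Sum>b\<in>Bs. (1/2) *\<^sub>R b) = 1/2"
      using coord_comb[OF Bs(1,2), of _ "\<lambda>_. 1/2"] by simp
    then show "0 < crd b (\<Sum>b\<in>Bs. (1/2) *\<^sub>R b) \<and> crd b (\<Sum>b\<in>Bs. (1/2) *\<^sub>R b) < 1"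
      by simp
  qed
  ultimately have "\<not> negligible ?U"
    using open_not_negligible by blast
  then have "\<not> negligible fd"
    by (rule contrapos_nn) (auto elim!: negligible_subset simp: fd_def less_imp_le)
  then have "emeasure lborel fd \<noteq> 0"
    using negligible_iff_emeasure0[of fd] by simp
  then show ?thesis
    using emeasure_bounded_finite[OF bounded_fd]
    by (simp add: covolume_eq measure_def enn2real_positive_iff zero_less_iff_neq_zero)
qed

lemma sets_dvol [simp, measurable_cong]: "sets (dvol \<Lambda>) = sets borel"
  and space_dvol [simp]: "space (dvol \<Lambda>) = UNIV"
  by (simp_all add: dvol_def)

lemma measurable_dvol [simp]: "measurable (dvol \<Lambda>) M = measurable borel M"
  by (rule measurable_cong_sets) simp_all

text \<open>The density is a positive constant, and a non-measurable function is integrable on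
  neither side.\<close>

lemma integrable_dvol: "integrable (dvol \<Lambda>) F \<longleftrightarrow> integrable lborel F"
  for F :: "'a \<Rightarrow> 'b::{banach, second_countable_topology}"
proof (cases "F \<in> borel_measurable borel")
  case True
  have "integrable (dvol \<Lambda>) F \<longleftrightarrow> integrable lborel (\<lambda>x. (1 / covolume \<Lambda>) *\<^sub>R F x)"
    unfolding dvol_def using covolume_pos True by (subst integrable_density) auto
  moreover have "integrable lborel (\<lambda>x. (1 / covolume \<Lambda>) *\<^sub>R F x) \<longleftrightarrow> integrable lborel F"
    using covolume_pos integrable_scaleR_right[of "covolume \<Lambda>" lborel "\<lambda>x. (1 / covolume \<Lambda>) *\<^sub>R F x"]
    by auto
  ultimately show ?thesis by simp
next
  case False
  then show ?thesis
    by (auto dest!: borel_measurable_integrable)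
qed

lemma integral_dvol:
  fixes F :: "'a \<Rightarrow> 'b::{banach, second_countable_topology}"
  assumes "F \<in> borel_measurable borel"
  shows "(LINT v|dvol \<Lambda>. F v) = (1 / covolume \<Lambda>) *\<^sub>R (LINT v|lborel. F v)"
  unfolding dvol_def using covolume_pos assms by (subst integral_density) auto

lemma integral_dvol_translate:
  fixes F :: "'a \<Rightarrow> 'b::{banach, second_countable_topology}"
  assumes [measurable]: "F \<in> borel_measurable borel"
  shows "(LINT v|dvol \<Lambda>. F (v + w)) = (LINT v|dvol \<Lambda>. F v)"
proof -
  have "(LINT v|lborel. F v) = (LINT v|distr lborel borel ((+) w). F v)"
    by (simp add: lborel_distr_plus)
  also have "\<dots> = (LINT v|lborel. F (v + w))"
    by (subst integral_distr) (auto simp: add.commute)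
  finally show ?thesis by (simp add: integral_dvol)
qed

lemma integrable_dvol_translate:
  fixes F :: "'a \<Rightarrow> 'b::{banach, second_countable_topology}"
  assumes "integrable (dvol \<Lambda>) F"
  shows "integrable (dvol \<Lambda>) (\<lambda>v. F (v + w))"
proof -
  have [measurable]: "F \<in> borel_measurable borel"
    using borel_measurable_integrable[OF assms] by simp
  have "integrable (distr lborel borel ((+) w)) F"
    using assms by (simp add: lborel_distr_plus integrable_dvol)
  then show ?thesis
    by (subst (asm) integrable_distr_eq) (auto simp: add.commute integrable_dvol)
qed

lemma emeasure_dvol_bounded:
  assumes "bounded S"
  shows "emeasure (dvol \<Lambda>) S < \<infinity>"
proof -
  obtain R where "S \<subseteq> cball 0 R" using assms by (auto simp: bounded_iff subset_iff)
  then have "emeasure (dvol \<Lambda>) S \<le> emeasure (dvol \<Lambda>) (cball 0 R)"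
    by (intro emeasure_mono) auto
  also have "\<dots> < \<infinity>"
    using emeasure_lborel_cball_finite[of "0::'a" R]
    by (simp add: dvol_def emeasure_density_const ennreal_mult_less_top)
  finally show ?thesis .
qed

lemma emeasure_dvol_fd: "emeasure (dvol \<Lambda>) fd = 1"
proof -
  have "emeasure lborel fd = ennreal (covolume \<Lambda>)"
    using emeasure_bounded_finite[OF bounded_fd] by (simp add: covolume_eq emeasure_eq_ennreal_measure)
  then show ?thesis
    using covolume_pos by (simp add: dvol_def emeasure_density_const ennreal_mult[symmetric])
qed

lemma continuous_borel: "continuous_on UNIV F \<Longrightarrow> F \<in> borel_measurable borel"
  by (rule borel_measurable_continuous_onI)

lemma integrable_bsupp:
  fixes F :: "'a \<Rightarrow> complex"
  assumes "continuous_on UNIV F" "bsupp F"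
  shows "integrable (dvol \<Lambda>) F"
proof -
  obtain R where R: "\<And>v. norm v > R \<Longrightarrow> F v = 0" using assms(2) by (auto simp: bsupp_def)
  have "integrable lborel (\<lambda>x. indicat_real (cball 0 R) x *\<^sub>R F x)"
    using assms(1) by (intro borel_integrable_compact) (auto intro: continuous_on_subset)
  moreover have "(\<lambda>x. indicat_real (cball 0 R) x *\<^sub>R F x) = F"
    using R by (auto simp: indicator_def not_le)
  ultimately show ?thesis by (simp add: integrable_dvol)
qed

lemma integrable_test: "test_fun F \<Longrightarrow> integrable (dvol \<Lambda>) F"
  by (rule integrable_bsupp) (auto simp: test_fun_iff smooth_continuous_on)

text \<open>Passage from the Lebesgue integral to the gauge integral over a box, the kind of
  integral used by \<open>avg\<close> and by the interchange rule for continuous functions.\<close>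

lemma integral_dvol_box:
  fixes F :: "'a \<Rightarrow> complex"
  assumes "continuous_on UNIV F" "\<And>v. v \<notin> cbox l u \<Longrightarrow> F v = 0"
  shows "(LINT v|dvol \<Lambda>. F v) = (1 / covolume \<Lambda>) *\<^sub>R integral (cbox l u) F"
proof -
  obtain R where "cbox l u \<subseteq> cball 0 R"
    using bounded_cbox[of l u] by (auto simp: bounded_iff subset_iff)
  with assms(2) have "bsupp F"
    by (metis bsupp_def mem_cball_0 not_le subsetD)
  then have "integrable lborel F"
    using integrable_bsupp assms(1) integrable_dvol by blast
  then have "(LINT v|lborel. F v) = integral UNIV F"
    by (simp add: integral_lborel)
  also have "\<dots> = integral UNIV (\<lambda>v. if v \<in> cbox l u then F v else 0)"
    using assms(2) by (intro Henstock_Kurzweil_Integration.integral_cong) auto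
  also have "\<dots> = integral (cbox l u) F"
    by (rule integral_restrict_UNIV)
  finally show ?thesis
    using integral_dvol[OF continuous_borel[OF assms(1)]] by simp
qed

text \<open>Fubini between the space integral and the unit interval; the uniform radius
  \<open>R\<close> confines everything to one compact box.\<close>

lemma integral_dvol_swap:
  fixes F :: "'a \<Rightarrow> real \<Rightarrow> complex"
  assumes cont: "continuous_on UNIV (\<lambda>(v, t). F v t)"
    and supp: "\<And>v t. t \<in> {0..1} \<Longrightarrow> norm v > R \<Longrightarrow> F v t = 0"
  shows "(LINT v|dvol \<Lambda>. integral {0..1} (F v)) = integral {0..1} (\<lambda>t. LINT v|dvol \<Lambda>. F v t)"
proof -
  obtain l u where lu: "cball (0::'a) R \<subseteq> cbox l u"
    using bounded_subset_cbox_symmetric[OF bounded_cball] by blast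
  have cont1: "continuous_on UNIV (\<lambda>v. F v t)" for t
    using continuous_on_compose2[OF cont, of UNIV "\<lambda>v. (v, t)"]
    by (simp add: continuous_on_Pair continuous_on_id continuous_on_const)
  have out: "F v t = 0" if "v \<notin> cbox l u" "t \<in> {0..1}" for v t
    using supp lu that by (meson mem_cball_0 not_le subsetD)
  have "continuous_on UNIV (\<lambda>v. integral (cbox 0 1) (F v))"
    by (rule integral_continuous_on_param) (rule continuous_on_subset[OF cont], simp)
  moreover have "integral {0..1} (F v) = 0" if "v \<notin> cbox l u" for v
  proof -
    have "integral {0..1} (F v) = integral {0..1} (\<lambda>t::real. 0)"
      using out[OF that] by (intro Henstock_Kurzweil_Integration.integral_cong) auto
    then show ?thesis by simp
  qed
  ultimately have "(LINT v|dvol \<Lambda>. integral {0..1} (F v)) =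
      (1 / covolume \<Lambda>) *\<^sub>R integral (cbox l u) (\<lambda>v. integral (cbox 0 1) (F v))"
    by (subst integral_dvol_box[of _ l u]) auto
  also have "integral (cbox l u) (\<lambda>v. integral (cbox 0 1) (F v)) =
      integral (cbox 0 1) (\<lambda>t. integral (cbox l u) (\<lambda>v. F v t))"
    by (rule integral_swap_continuous) (rule continuous_on_subset[OF cont], simp)
  also have "(1 / covolume \<Lambda>) *\<^sub>R \<dots> = integral {0..1} (\<lambda>t. (1 / covolume \<Lambda>) *\<^sub>R integral (cbox l u) (\<lambda>v. F v t))"
    by simp
  also have "\<dots> = integral {0..1} (\<lambda>t. LINT v|dvol \<Lambda>. F v t)"
    using out cont1 by (intro Henstock_Kurzweil_Integration.integral_cong) (auto simp: integral_dvol_box[of _ l u])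
  finally show ?thesis .
qed

lemma integral_avg:
  assumes F: "continuous_on UNIV F" "bsupp F"
  shows "(LINT v|dvol \<Lambda>. avg a F v) = (LINT v|dvol \<Lambda>. F v)"
proof -
  obtain R where R: "\<forall>v. norm v > R \<longrightarrow> F v = 0" using F(2) by (auto simp: bsupp_def)
  have "F (v + t *\<^sub>R a) = 0" if t: "t \<in> {0..1}" "norm v > R + norm a" for v t
  proof (rule bsupp_shift[OF R])
    have "\<bar>t\<bar> * norm a \<le> norm a" using t by (simp add: mult_left_le_one_le)
    with t show "R + norm (t *\<^sub>R a) < norm v" by simp
  qed
  moreover have "continuous_on UNIV (\<lambda>(v, t). F (v + t *\<^sub>R a))"
    by (auto intro!: continuous_intros continuous_on_compose2[OF F(1)] simp: case_prod_beta)
  ultimately have "(LINT v|dvol \<Lambda>. avg a F v) = integral {0..1} (\<lambda>t. LINT v|dvol \<Lambda>. F (v + t *\<^sub>R a))"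
    unfolding avg_def by (intro integral_dvol_swap[where R = "R + norm a"])
  also have "\<dots> = integral {0..1} (\<lambda>t::real. LINT v|dvol \<Lambda>. F v)"
    by (simp add: integral_dvol_translate continuous_borel F)
  finally show ?thesis by simp
qed

text \<open>Averaging along \<open>a\<close> leaves the integral unchanged and turns the derivative
  into \<open>F (v + a) - F v\<close>, whose two halves have equal integrals.\<close>

lemma integral_pderiv_dir:
  assumes "test_fun F"
  shows "(LINT v|dvol \<Lambda>. pderiv_dir a F v) = 0"
proof -
  have F: "smooth F" "bsupp F" using assms by (auto simp: test_fun_iff)
  have "(LINT v|dvol \<Lambda>. pderiv_dir a F v) = (LINT v|dvol \<Lambda>. avg a (pderiv_dir a F) v)"
    using F by (intro integral_avg[symmetric] smooth_continuous_on smooth_pderiv_dir bsupp_pderiv_dir)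
  also have "\<dots> = (LINT v|dvol \<Lambda>. F (v + a) - F v)"
    using F by (simp add: avg_pderiv_dir)
  also have "\<dots> = (LINT v|dvol \<Lambda>. F (v + a)) - (LINT v|dvol \<Lambda>. F v)"
    using assms by (intro Bochner_Integration.integral_diff integrable_test test_fun_translate)
  also have "\<dots> = 0"
    using F by (simp add: integral_dvol_translate continuous_borel smooth_continuous_on)
  finally show ?thesis .
qed

lemma integral_by_parts:
  assumes "smooth F" "test_fun G"
  shows "(LINT v|dvol \<Lambda>. F v * pderiv_dir a G v) = - (LINT v|dvol \<Lambda>. pderiv_dir a F v * G v)"
proof -
  have "0 = (LINT v|dvol \<Lambda>. pderiv_dir a (\<lambda>v. F v * G v) v)"
    using assms by (simp add: integral_pderiv_dir test_fun_mult)
  also have "\<dots> = (LINT v|dvol \<Lambda>. F v * pderiv_dir a G v + pderiv_dir a F v * G v)"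
    using assms by (simp add: pderiv_dir_mult test_fun_iff)
  also have "\<dots> = (LINT v|dvol \<Lambda>. F v * pderiv_dir a G v) + (LINT v|dvol \<Lambda>. pderiv_dir a F v * G v)"
    using assms by (intro Bochner_Integration.integral_add integrable_test test_fun_mult smooth_pderiv_dir test_fun_pderiv_dir)
  finally show ?thesis by (simp add: eq_neg_iff_add_eq_0)
qed

section \<open>Fourier coefficients\<close>

text \<open>The exponent carries a plus sign, matching the terms of \<open>W_series\<close>;
  reconstruction therefore uses \<open>echar (- \<gamma>)\<close>.\<close>

definition ft :: "('a \<Rightarrow> complex) \<Rightarrow> ('a \<Rightarrow>\<^sub>L real) \<Rightarrow> complex" where
  "ft \<psi> \<gamma> = (LINT v|dvol \<Lambda>. echar \<gamma> v * \<psi> v)"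

lemma ft_pderiv_dir:
  assumes "test_fun \<psi>"
  shows "ft (pderiv_dir a \<psi>) \<gamma> = - (2 * \<i> * of_real pi * of_real (blinfun_apply \<gamma> a)) * ft \<psi> \<gamma>"
  unfolding ft_def
  by (subst integral_by_parts) (use assms in \<open>simp_all add: smooth_echar pderiv_dir_echar mult.assoc\<close>)

text \<open>One differential operator per element of \<open>A\<close>: applied in turn they yield
  another test function, whose coefficients are bounded by an L1 norm. The product shape is the one
  summed in \<open>summable_on_linear_forms\<close>.\<close>

lemma ft_decay:
  assumes "finite A" "test_fun \<psi>"
  shows "\<exists>C. \<forall>\<gamma>. norm (ft \<psi> \<gamma>) * (\<Prod>b\<in>A. 1 + (blinfun_apply \<gamma> b)\<^sup>2) \<le> C"
  using assms
proof (induction A arbitrary: \<psi> rule: finite_induct)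
  case empty
  have "norm (ft \<psi> \<gamma>) \<le> (LINT v|dvol \<Lambda>. norm (\<psi> v))" for \<gamma>
    unfolding ft_def by (rule order_trans[OF integral_norm_bound]) (simp add: norm_mult)
  then show ?case by auto
next
  case (insert b A)
  \<comment> \<open>the operator \<open>1 - \<partial>\<^sub>b\<^sup>2 / 4\<pi>\<^sup>2\<close> multiplies the coefficient at \<open>\<gamma>\<close> by \<open>1 + \<gamma>(b)\<^sup>2\<close>\<close>
  define c where "c = - 1 / (4 * complex_of_real pi ^ 2)"
  define L where "L = (\<lambda>v. \<psi> v + c * pderiv_dir b (pderiv_dir b \<psi>) v)"
  have t: "test_fun (pderiv_dir b (pderiv_dir b \<psi>))"
    using insert.prems by (intro test_fun_pderiv_dir)
  have t2: "test_fun (\<lambda>v. c * pderiv_dir b (pderiv_dir b \<psi>) v)"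
    by (intro test_fun_mult smooth_const t)
  then have tL: "test_fun L"
    using insert.prems by (auto simp: L_def test_fun_iff intro: smooth_add bsupp_add)
  have "ft L \<gamma> = (1 + of_real (blinfun_apply \<gamma> b) ^ 2) * ft \<psi> \<gamma>" for \<gamma>
  proof -
    have "ft L \<gamma> = (LINT v|dvol \<Lambda>. echar \<gamma> v * \<psi> v + c * (echar \<gamma> v * pderiv_dir b (pderiv_dir b \<psi>) v))"
      by (simp add: ft_def L_def algebra_simps)
    also have "\<dots> = ft \<psi> \<gamma> + c * ft (pderiv_dir b (pderiv_dir b \<psi>)) \<gamma>"
      unfolding ft_def using insert.prems t
      by (subst Bochner_Integration.integral_add)
        (auto intro!: integrable_test test_fun_mult smooth_const smooth_echar integrable_mult_right)
    also have "\<dots> = (1 + of_real (blinfun_apply \<gamma> b) ^ 2) * ft \<psi> \<gamma>"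
    proof -
      have "ft (pderiv_dir b (pderiv_dir b \<psi>)) \<gamma> =
          (- (2 * \<i> * of_real pi * of_real (blinfun_apply \<gamma> b)))\<^sup>2 * ft \<psi> \<gamma>"
        using insert.prems by (simp only: ft_pderiv_dir test_fun_pderiv_dir power2_eq_square mult.assoc)
      also have "\<dots> = - (4 * of_real pi ^ 2) * (of_real (blinfun_apply \<gamma> b)) ^ 2 * ft \<psi> \<gamma>"
        by (simp add: power_mult_distrib)
      finally have "c * ft (pderiv_dir b (pderiv_dir b \<psi>)) \<gamma> =
          (c * - (4 * of_real pi ^ 2)) * ((of_real (blinfun_apply \<gamma> b)) ^ 2 * ft \<psi> \<gamma>)"
        by (simp only: mult.assoc)
      also have "c * - (4 * of_real pi ^ 2) = 1"
        by (simp add: c_def)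
      finally show ?thesis by (simp add: distrib_right)
    qed
    finally show ?thesis .
  qed
  then have n: "norm (ft L \<gamma>) = (1 + (blinfun_apply \<gamma> b)\<^sup>2) * norm (ft \<psi> \<gamma>)" for \<gamma>
  proof -
    have "1 + complex_of_real (blinfun_apply \<gamma> b) ^ 2 = complex_of_real (1 + (blinfun_apply \<gamma> b)\<^sup>2)"
      by simp
    then have "norm (1 + complex_of_real (blinfun_apply \<gamma> b) ^ 2) = 1 + (blinfun_apply \<gamma> b)\<^sup>2"
      by (metis abs_of_nonneg add_nonneg_nonneg norm_of_real zero_le_one zero_le_power2)
    then show ?thesis
      by (simp only: norm_mult \<open>\<And>\<gamma>. ft L \<gamma> = _\<close>)
  qed
  obtain C where "\<forall>\<gamma>. norm (ft L \<gamma>) * (\<Prod>b\<in>A. 1 + (blinfun_apply \<gamma> b)\<^sup>2) \<le> C"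
    using insert.IH[OF tL] by auto
  then show ?case
    using insert.hyps by (auto simp: n mult_ac intro!: exI[of _ C])
qed

end

section \<open>Summability over sets of linear forms\<close>

text \<open>The bound telescopes: its increment \<open>4 / ((M + 1) * (M + 2))\<close> dominates the
  two new terms, and both sides equal 1 at \<open>M = 0\<close>.\<close>

lemma sum_int_inverse_square_le: "(\<Sum>k = - int M..int M. 1 / (1 + (real_of_int k)\<^sup>2)) \<le> 5 - 4 / (real M + 1)"
proof (induction M)
  case (Suc M)
  have set: "{- int (Suc M)..int (Suc M)} = insert (- int (Suc M)) (insert (int (Suc M)) {- int M..int M})"
    by auto
  have "(\<Sum>k = - int (Suc M)..int (Suc M). 1 / (1 + (real_of_int k)\<^sup>2)) =
      2 / (1 + (real M + 1)\<^sup>2) + (\<Sum>k = - int M..int M. 1 / (1 + (real_of_int k)\<^sup>2))"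
    unfolding set by (simp add: power2_eq_square algebra_simps)
  also have "\<dots> \<le> 2 / (1 + (real M + 1)\<^sup>2) + (5 - 4 / (real M + 1))"
    using Suc by simp
  also have "\<dots> \<le> 5 - 4 / (real (Suc M) + 1)"
  proof -
    have "2 * ((real M + 1) * (real M + 2)) \<le> 4 * (1 + (real M + 1)\<^sup>2)"
      by (simp add: power2_eq_square algebra_simps)
    moreover have "0 < (real M + 1) * (real M + 2)" "0 < 1 + (real M + 1)\<^sup>2"
      by (auto intro!: add_pos_nonneg)
    ultimately have "2 / (1 + (real M + 1)\<^sup>2) \<le> 4 / ((real M + 1) * (real M + 2))"
      by (simp add: divide_le_eq pos_le_divide_eq mult.commute)
    also have "\<dots> = 4 / (real M + 1) - 4 / (real M + 2)"
      by (simp add: field_simps)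
    finally show ?thesis by (simp add: add.commute)
  qed
  finally show ?case .
qed simp

text \<open>The values on the \<open>a i\<close> embed \<open>G\<close> into integer vectors indexed
  by \<open>J\<close>, where the sum factors into one convergent series per index. It serves the
  Fourier coefficients, with a lattice basis, and the Bernoulli series, with the vectors outside the
  subspace.\<close>

lemma summable_on_linear_forms:
  fixes G :: "('a::euclidean_space \<Rightarrow>\<^sub>L real) set" and a :: "'i \<Rightarrow> 'a"
  assumes "finite J"
    and int: "\<And>\<gamma> i. \<gamma> \<in> G \<Longrightarrow> i \<in> J \<Longrightarrow> blinfun_apply \<gamma> (a i) \<in> \<int>"
    and inj: "\<And>\<gamma> \<delta>. \<gamma> \<in> G \<Longrightarrow> \<delta> \<in> G \<Longrightarrow> (\<And>i. i \<in> J \<Longrightarrow> blinfun_apply \<gamma> (a i) = blinfun_apply \<delta> (a i)) \<Longrightarrow> \<gamma> = \<delta>"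
  shows "(\<lambda>\<gamma>. \<Prod>i\<in>J. 1 / (1 + (blinfun_apply \<gamma> (a i))\<^sup>2)) summable_on G"
proof (rule nonneg_bdd_above_summable_on)
  define u where "u k = 1 / (1 + (real_of_int k)\<^sup>2)" for k
  \<comment> \<open>Restricted to \<open>J\<close> so that the integer vectors belong to a product
    \<open>PiE\<close>.\<close>
  define c where "c \<gamma> = (\<lambda>i\<in>J. \<lfloor>blinfun_apply \<gamma> (a i)\<rfloor>)" for \<gamma> :: "'a \<Rightarrow>\<^sub>L real"
  have upos: "0 \<le> u k" for k by (simp add: u_def add_nonneg_nonneg)
  have uc: "(\<Prod>i\<in>J. 1 / (1 + (blinfun_apply \<gamma> (a i))\<^sup>2)) = (\<Prod>i\<in>J. u (c \<gamma> i))" if "\<gamma> \<in> G" for \<gamma>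
    using int[OF that] by (intro prod.cong) (auto simp: u_def c_def)
  have injc: "inj_on c G"
  proof (rule inj_onI)
    fix \<gamma> \<delta> assume *: "\<gamma> \<in> G" "\<delta> \<in> G" "c \<gamma> = c \<delta>"
    show "\<gamma> = \<delta>"
    proof (rule inj[OF *(1,2)])
      fix i assume "i \<in> J"
      with *(3) have "\<lfloor>blinfun_apply \<gamma> (a i)\<rfloor> = \<lfloor>blinfun_apply \<delta> (a i)\<rfloor>"
        by (metis c_def restrict_apply')
      then show "blinfun_apply \<gamma> (a i) = blinfun_apply \<delta> (a i)"
        using int[OF *(1) \<open>i \<in> J\<close>] int[OF *(2) \<open>i \<in> J\<close>] by (metis floor_of_int Ints_cases)
    qed
  qed
  have "sum (\<lambda>\<gamma>. \<Prod>i\<in>J. 1 / (1 + (blinfun_apply \<gamma> (a i))\<^sup>2)) F \<le> 5 ^ card J" if F: "F \<subseteq> G" "finite F" for F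
  proof -
    have "finite (\<Union>\<gamma>\<in>F. (\<lambda>i. nat \<bar>c \<gamma> i\<bar>) ` J)" using F \<open>finite J\<close> by auto
    then obtain M where "\<forall>x\<in>(\<Union>\<gamma>\<in>F. (\<lambda>i. nat \<bar>c \<gamma> i\<bar>) ` J). x \<le> M"
      by (metis finite_nat_set_iff_bounded_le)
    then have M: "\<bar>c \<gamma> i\<bar> \<le> int M" if "\<gamma> \<in> F" "i \<in> J" for \<gamma> i using that by fastforce
    have "sum (\<lambda>\<gamma>. \<Prod>i\<in>J. 1 / (1 + (blinfun_apply \<gamma> (a i))\<^sup>2)) F = (\<Sum>\<gamma>\<in>F. \<Prod>i\<in>J. u (c \<gamma> i))"
      using F uc by (intro sum.cong) auto
    also have "\<dots> = (\<Sum>g\<in>c ` F. \<Prod>i\<in>J. u (g i))"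
      using inj_on_subset[OF injc F(1)] by (simp add: sum.reindex)
    \<comment> \<open>Finitely many integer vectors fit into one cube, over which sum and product
      exchange.\<close>
    also have "\<dots> \<le> (\<Sum>g\<in>(\<Pi>\<^sub>E i\<in>J. {- int M..int M}). \<Prod>i\<in>J. u (g i))"
      using M by (intro sum_mono2 finite_PiE \<open>finite J\<close> prod_nonneg)
        (auto simp: upos c_def abs_le_iff PiE_def Pi_def minus_le_iff)
    also have "\<dots> = (\<Prod>i\<in>J. \<Sum>k = - int M..int M. u k)"
      by (rule prod_sum_PiE[symmetric]) (auto simp: \<open>finite J\<close>)
    also have "\<dots> \<le> (\<Prod>i\<in>J. 5)"
      using order_trans[OF sum_int_inverse_square_le[of M], of 5]
      by (intro prod_mono conjI sum_nonneg) (auto simp: upos, simp add: u_def)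
    finally show ?thesis by simp
  qed
  then show "bdd_above (sum (\<lambda>\<gamma>. \<Prod>i\<in>J. 1 / (1 + (blinfun_apply \<gamma> (a i))\<^sup>2)) ` {F. F \<subseteq> G \<and> finite F})"
    by (intro bdd_aboveI2[of _ _ "5 ^ card J"]) auto
qed (auto intro!: prod_nonneg add_nonneg_nonneg)

section \<open>Integration over a fundamental domain\<close>

context euclidean_lattice
begin

definition flr :: "'a \<Rightarrow> 'a" where
  "flr v = (\<Sum>b\<in>Bs. of_int \<lfloor>crd b v\<rfloor> *\<^sub>R b)"

lemma crd_flr: "b \<in> Bs \<Longrightarrow> crd b (flr v) = of_int \<lfloor>crd b v\<rfloor>"
  unfolding flr_def by (rule coord_comb[OF Bs(1,2)])

lemma flr_lattice: "flr v \<in> \<Lambda>"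
  by (simp add: lattice_iff crd_flr)

lemma crd_eqI: "(\<And>b. b \<in> Bs \<Longrightarrow> crd b v = crd b w) \<Longrightarrow> v = w"
  by (metis (no_types, lifting) Bs(1,2) coord_sum sum.cong)

text \<open>Exactly one lattice translate of \<open>fd\<close> contains \<open>v\<close>. As an
  equivalence this collapses sums of indicators over translates to a single term.\<close>

lemma fd_flr: "l \<in> \<Lambda> \<Longrightarrow> v - l \<in> fd \<longleftrightarrow> l = flr v"
proof
  assume l: "l \<in> \<Lambda>" "v - l \<in> fd"
  show "l = flr v"
  proof (rule crd_eqI)
    fix b assume b: "b \<in> Bs"
    then obtain k where k: "crd b l = of_int k"
      using l by (auto simp: lattice_iff elim: Ints_cases)
    have "\<lfloor>crd b v\<rfloor> = k"
      using l(2) b by (intro floor_unique) (auto simp: fd_def blinfun.diff_right k)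
    then show "crd b l = crd b (flr v)"
      by (simp add: k crd_flr b)
  qed
next
  assume "l = flr v"
  then show "v - l \<in> fd"
    by (auto simp: fd_def blinfun.diff_right crd_flr) (linarith)+
qed

definition rfd :: real where "rfd = (SOME R. \<forall>v\<in>fd. norm v \<le> R)"

lemma rfd: "v \<in> fd \<Longrightarrow> norm v \<le> rfd"
  using someI_ex[of "\<lambda>R. \<forall>v\<in>fd. norm v \<le> R"] bounded_fd unfolding rfd_def bounded_iff by blast

text \<open>On a bounded set the coordinates are bounded through their operator norms, which leaves
  finitely many integer values. This keeps lattice sums of compactly supported functions
  finite.\<close>

lemma finite_lattice_bounded:
  assumes "bounded S"
  shows "finite (\<Lambda> \<inter> S)"
proof -
  obtain R where R: "\<And>v. v \<in> S \<Longrightarrow> norm v \<le> R" using assms by (auto simp: bounded_iff)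
  have "\<Lambda> \<inter> S \<subseteq> (\<lambda>c. \<Sum>b\<in>Bs. of_int (c b) *\<^sub>R b) ` (\<Pi>\<^sub>E b\<in>Bs. {- \<lceil>norm (crd b) * R\<rceil>..\<lceil>norm (crd b) * R\<rceil>})"
  proof
    fix l assume l: "l \<in> \<Lambda> \<inter> S"
    define c where "c = (\<lambda>b\<in>Bs. \<lfloor>crd b l\<rfloor>)"
    have "l = flr l"
      using l by (intro crd_eqI) (auto simp: crd_flr lattice_iff)
    then have "l = (\<Sum>b\<in>Bs. of_int (c b) *\<^sub>R b)"
      by (simp add: flr_def c_def cong: sum.cong)
    moreover have "c b \<in> {- \<lceil>norm (crd b) * R\<rceil>..\<lceil>norm (crd b) * R\<rceil>}" if b: "b \<in> Bs" for b
    proof -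
      obtain k where k: "crd b l = of_int k"
        using l b by (auto simp: lattice_iff elim: Ints_cases)
      have "\<bar>of_int k\<bar> \<le> norm (crd b) * norm l"
        using norm_blinfun[of "crd b" l] by (simp add: k)
      also have "\<dots> \<le> norm (crd b) * R"
        using R l by (intro mult_left_mono) auto
      also have "\<dots> \<le> of_int \<lceil>norm (crd b) * R\<rceil>" by simp
      finally have "\<bar>k\<bar> \<le> \<lceil>norm (crd b) * R\<rceil>" by (metis of_int_abs of_int_le_iff)
      then show ?thesis using b by (auto simp: c_def k)
    qed
    ultimately show "l \<in> (\<lambda>c. \<Sum>b\<in>Bs. of_int (c b) *\<^sub>R b) ` (\<Pi>\<^sub>E b\<in>Bs. {- \<lceil>norm (crd b) * R\<rceil>..\<lceil>norm (crd b) * R\<rceil>})"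
      by (intro image_eqI[of _ _ c]) (auto simp: c_def)
  qed
  then show ?thesis
    by (rule finite_subset) (intro finite_imageI finite_PiE Bs(3), auto)
qed

text \<open>The normalised integral over the torus; on continuous periodic functions any translate
  of \<open>fd\<close> gives the same value. It is polymorphic because both moduli and complex
  functions are integrated.\<close>

definition ifd :: "('a \<Rightarrow> 'b::{banach, second_countable_topology}) \<Rightarrow> 'b" where
  "ifd F = (LINT v:fd|dvol \<Lambda>. F v)"

lemma set_integrable_fd:
  fixes F :: "'a \<Rightarrow> 'b::{banach, second_countable_topology}"
  assumes "continuous_on UNIV F"
  shows "set_integrable (dvol \<Lambda>) fd F"
proof -
  have [measurable]: "F \<in> borel_measurable borel" by (rule borel_measurable_continuous_onI[OF assms])
  have "set_integrable lborel (cball 0 rfd) F"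
    unfolding set_integrable_def
    using assms by (intro borel_integrable_compact) (auto intro: continuous_on_subset)
  then have "set_integrable (dvol \<Lambda>) (cball 0 rfd) F"
    by (simp add: set_integrable_def integrable_dvol)
  then show ?thesis
    by (rule set_integrable_subset) (auto simp: rfd)
qed

text \<open>The space is cut into translates of \<open>fd\<close> and each piece is moved back. The
  support condition is phrased through \<open>flr\<close>, which names the tile of \<open>v\<close>;
  a finite \<open>A\<close> makes the exchange of sum and integral elementary.\<close>

lemma ifd_tile:
  fixes F :: "'a \<Rightarrow> 'b::{banach, second_countable_topology}"
  assumes F: "integrable (dvol \<Lambda>) F" and A: "finite A" "A \<subseteq> \<Lambda>"
    and supp: "\<And>v. F v \<noteq> 0 \<Longrightarrow> flr v \<in> A"
  shows "(LINT v|dvol \<Lambda>. F v) = ifd (\<lambda>v. \<Sum>l\<in>A. F (v + l))"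
proof -
  have [measurable]: "F \<in> borel_measurable borel"
    using borel_measurable_integrable[OF F] by simp
  have int: "set_integrable (dvol \<Lambda>) fd (\<lambda>v. F (v + l))" for l
    using integrable_mult_indicator[OF _ integrable_dvol_translate[OF F], of fd l]
    by (simp add: set_integrable_def)
  have int2: "integrable (dvol \<Lambda>) (\<lambda>v. indicat_real fd (v - l) *\<^sub>R F v)" for l
    using integrable_dvol_translate[OF int[of l, unfolded set_integrable_def], of "-l"] by simp
  have "F v = (\<Sum>l\<in>A. indicat_real fd (v - l) *\<^sub>R F v)" for v
  proof (cases "F v = 0")
    case False
    have "(\<Sum>l\<in>A. indicat_real fd (v - l) *\<^sub>R F v) = (\<Sum>l\<in>A. if l = flr v then F v else 0)"
      using A(2) fd_flr by (intro sum.cong) (auto simp: indicator_def)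
    also have "\<dots> = F v" using supp[OF False] A(1) by simp
    finally show ?thesis by simp
  qed simp
  then have "(LINT v|dvol \<Lambda>. F v) = (LINT v|dvol \<Lambda>. (\<Sum>l\<in>A. indicat_real fd (v - l) *\<^sub>R F v))"
    by (intro Bochner_Integration.integral_cong) auto
  also have "\<dots> = (\<Sum>l\<in>A. LINT v|dvol \<Lambda>. indicat_real fd (v - l) *\<^sub>R F v)"
    by (intro Bochner_Integration.integral_sum int2)
  also have "\<dots> = (\<Sum>l\<in>A. LINT v|dvol \<Lambda>. indicat_real fd v *\<^sub>R F (v + l))"
  proof (intro sum.cong refl)
    fix l
    show "(LINT v|dvol \<Lambda>. indicat_real fd (v - l) *\<^sub>R F v) = (LINT v|dvol \<Lambda>. indicat_real fd v *\<^sub>R F (v + l))"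
      using integral_dvol_translate[of "\<lambda>v. indicat_real fd (v - l) *\<^sub>R F v" l] by simp
  qed
  also have "\<dots> = (LINT v|dvol \<Lambda>. (\<Sum>l\<in>A. indicat_real fd v *\<^sub>R F (v + l)))"
    using int by (intro Bochner_Integration.integral_sum[symmetric]) (simp add: set_integrable_def)
  finally show ?thesis
    by (simp add: ifd_def set_lebesgue_integral_def scaleR_sum_right)
qed

text \<open>The domain \<open>w + fd\<close> is cut by the lattice tiles, and periodicity lets the
  pieces be reassembled into \<open>fd\<close>.\<close>

lemma ifd_translate:
  fixes h :: "'a \<Rightarrow> 'b::{banach, second_countable_topology}"
  assumes h: "continuous_on UNIV h" and per: "\<And>v l. l \<in> \<Lambda> \<Longrightarrow> h (v + l) = h v"
  shows "(LINT v|dvol \<Lambda>. indicat_real fd (v - w) *\<^sub>R h v) = ifd h"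
    and "ifd (\<lambda>v. h (v + w)) = ifd h"
proof -
  \<comment> \<open>Contains every \<open>l\<close> for which the tile \<open>l + fd\<close> can
    meet \<open>w + fd\<close>: one \<open>rfd\<close> for each of the two domains.\<close>
  define A where "A = \<Lambda> \<inter> cball 0 (norm w + rfd + rfd)"
  have A: "finite A" "A \<subseteq> \<Lambda>"
    unfolding A_def by (auto intro: finite_lattice_bounded)
  have [measurable]: "h \<in> borel_measurable borel" by (rule borel_measurable_continuous_onI[OF h])
  have cw: "continuous_on UNIV (\<lambda>v. h (v + w))"
    by (intro continuous_on_compose2[OF h] continuous_intros) auto
  have int: "integrable (dvol \<Lambda>) (\<lambda>v. indicat_real fd (v - w) *\<^sub>R h v)"
    using integrable_dvol_translate[OF set_integrable_fd[OF cw, unfolded set_integrable_def], of "-w"] by simp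
  have "(LINT v|dvol \<Lambda>. indicat_real fd (v - w) *\<^sub>R h v) =
      ifd (\<lambda>v. \<Sum>l\<in>A. indicat_real fd (v + l - w) *\<^sub>R h (v + l))"
  proof (rule ifd_tile[OF int A])
    fix v assume "indicat_real fd (v - w) *\<^sub>R h v \<noteq> 0"
    then have 1: "v - w \<in> fd" by (auto simp: indicator_def split: if_splits)
    have 2: "v - flr v \<in> fd" using fd_flr[OF flr_lattice] by blast
    have "norm (flr v) = norm (w + (v - w) - (v - flr v))" by simp
    also have "\<dots> \<le> norm w + norm (v - w) + norm (v - flr v)"
      by (meson norm_triangle_ineq4 norm_triangle_ineq order_trans add_mono order_refl)
    also have "\<dots> \<le> norm w + rfd + rfd" using rfd[OF 1] rfd[OF 2] by simp
    finally show "flr v \<in> A" by (simp add: A_def flr_lattice)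
  qed
  also have "\<dots> = ifd h"
    unfolding ifd_def
  proof (rule set_lebesgue_integral_cong)
    show "\<forall>v. v \<in> fd \<longrightarrow> (\<Sum>l\<in>A. indicat_real fd (v + l - w) *\<^sub>R h (v + l)) = h v"
    proof (intro allI impI)
      fix v assume v: "v \<in> fd"
      \<comment> \<open>The only lattice vector that carries \<open>v\<close> into
        \<open>w + fd\<close>.\<close>
      define m where "m = - flr (v - w)"
      have m: "m \<in> \<Lambda>" by (simp add: m_def lattice_minus flr_lattice)
      have eq: "v + l - w \<in> fd \<longleftrightarrow> l = m" if "l \<in> \<Lambda>" for l
      proof -
        have "v + l - w = (v - w) - (- l)" by simp
        then have "v + l - w \<in> fd \<longleftrightarrow> - l = flr (v - w)" using fd_flr[OF lattice_minus[OF that], of "v - w"] by metis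
        then show ?thesis by (metis m_def minus_minus)
      qed
      have 1: "v + m - w \<in> fd" using eq m by blast
      have "norm m = norm (w + (v + m - w) - v)" by simp
      also have "\<dots> \<le> norm w + norm (v + m - w) + norm v"
        by (meson norm_triangle_ineq4 norm_triangle_ineq order_trans add_mono order_refl)
      also have "\<dots> \<le> norm w + rfd + rfd" using rfd[OF 1] rfd[OF v] by simp
      finally have "m \<in> A" by (simp add: A_def m)
      have "(\<Sum>l\<in>A. indicat_real fd (v + l - w) *\<^sub>R h (v + l)) = (\<Sum>l\<in>A. if l = m then h v else 0)"
        using A(2) eq per by (intro sum.cong) (auto simp: indicator_def)
      also have "\<dots> = h v" using \<open>m \<in> A\<close> A by simp
      finally show "(\<Sum>l\<in>A. indicat_real fd (v + l - w) *\<^sub>R h (v + l)) = h v" .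
    qed
  qed simp
  finally show *: "(LINT v|dvol \<Lambda>. indicat_real fd (v - w) *\<^sub>R h v) = ifd h" .
  have "ifd (\<lambda>v. h (v + w)) = (LINT v|dvol \<Lambda>. indicat_real fd (v - w) *\<^sub>R h v)"
    using integral_dvol_translate[of "\<lambda>v. indicat_real fd (v - w) *\<^sub>R h v" w]
    by (simp add: ifd_def set_lebesgue_integral_def)
  with * show "ifd (\<lambda>v. h (v + w)) = ifd h" by simp
qed

lemma ifd_const: "ifd (\<lambda>_. c) = c" for c :: "'b::{banach, second_countable_topology}"
  by (simp add: ifd_def set_lebesgue_integral_def measure_def emeasure_dvol_fd)

lemma continuous_on_echar: "continuous_on S (echar \<gamma>)"
  by (rule smooth_continuous_on[OF smooth_echar])

lemma ifd_cmult: "ifd (\<lambda>v. c * F v) = c * ifd F" for F :: "'a \<Rightarrow> complex"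
  by (simp add: ifd_def)

lemma ifd_add:
  fixes F :: "'a \<Rightarrow> 'b::{banach, second_countable_topology}"
  shows "continuous_on UNIV F \<Longrightarrow> continuous_on UNIV G \<Longrightarrow> ifd (\<lambda>v. F v + G v) = ifd F + ifd G"
  by (simp add: ifd_def set_integral_add set_integrable_fd)

lemma ifd_diff:
  fixes F :: "'a \<Rightarrow> 'b::{banach, second_countable_topology}"
  shows "continuous_on UNIV F \<Longrightarrow> continuous_on UNIV G \<Longrightarrow> ifd (\<lambda>v. F v - G v) = ifd F - ifd G"
  by (simp add: ifd_def set_integral_diff set_integrable_fd)

lemma ifd_sum:
  fixes F :: "'i \<Rightarrow> 'a \<Rightarrow> 'b::{banach, second_countable_topology}"
  assumes "\<And>i. i \<in> A \<Longrightarrow> continuous_on UNIV (F i)"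
  shows "ifd (\<lambda>v. \<Sum>i\<in>A. F i v) = (\<Sum>i\<in>A. ifd (F i))"
  using assms
proof (induction A rule: infinite_finite_induct)
  case (insert i A)
  then show ?case by (simp add: ifd_add continuous_on_sum)
qed (simp_all add: ifd_const)

lemma ifd_norm_le:
  fixes F :: "'a \<Rightarrow> 'b::{banach, second_countable_topology}"
  assumes "continuous_on UNIV F" "\<And>v. norm (F v) \<le> c"
  shows "norm (ifd F) \<le> c"
proof -
  have "norm (ifd F) \<le> ifd (\<lambda>v. norm (F v))"
    unfolding ifd_def using set_integral_norm_bound[OF set_integrable_fd[OF assms(1)]] by simp
  also have "\<dots> \<le> ifd (\<lambda>_. c)"
    unfolding ifd_def using assms
    by (intro set_integral_mono set_integrable_fd continuous_intros) auto
  finally show ?thesis by (simp add: ifd_const)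
qed

text \<open>Orthogonality of characters: a translation that multiplies a nontrivial character by -1
  preserves its integral, which must vanish.\<close>

lemma ifd_echar:
  assumes "\<gamma> \<in> dual_lattice \<Lambda>"
  shows "ifd (echar \<gamma>) = (if \<gamma> = 0 then 1 else 0)"
proof (cases "\<gamma> = 0")
  case False
  then obtain b where b: "b \<in> Bs" "blinfun_apply \<gamma> b \<noteq> 0"
  proof -
    have "\<exists>b\<in>Bs. blinfun_apply \<gamma> b \<noteq> 0"
    proof (rule ccontr)
      assume "\<not> ?thesis"
      then have "blinfun_apply \<gamma> (\<Sum>b\<in>Bs. crd b v *\<^sub>R b) = 0" for v
        by (simp add: blinfun.sum_right blinfun.scaleR_right)
      then have "\<gamma> = 0" by (intro blinfun_eqI) (simp add: coord_sum Bs)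
      with False show False by simp
    qed
    then show ?thesis using that by blast
  qed
  \<comment> \<open>Scaled so that \<open>\<gamma>\<close> takes the value 1/2 on \<open>w\<close>,
    hence the character the value -1.\<close>
  define w where "w = (1 / (2 * blinfun_apply \<gamma> b)) *\<^sub>R b"
  have "blinfun_apply \<gamma> w = 1/2" using b by (simp add: w_def blinfun.scaleR_right)
  then have "2 * \<i> * of_real pi * complex_of_real (blinfun_apply \<gamma> w) = \<i> * of_real pi"
    by (simp only:) simp
  then have "echar \<gamma> w = -1"
    by (simp only: echar_def) (simp add: mult.commute)
  then have "ifd (\<lambda>v. echar \<gamma> (v + w)) = - ifd (echar \<gamma>)"
    using ifd_cmult[of "-1" "echar \<gamma>"] by (simp add: echar_add)
  moreover have "ifd (\<lambda>v. echar \<gamma> (v + w)) = ifd (echar \<gamma>)"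
    by (rule ifd_translate) (auto simp: continuous_on_echar echar_periodic assms)
  ultimately show ?thesis using False by simp
next
  case True
  then have "echar \<gamma> = (\<lambda>_. 1)" by auto
  then show ?thesis using True ifd_const[of "1::complex"] by simp
qed

end

section \<open>Uniqueness of Fourier coefficients\<close>

text \<open>Given by rules, so that closure under products and conjugation follows by rule
  induction.\<close>

inductive trig_poly :: "'a::euclidean_space set \<Rightarrow> ('a \<Rightarrow> complex) \<Rightarrow> bool" for \<Lambda> where
  mode: "\<gamma> \<in> dual_lattice \<Lambda> \<Longrightarrow> trig_poly \<Lambda> (\<lambda>v. c * echar \<gamma> v)"
| add: "trig_poly \<Lambda> f \<Longrightarrow> trig_poly \<Lambda> g \<Longrightarrow> trig_poly \<Lambda> (\<lambda>v. f v + g v)"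

context euclidean_lattice
begin

lemma trig_const: "trig_poly \<Lambda> (\<lambda>_. c)"
  using trig_poly.mode[OF dual_zero, of c] by simp

lemma trig_mult:
  assumes "trig_poly \<Lambda> f" "trig_poly \<Lambda> g"
  shows "trig_poly \<Lambda> (\<lambda>v. f v * g v)"
  using assms(1)
proof induction
  case (mode \<gamma> c)
  from assms(2) show ?case
  proof induction
    case (mode \<delta> d)
    have "(\<lambda>v. c * echar \<gamma> v * (d * echar \<delta> v)) = (\<lambda>v. (c * d) * echar (\<gamma> + \<delta>) v)"
      by (simp add: echar_plus mult_ac)
    then show ?case
      using trig_poly.mode[OF dual_add[OF \<open>\<gamma> \<in> _\<close> mode]] by metis
  next
    case (add f g)
    then show ?case using trig_poly.add[OF add.IH] by (simp add: distrib_left)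
  qed
next
  case (add f1 f2)
  then show ?case using trig_poly.add[OF add.IH] by (simp add: distrib_right)
qed

lemma trig_cnj: "trig_poly \<Lambda> f \<Longrightarrow> trig_poly \<Lambda> (\<lambda>v. cnj (f v))"
proof (induction rule: trig_poly.induct)
  case (mode \<gamma> c)
  then show ?case
    using trig_poly.mode[OF dual_minus[OF mode], of "cnj c"] by (simp add: cnj_echar)
next
  case (add f g)
  then show ?case using trig_poly.add by simp
qed

lemma trig_sum: "(\<And>i. i \<in> A \<Longrightarrow> trig_poly \<Lambda> (f i)) \<Longrightarrow> trig_poly \<Lambda> (\<lambda>v. \<Sum>i\<in>A. f i v)"
  by (induction A rule: infinite_finite_induct) (auto intro: trig_const trig_poly.add)

lemma trig_cos_sin:
  assumes "\<gamma> \<in> dual_lattice \<Lambda>"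
  shows "trig_poly \<Lambda> (\<lambda>v. of_real (cos (2 * pi * blinfun_apply \<gamma> v)))"
    and "trig_poly \<Lambda> (\<lambda>v. of_real (sin (2 * pi * blinfun_apply \<gamma> v)))"
proof -
  have e: "echar \<gamma> v = cis (2 * pi * blinfun_apply \<gamma> v)" "echar (- \<gamma>) v = cis (- (2 * pi * blinfun_apply \<gamma> v))" for v
    by (simp_all add: echar_def cis_conv_exp mult_ac blinfun.minus_left)
  have "(\<lambda>v. of_real (cos (2 * pi * blinfun_apply \<gamma> v))) = (\<lambda>v. (1/2) * echar \<gamma> v + (1/2) * echar (- \<gamma>) v)"
    by (auto simp: e complex_eq_iff)
  then show "trig_poly \<Lambda> (\<lambda>v. of_real (cos (2 * pi * blinfun_apply \<gamma> v)))"
    by (simp only:) (intro trig_poly.intros dual_minus assms)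
  have "(\<lambda>v. of_real (sin (2 * pi * blinfun_apply \<gamma> v))) = (\<lambda>v. (-\<i>/2) * echar \<gamma> v + (\<i>/2) * echar (- \<gamma>) v)"
    by (auto simp: e complex_eq_iff)
  then show "trig_poly \<Lambda> (\<lambda>v. of_real (sin (2 * pi * blinfun_apply \<gamma> v)))"
    by (simp only:) (intro trig_poly.intros dual_minus assms)
qed

text \<open>An embedding of the torus \<open>V/\<Lambda>\<close> into a Euclidean space.\<close>

definition tor :: "'a \<Rightarrow> 'a \<times> 'a" where
  "tor v = (\<Sum>b\<in>Bs. cos (2 * pi * crd b v) *\<^sub>R b,
            \<Sum>b\<in>Bs. sin (2 * pi * crd b v) *\<^sub>R b)"

text \<open>Cosine and sine of the scaled coordinates determine them modulo 1, so each fibre of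
  \<open>tor\<close> lies in one coset of \<open>\<Lambda>\<close>.\<close>

lemma tor_eq:
  assumes "tor v = tor w"
  shows "v - w \<in> \<Lambda>"
  unfolding lattice_iff
proof
  fix b assume b: "b \<in> Bs"
  have "crd b (fst (tor v)) = crd b (fst (tor w))"
    "crd b (snd (tor v)) = crd b (snd (tor w))"
    using assms by simp_all
  then have "cos (2 * pi * crd b v) = cos (2 * pi * crd b w)"
    "sin (2 * pi * crd b v) = sin (2 * pi * crd b w)"
    using b by (simp_all add: tor_def coord_comb Bs)
  then obtain k where "2 * pi * crd b v = 2 * pi * crd b w + 2 * pi * real_of_int k"
    using sin_cos_eq_iff by metis
  then have "2 * pi * crd b v = 2 * pi * (crd b w + real_of_int k)"
    by (simp add: distrib_left)
  then have "crd b v = crd b w + real_of_int k"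
    by simp
  then show "crd b (v - w) \<in> \<int>"
    by (simp add: blinfun.diff_right)
qed

lemma tor_flr: "tor (v - flr v) = tor v"
proof -
  have "cos (2 * pi * crd b (v - flr v)) = cos (2 * pi * crd b v)"
    "sin (2 * pi * crd b (v - flr v)) = sin (2 * pi * crd b v)" if "b \<in> Bs" for b
  proof -
    have eq: "2 * pi * crd b v = 2 * pi * crd b (v - flr v) + 2 * pi * of_int \<lfloor>crd b v\<rfloor>"
      by (simp add: blinfun.diff_right crd_flr that algebra_simps)
    show "cos (2 * pi * crd b (v - flr v)) = cos (2 * pi * crd b v)"
      "sin (2 * pi * crd b (v - flr v)) = sin (2 * pi * crd b v)"
      using sin_cos_eq_iff eq by metis+
  qed
  then show ?thesis by (simp add: tor_def)
qed

lemma continuous_tor: "continuous_on UNIV tor"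
  unfolding tor_def[abs_def] by (intro continuous_intros)

text \<open>Polynomials in the cosines and sines of the coordinates are trigonometric polynomials;
  this carries polynomial approximation on the image of \<open>tor\<close> back to the whole
  space.\<close>

lemma trig_tor:
  assumes "real_polynomial_function p"
  shows "trig_poly \<Lambda> (\<lambda>v. of_real (p (tor v)))"
  using assms
proof induction
  case (linear f)
  then have l: "linear f" by (rule bounded_linear.linear)
  have "f (tor v) = (\<Sum>b\<in>Bs. cos (2 * pi * crd b v) * f (b, 0) +
      sin (2 * pi * crd b v) * f (0, b))" for v
  proof -
    have "tor v = (\<Sum>b\<in>Bs. cos (2 * pi * crd b v) *\<^sub>R (b, 0) +
        sin (2 * pi * crd b v) *\<^sub>R (0, b))"
      by (simp add: tor_def prod_eq_iff fst_sum snd_sum)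
    then show ?thesis
      by (simp only: linear_sum[OF l] linear_add[OF l] linear_cmul[OF l] real_scaleR_def)
  qed
  then have eq: "(\<lambda>v. of_real (f (tor v))) = (\<lambda>v. \<Sum>b\<in>Bs. of_real (cos (2 * pi * crd b v)) * complex_of_real (f (b, 0)) +
      of_real (sin (2 * pi * crd b v)) * of_real (f (0, b)))"
    by simp
  show ?case
    unfolding eq by (intro trig_sum trig_poly.add trig_mult trig_cos_sin trig_const crd_dual)
next
  case (const c)
  then show ?case by (rule trig_const)
next
  case (add f g)
  then show ?case using trig_poly.add by simp
next
  case (mult f g)
  then show ?case using trig_mult by simp
qed

text \<open>A periodic function factors through \<open>tor\<close>, and Stone-Weierstrass applies on
  the compact image.\<close>

lemma trig_approx:
  assumes h: "continuous_on UNIV h" and per: "\<And>v l. l \<in> \<Lambda> \<Longrightarrow> h (v + l) = (h v :: complex)" and e: "0 < e"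
  shows "\<exists>t. trig_poly \<Lambda> t \<and> (\<forall>v. norm (h v - t v) < e)"
proof -
  define h' where "h' y = h (SOME v. tor v = y)" for y
  have h': "h' (tor v) = h v" for v
  proof -
    define w where "w = (SOME w. tor w = tor v)"
    have "tor w = tor v" unfolding w_def by (rule someI[of _ v]) simp
    then have "h w = h v" using tor_eq[of w v] per[of "w - v" v] by simp
    then show ?thesis by (simp add: h'_def w_def)
  qed
  \<comment> \<open>The ball contains \<open>fd\<close>, so this is the image of the whole space,
    written so that its compactness is evident.\<close>
  define S where "S = tor ` cball 0 rfd"
  have S: "tor v \<in> S" for v
    using fd_flr[OF flr_lattice, of v v] rfd[of "v - flr v"] tor_flr[of v]
    unfolding S_def by (metis image_eqI mem_cball_0)
  have cS: "compact S"
    unfolding S_def using continuous_tor continuous_on_subset by (intro compact_continuous_image) auto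
  \<comment> \<open>A continuous map on a compact ball is closed, so the preimages of closed sets
    under \<open>h'\<close> are closed.\<close>
  have "continuous_on S h'"
    unfolding continuous_on_closed_vimage[OF compact_imp_closed[OF cS]]
  proof (intro allI impI)
    fix T :: "complex set" assume "closed T"
    have eq: "h' -` T \<inter> S = tor ` (h -` T \<inter> cball 0 rfd)"
      by (auto simp: S_def h')
    have "closed (h -` T)"
      using continuous_closed_vimage[OF \<open>closed T\<close>, of h] h by (simp add: continuous_on_eq_continuous_at)
    then have "compact (h -` T \<inter> cball 0 rfd)" by (intro closed_Int_compact) auto
    then have "compact (tor ` (h -` T \<inter> cball 0 rfd))"
      using continuous_tor continuous_on_subset by (intro compact_continuous_image) auto
    then show "closed (h' -` T \<inter> S)" unfolding eq by (rule compact_imp_closed)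
  qed
  from Stone_Weierstrass_polynomial_function[OF cS this e]
  obtain g where g: "polynomial_function g" "\<And>y. y \<in> S \<Longrightarrow> norm (h' y - g y) < e" by auto
  have "real_polynomial_function (Re \<circ> g)" "real_polynomial_function (Im \<circ> g)"
    using g(1) bounded_linear_Re bounded_linear_Im by (auto simp: polynomial_function_def)
  then have "trig_poly \<Lambda> (\<lambda>v. of_real (Re (g (tor v))))" "trig_poly \<Lambda> (\<lambda>v. of_real (Im (g (tor v))))"
    using trig_tor by fastforce+
  then have "trig_poly \<Lambda> (\<lambda>v. of_real (Re (g (tor v))) + \<i> * of_real (Im (g (tor v))))"
    by (intro trig_poly.add trig_mult trig_const)
  then have "trig_poly \<Lambda> (\<lambda>v. g (tor v))"
    by (simp add: complex_eq[symmetric])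
  moreover have "norm (h v - g (tor v)) < e" for v
    using g(2)[OF S[of v]] by (simp add: h')
  ultimately show ?thesis by blast
qed

lemma continuous_trig: "trig_poly \<Lambda> t \<Longrightarrow> continuous_on UNIV t"
  by (induction rule: trig_poly.induct) (auto intro!: continuous_intros continuous_on_echar)

text \<open>Orthogonality to all characters extends to trigonometric polynomials, which approximate
  \<open>h\<close> uniformly. So the integral of \<open>|h|^2\<close> vanishes, and continuity
  forces \<open>h\<close> to be zero.\<close>

lemma fourier_unique:
  assumes h: "continuous_on UNIV h" and per: "\<And>v l. l \<in> \<Lambda> \<Longrightarrow> h (v + l) = (h v :: complex)"
    and coef: "\<And>\<gamma>. \<gamma> \<in> dual_lattice \<Lambda> \<Longrightarrow> ifd (\<lambda>v. echar \<gamma> v * h v) = 0"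
  shows "h v0 = 0"
proof (rule ccontr)
  assume nz: "h v0 \<noteq> 0"
  have trig0: "ifd (\<lambda>v. t v * h v) = 0" if "trig_poly \<Lambda> t" for t
    using that
  proof induction
    case (mode \<gamma> c)
    then show ?case using coef ifd_cmult[of c "\<lambda>v. echar \<gamma> v * h v"] by (simp add: mult.assoc)
  next
    case (add f g)
    then show ?case
      by (simp only: distrib_right ifd_add[OF continuous_on_mult continuous_on_mult] h continuous_trig add_0)
  qed
  define N where "N = ifd (\<lambda>v. norm (h v))"
  have N: "0 \<le> N"
    unfolding N_def ifd_def set_lebesgue_integral_def by (intro Bochner_Integration.integral_nonneg) auto
  have small: "norm (ifd (\<lambda>v. cnj (h v) * h v)) \<le> e * N" if e: "0 < e" for e
  proof -
    obtain t where t: "trig_poly \<Lambda> t" "\<And>v. norm (h v - t v) < e"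
      using trig_approx[OF h per e] by blast
    have ct: "continuous_on UNIV t" by (rule continuous_trig[OF t(1)])
    have "ifd (\<lambda>v. cnj (h v) * h v) = ifd (\<lambda>v. cnj (h v) * h v - cnj (t v) * h v)"
      using trig0[OF trig_cnj[OF t(1)]]
      by (subst ifd_diff) (auto intro!: continuous_intros h ct)
    also have "norm \<dots> \<le> ifd (\<lambda>v. norm (cnj (h v) * h v - cnj (t v) * h v))"
      unfolding ifd_def
      by (intro set_integral_norm_bound set_integrable_fd continuous_intros h ct)
    also have "\<dots> \<le> ifd (\<lambda>v. e * norm (h v))"
      unfolding ifd_def
    proof (intro set_integral_mono set_integrable_fd continuous_intros h ct)
      fix v
      have "norm (cnj (h v) * h v - cnj (t v) * h v) = norm (h v - t v) * norm (h v)"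
        by (metis complex_cnj_diff complex_mod_cnj left_diff_distrib norm_mult)
      also have "\<dots> \<le> e * norm (h v)"
        using t(2)[of v] by (intro mult_right_mono) auto
      finally show "norm (cnj (h v) * h v - cnj (t v) * h v) \<le> e * norm (h v)" .
    qed
    also have "\<dots> = e * N"
      by (simp add: N_def ifd_def)
    finally show ?thesis .
  qed
  have "norm (ifd (\<lambda>v. cnj (h v) * h v)) \<le> 0"
  proof (rule field_le_epsilon)
    fix e :: real assume "0 < e"
    then have "norm (ifd (\<lambda>v. cnj (h v) * h v)) \<le> e / (N + 1) * N"
      using N by (intro small) auto
    also have "\<dots> \<le> e" using N \<open>0 < e\<close> by (simp add: field_simps)
    finally show "norm (ifd (\<lambda>v. cnj (h v) * h v)) \<le> 0 + e" by simp
  qed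
  moreover have "ifd (\<lambda>v. cnj (h v) * h v) = of_real (ifd (\<lambda>v. (norm (h v))\<^sup>2))"
  proof -
    have "(\<lambda>v. cnj (h v) * h v) = (\<lambda>v. of_real ((norm (h v))\<^sup>2))"
      by (simp add: complex_norm_square mult.commute del: of_real_power)
    then show ?thesis
      by (simp only: ifd_def set_integral_complex_of_real)
  qed
  ultimately have z: "ifd (\<lambda>v. (norm (h v))\<^sup>2) = 0" by simp
  define m where "m = (\<Sum>b\<in>Bs. (1/2) *\<^sub>R b)"
  \<comment> \<open>As \<open>m\<close> is the centre of \<open>fd\<close>, the domain
    \<open>w + fd\<close> has \<open>v0\<close> in its interior even when \<open>v0\<close> lies on
    the boundary of a tile of the original tiling.\<close>
  define w where "w = v0 - m"
  define U where "U = (\<Inter>b\<in>Bs. {v. 0 < crd b (v - w)} \<inter> {v. crd b (v - w) < 1}) \<inter> {v. h v \<noteq> 0}"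
  have "open U"
    unfolding U_def
    by (intro open_Int open_INT Bs(3) ballI open_Collect_less open_Collect_neq continuous_intros h) 
  moreover have "v0 \<in> U"
  proof -
    have "0 < crd b (v0 - w)" "crd b (v0 - w) < 1" if "b \<in> Bs" for b
      using coord_comb[OF Bs(1,2) that, of "\<lambda>_. 1/2"] by (simp_all add: w_def m_def)
    then show ?thesis by (auto simp: U_def nz)
  qed
  ultimately have nU: "\<not> negligible U" using open_not_negligible by blast
  have c2: "continuous_on UNIV (\<lambda>v. (norm (h v))\<^sup>2)" by (intro continuous_intros h)
  have int: "integrable (dvol \<Lambda>) (\<lambda>v. indicat_real fd (v - w) *\<^sub>R (norm (h v))\<^sup>2)"
  proof -
    have "continuous_on UNIV (\<lambda>v. (norm (h (v + w)))\<^sup>2)"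
      by (intro continuous_intros continuous_on_compose2[OF h]) auto
    from integrable_dvol_translate[OF set_integrable_fd[OF this, unfolded set_integrable_def], of "-w"]
    show ?thesis by simp
  qed
  have "(LINT v|dvol \<Lambda>. indicat_real fd (v - w) *\<^sub>R (norm (h v))\<^sup>2) = 0"
    using ifd_translate(1)[OF c2, of w] per z by simp
  then have "AE v in dvol \<Lambda>. indicat_real fd (v - w) *\<^sub>R (norm (h v))\<^sup>2 = 0"
    using integral_nonneg_eq_0_iff_AE[OF int] by auto
  then have "AE v in lborel. indicat_real fd (v - w) *\<^sub>R (norm (h v))\<^sup>2 = 0"
    unfolding dvol_def using covolume_pos by (subst (asm) AE_density) auto
  moreover have "v - w \<in> fd \<and> h v \<noteq> 0" if "v \<in> U" for v
    using that by (auto simp: U_def fd_def less_imp_le)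
  ultimately have "AE v in lborel. v \<notin> U"
    by (auto elim!: eventually_mono)
  then have "emeasure lborel U = 0"
    using AE_iff_measurable[of U lborel "\<lambda>v. v \<notin> U"] \<open>open U\<close> by simp
  then show False
    using nU \<open>open U\<close> by (simp add: negligible_iff_emeasure0)
qed

section \<open>Poisson summation\<close>

lemma ft_summable:
  assumes "test_fun \<psi>"
  shows "(\<lambda>\<gamma>. norm (ft \<psi> \<gamma>)) summable_on dual_lattice \<Lambda>"
proof -
  obtain C where C: "\<And>\<gamma>. norm (ft \<psi> \<gamma>) * (\<Prod>b\<in>Bs. 1 + (blinfun_apply \<gamma> b)\<^sup>2) \<le> C"
    using ft_decay[OF Bs(3) assms] by blast
  have "(\<lambda>\<gamma>. \<Prod>b\<in>Bs. 1 / (1 + (blinfun_apply \<gamma> b)\<^sup>2)) summable_on dual_lattice \<Lambda>"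
  proof (rule summable_on_linear_forms[OF Bs(3)])
    fix \<gamma> \<delta> :: "'a \<Rightarrow>\<^sub>L real" assume eq: "\<And>b. b \<in> Bs \<Longrightarrow> blinfun_apply \<gamma> b = blinfun_apply \<delta> b"
    show "\<gamma> = \<delta>"
    proof (rule blinfun_eqI)
      fix v
      have "blinfun_apply \<gamma> (\<Sum>b\<in>Bs. crd b v *\<^sub>R b) = blinfun_apply \<delta> (\<Sum>b\<in>Bs. crd b v *\<^sub>R b)"
        by (simp add: blinfun.sum_right blinfun.scaleR_right eq)
      then show "blinfun_apply \<gamma> v = blinfun_apply \<delta> v" by (simp add: coord_sum Bs)
    qed
  qed (auto simp: dual_lattice_iff)
  then have "(\<lambda>\<gamma>. C * (\<Prod>b\<in>Bs. 1 / (1 + (blinfun_apply \<gamma> b)\<^sup>2))) summable_on dual_lattice \<Lambda>"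
    by (rule summable_on_cmult_right)
  then show ?thesis
  proof (rule summable_on_comparison_test)
    fix \<gamma> :: "'a \<Rightarrow>\<^sub>L real"
    have "0 < (\<Prod>b\<in>Bs. 1 + (blinfun_apply \<gamma> b)\<^sup>2)"
      by (intro prod_pos) (auto intro: add_pos_nonneg)
    then show "norm (ft \<psi> \<gamma>) \<le> C * (\<Prod>b\<in>Bs. 1 / (1 + (blinfun_apply \<gamma> b)\<^sup>2))"
      using C[of \<gamma>] by (simp add: prod_dividef pos_le_divide_eq)
  qed auto
qed

definition perd :: "('a \<Rightarrow> complex) \<Rightarrow> 'a \<Rightarrow> complex" where
  "perd \<psi> v = (\<Sum>\<^sub>\<infinity>l\<in>\<Lambda>. \<psi> (v + l))"

lemma perd_finite:
  assumes R: "\<And>v. norm v > R \<Longrightarrow> \<psi> v = 0" and v: "norm v \<le> S"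
  shows "perd \<psi> v = (\<Sum>l\<in>\<Lambda> \<inter> cball 0 (R + S). \<psi> (v + l))"
proof -
  have "\<psi> (v + l) = 0" if "l \<notin> cball 0 (R + S)" for l
  proof (rule R)
    have "norm l \<le> norm (v + l) + norm v"
      by (metis add_diff_cancel_left' norm_triangle_ineq4)
    with that v show "R < norm (v + l)" by auto
  qed
  then have "perd \<psi> v = (\<Sum>\<^sub>\<infinity>l\<in>\<Lambda> \<inter> cball 0 (R + S). \<psi> (v + l))"
    unfolding perd_def by (intro infsum_cong_neutral) auto
  also have "\<dots> = (\<Sum>l\<in>\<Lambda> \<inter> cball 0 (R + S). \<psi> (v + l))"
    by (intro infsum_finite finite_lattice_bounded) auto
  finally show ?thesis .
qed

text \<open>Near each point the lattice sum ranges over one fixed finite set.\<close>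

lemma continuous_perd:
  assumes "continuous_on UNIV \<psi>" "bsupp \<psi>"
  shows "continuous_on UNIV (perd \<psi>)"
  unfolding continuous_on_eq_continuous_at[OF open_UNIV]
proof
  fix v0 :: 'a
  obtain R where R: "\<And>v. norm v > R \<Longrightarrow> \<psi> v = 0" using assms(2) by (auto simp: bsupp_def)
  define S where "S = norm v0 + 1"
  have "continuous_on (ball 0 S) (\<lambda>v. \<Sum>l\<in>\<Lambda> \<inter> cball 0 (R + S). \<psi> (v + l))"
    by (intro continuous_intros continuous_on_compose2[OF assms(1)]) auto
  then have "continuous_on (ball 0 S) (perd \<psi>)"
    using perd_finite[of R \<psi> _ S, OF R] by (subst continuous_on_cong[OF refl]) auto
  then show "continuous (at v0) (perd \<psi>)"
    by (rule continuous_on_interior) (auto simp: S_def)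
qed

lemma perd_periodic: "l \<in> \<Lambda> \<Longrightarrow> perd \<psi> (v + l) = perd \<psi> v"
proof -
  assume l: "l \<in> \<Lambda>"
  have "bij_betw (\<lambda>m. l + m) \<Lambda> \<Lambda>"
    using l by (intro bij_betwI[of _ _ _ "\<lambda>m. m - l"]) (auto simp: lattice_add lattice_diff)
  from infsum_reindex_bij_betw[OF this, of "\<lambda>m. \<psi> (v + m)"]
  show ?thesis by (simp add: perd_def add.assoc)
qed

text \<open>Unfolding: the character is periodic, so the tiles of the integral over the whole space
  add up to the torus coefficient of the periodised function.\<close>

lemma ifd_perd:
  assumes c: "continuous_on UNIV \<psi>" "bsupp \<psi>" and g: "\<gamma> \<in> dual_lattice \<Lambda>"
  shows "ifd (\<lambda>v. echar \<gamma> v * perd \<psi> v) = ft \<psi> \<gamma>"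
proof -
  obtain R where R: "\<And>v. norm v > R \<Longrightarrow> \<psi> v = 0" using c(2) by (auto simp: bsupp_def)
  define A where "A = \<Lambda> \<inter> cball 0 (R + rfd)"
  have A: "finite A" "A \<subseteq> \<Lambda>" unfolding A_def by (auto intro: finite_lattice_bounded)
  have "ft \<psi> \<gamma> = ifd (\<lambda>v. \<Sum>l\<in>A. echar \<gamma> (v + l) * \<psi> (v + l))"
    unfolding ft_def
  proof (rule ifd_tile[OF _ A])
    show "integrable (dvol \<Lambda>) (\<lambda>v. echar \<gamma> v * \<psi> v)"
      by (intro integrable_bsupp continuous_intros continuous_on_echar c bsupp_mult_left)
    fix v assume "echar \<gamma> v * \<psi> v \<noteq> 0"
    then have "norm v \<le> R" using R[of v] by (cases "norm v \<le> R") auto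
    moreover have "norm (v - flr v) \<le> rfd" using fd_flr[OF flr_lattice] rfd by blast
    moreover have "norm (flr v) \<le> norm v + norm (v - flr v)"
      by (metis add.commute diff_add_cancel norm_minus_commute norm_triangle_sub)
    ultimately show "flr v \<in> A" by (simp add: A_def flr_lattice)
  qed
  also have "\<dots> = ifd (\<lambda>v. echar \<gamma> v * perd \<psi> v)"
    unfolding ifd_def
  proof (rule set_lebesgue_integral_cong)
    show "\<forall>v. v \<in> fd \<longrightarrow> (\<Sum>l\<in>A. echar \<gamma> (v + l) * \<psi> (v + l)) = echar \<gamma> v * perd \<psi> v"
    proof (intro allI impI)
      fix v assume "v \<in> fd"
      then have "perd \<psi> v = (\<Sum>l\<in>A. \<psi> (v + l))"
        unfolding A_def by (intro perd_finite R rfd)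
      then show "(\<Sum>l\<in>A. echar \<gamma> (v + l) * \<psi> (v + l)) = echar \<gamma> v * perd \<psi> v"
        using A(2) g by (simp add: sum_distrib_left echar_periodic subset_iff cong: sum.cong)
    qed
  qed simp
  finally show ?thesis by simp
qed

text \<open>The periodisation and its Fourier series are continuous periodic functions with the same
  coefficients. Uniqueness identifies them everywhere, and the formula is their equality at
  0.\<close>

lemma poisson:
  assumes "test_fun \<psi>"
  shows "(\<Sum>\<^sub>\<infinity>l\<in>\<Lambda>. \<psi> l) = (\<Sum>\<^sub>\<infinity>\<gamma>\<in>dual_lattice \<Lambda>. ft \<psi> \<gamma>)"
proof -
  have c: "continuous_on UNIV \<psi>" "bsupp \<psi>" using assms by (auto simp: test_fun_iff smooth_continuous_on)
  define \<Gamma> where "\<Gamma> = dual_lattice \<Lambda>"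
  define s where "s v = (\<Sum>\<^sub>\<infinity>\<gamma>\<in>\<Gamma>. ft \<psi> \<gamma> * echar (- \<gamma>) v)" for v
  define F where "F = finite_subsets_at_top \<Gamma>"
  have F: "F \<noteq> bot" by (simp add: F_def)
  \<comment> \<open>Absolute summability of the coefficients gives uniform convergence, so the sum
    is continuous and may be integrated against characters term by term.\<close>
  have unif: "uniform_limit UNIV (\<lambda>A v. \<Sum>\<gamma>\<in>A. ft \<psi> \<gamma> * echar (- \<gamma>) v) s F"
    unfolding s_def[abs_def] F_def
    by (rule Weierstrass_m_test_general[OF _ ft_summable[OF assms, folded \<Gamma>_def]]) (simp add: norm_mult)
  have cp: "continuous_on UNIV (\<lambda>v. \<Sum>\<gamma>\<in>A. ft \<psi> \<gamma> * echar (- \<gamma>) v)" for A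
    by (intro continuous_intros continuous_on_echar)
  have cs: "continuous_on UNIV s"
    by (rule uniform_limit_theorem[OF _ unif F]) (simp add: cp)
  have pers: "s (v + l) = s v" if "l \<in> \<Lambda>" for v l
    unfolding s_def using that by (intro infsum_cong) (simp add: echar_periodic dual_minus \<Gamma>_def)
  have coefs: "ifd (\<lambda>v. echar \<delta> v * s v) = ft \<psi> \<delta>" if d: "\<delta> \<in> \<Gamma>" for \<delta>
  proof -
    have "((\<lambda>A. ifd (\<lambda>v. echar \<delta> v * (\<Sum>\<gamma>\<in>A. ft \<psi> \<gamma> * echar (- \<gamma>) v))) \<longlongrightarrow> ifd (\<lambda>v. echar \<delta> v * s v)) F"
    proof (rule tendstoI)
      fix e :: real assume "0 < e"
      then have "\<forall>\<^sub>F A in F. \<forall>v\<in>UNIV. dist (\<Sum>\<gamma>\<in>A. ft \<psi> \<gamma> * echar (- \<gamma>) v) (s v) < e/2"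
        using uniform_limitD[OF unif, of "e/2"] by simp
      then show "\<forall>\<^sub>F A in F. dist (ifd (\<lambda>v. echar \<delta> v * (\<Sum>\<gamma>\<in>A. ft \<psi> \<gamma> * echar (- \<gamma>) v))) (ifd (\<lambda>v. echar \<delta> v * s v)) < e"
      proof eventually_elim
        case (elim A)
        have "dist (ifd (\<lambda>v. echar \<delta> v * (\<Sum>\<gamma>\<in>A. ft \<psi> \<gamma> * echar (- \<gamma>) v))) (ifd (\<lambda>v. echar \<delta> v * s v)) =
            norm (ifd (\<lambda>v. echar \<delta> v * (\<Sum>\<gamma>\<in>A. ft \<psi> \<gamma> * echar (- \<gamma>) v) - echar \<delta> v * s v))"
          by (subst ifd_diff) (auto simp: dist_norm intro!: continuous_on_mult continuous_on_echar cp cs)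
        also have "\<dots> \<le> e/2"
        proof (rule ifd_norm_le)
          show "continuous_on UNIV (\<lambda>v. echar \<delta> v * (\<Sum>\<gamma>\<in>A. ft \<psi> \<gamma> * echar (- \<gamma>) v) - echar \<delta> v * s v)"
            by (intro continuous_on_diff continuous_on_mult continuous_on_echar cp cs)
          fix v
          show "norm (echar \<delta> v * (\<Sum>\<gamma>\<in>A. ft \<psi> \<gamma> * echar (- \<gamma>) v) - echar \<delta> v * s v) \<le> e/2"
            using elim by (auto simp: right_diff_distrib[symmetric] norm_mult dist_norm less_imp_le)
        qed
        also have "\<dots> < e" using \<open>0 < e\<close> by simp
        finally show ?case .
      qed
    qed
    \<comment> \<open>By orthogonality the integral is constant as soon as \<open>\<delta>\<close>
      belongs to the finite set.\<close>
    moreover have "\<forall>\<^sub>F A in F. ifd (\<lambda>v. echar \<delta> v * (\<Sum>\<gamma>\<in>A. ft \<psi> \<gamma> * echar (- \<gamma>) v)) = ft \<psi> \<delta>"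
    proof -
      have "\<forall>\<^sub>F A in F. finite A \<and> {\<delta>} \<subseteq> A \<and> A \<subseteq> \<Gamma>"
        unfolding F_def eventually_finite_subsets_at_top using d by (intro exI[of _ "{\<delta>}"]) auto
      then show ?thesis
      proof eventually_elim
        case (elim A)
        have "ifd (\<lambda>v. echar \<delta> v * (\<Sum>\<gamma>\<in>A. ft \<psi> \<gamma> * echar (- \<gamma>) v)) =
            ifd (\<lambda>v. \<Sum>\<gamma>\<in>A. ft \<psi> \<gamma> * echar (\<delta> + - \<gamma>) v)"
          by (simp only: sum_distrib_left echar_plus mult_ac)
        also have "\<dots> = (\<Sum>\<gamma>\<in>A. ft \<psi> \<gamma> * ifd (echar (\<delta> + - \<gamma>)))"
          by (subst ifd_sum) (auto intro!: continuous_intros continuous_on_echar simp: ifd_cmult)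
        also have "\<dots> = (\<Sum>\<gamma>\<in>A. if \<gamma> = \<delta> then ft \<psi> \<delta> else 0)"
        proof (intro sum.cong refl)
          fix \<gamma> assume "\<gamma> \<in> A"
          then have "ifd (echar (\<delta> + - \<gamma>)) = (if \<delta> + - \<gamma> = 0 then 1 else 0)"
            using elim d by (intro ifd_echar dual_add dual_minus) (auto simp: \<Gamma>_def)
          then show "ft \<psi> \<gamma> * ifd (echar (\<delta> + - \<gamma>)) = (if \<gamma> = \<delta> then ft \<psi> \<delta> else 0)" by auto
        qed
        also have "\<dots> = ft \<psi> \<delta>" using elim by simp
        finally show ?case .
      qed
    qed
    ultimately show ?thesis
      by (intro tendsto_unique[OF F _ tendsto_eventually])
  qed
  have "perd \<psi> 0 - s 0 = 0"
  proof (rule fourier_unique[of "\<lambda>v. perd \<psi> v - s v"])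
    show "continuous_on UNIV (\<lambda>v. perd \<psi> v - s v)"
      by (intro continuous_on_diff continuous_perd c cs)
    show "perd \<psi> (v + l) - s (v + l) = perd \<psi> v - s v" if "l \<in> \<Lambda>" for v l
      using that by (simp add: perd_periodic pers)
    fix \<gamma> assume g: "\<gamma> \<in> dual_lattice \<Lambda>"
    have "ifd (\<lambda>v. echar \<gamma> v * (perd \<psi> v - s v)) = ifd (\<lambda>v. echar \<gamma> v * perd \<psi> v) - ifd (\<lambda>v. echar \<gamma> v * s v)"
      unfolding right_diff_distrib
      by (intro ifd_diff continuous_on_mult continuous_on_echar continuous_perd c cs)
    then show "ifd (\<lambda>v. echar \<gamma> v * (perd \<psi> v - s v)) = 0"
      using g by (simp add: ifd_perd c coefs \<Gamma>_def)
  qed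
  then show ?thesis
    by (simp add: perd_def s_def \<Gamma>_def echar_def)
qed

end

section \<open>Fourier series with square summable coefficients\<close>

text \<open>The sum of the norms has a finite integral, by exchange of sum and integral for
  nonnegative functions, hence is finite almost everywhere.\<close>

lemma AE_summable_norm:
  fixes f :: "nat \<Rightarrow> 'a \<Rightarrow> 'b::{banach, second_countable_topology}"
  assumes f: "\<And>i. integrable M (f i)" and s: "summable (\<lambda>i. LINT x|M. norm (f i x))"
  shows "AE x in M. summable (\<lambda>i. norm (f i x))"
proof -
  have [measurable]: "f i \<in> borel_measurable M" for i
    by (rule borel_measurable_integrable[OF f])
  have "(\<integral>\<^sup>+x. (\<Sum>i. ennreal (norm (f i x))) \<partial>M) = (\<Sum>i. \<integral>\<^sup>+x. ennreal (norm (f i x)) \<partial>M)"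
    by (rule nn_integral_suminf) measurable
  also have "\<dots> = (\<Sum>i. ennreal (LINT x|M. norm (f i x)))"
    by (intro suminf_cong nn_integral_eq_integral integrable_norm f) auto
  also have "\<dots> = ennreal (\<Sum>i. LINT x|M. norm (f i x))"
    by (rule suminf_ennreal2) (auto intro: s)
  finally have "(\<integral>\<^sup>+x. (\<Sum>i. ennreal (norm (f i x))) \<partial>M) \<noteq> \<infinity>" by simp
  then have "AE x in M. (\<Sum>i. ennreal (norm (f i x))) \<noteq> \<infinity>"
    by (intro nn_integral_PInf_AE) measurable
  then show ?thesis
    by eventually_elim (auto intro: summable_suminf_not_top)
qed

text \<open>Cauchy criterion: the sums over \<open>A\<close> and over \<open>A \<union> B\<close>
  are both within \<open>e / 2\<close> of the total, so their difference, the sum over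
  \<open>B\<close>, is at most \<open>e\<close>.\<close>

lemma summable_tail_small:
  fixes f :: "'a \<Rightarrow> real"
  assumes s: "f summable_on G" and pos: "\<And>x. 0 \<le> f x" and e: "0 < e"
  shows "\<exists>A. finite A \<and> A \<subseteq> G \<and> (\<forall>B. finite B \<longrightarrow> B \<subseteq> G \<longrightarrow> B \<inter> A = {} \<longrightarrow> sum f B \<le> e)"
proof -
  obtain S where "(f has_sum S) G" using s by (auto simp: summable_on_def)
  then have "\<forall>\<^sub>F A in finite_subsets_at_top G. dist (sum f A) S < e/2"
    unfolding has_sum_def using e tendstoD half_gt_zero by blast
  then obtain A where A: "finite A" "A \<subseteq> G" "\<And>B. finite B \<Longrightarrow> A \<subseteq> B \<Longrightarrow> B \<subseteq> G \<Longrightarrow> dist (sum f B) S < e/2"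
    unfolding eventually_finite_subsets_at_top by metis
  have "sum f B \<le> e" if B: "finite B" "B \<subseteq> G" "B \<inter> A = {}" for B
  proof -
    have "sum f (A \<union> B) = sum f A + sum f B"
      using A(1) B by (intro sum.union_disjoint) auto
    moreover have "dist (sum f (A \<union> B)) S < e/2" "dist (sum f A) S < e/2"
      using A B by auto
    ultimately show ?thesis unfolding dist_real_def by linarith
  qed
  with A show ?thesis by blast
qed

context euclidean_lattice
begin

lemma parseval:
  assumes B: "finite B" "B \<subseteq> dual_lattice \<Lambda>"
  shows "ifd (\<lambda>v. (norm (\<Sum>\<gamma>\<in>B. c \<gamma> * echar \<gamma> v))\<^sup>2) = (\<Sum>\<gamma>\<in>B. (norm (c \<gamma>))\<^sup>2)"
proof -
  define t where "t v = (\<Sum>\<gamma>\<in>B. c \<gamma> * echar \<gamma> v)" for v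
  have "complex_of_real (ifd (\<lambda>v. (norm (t v))\<^sup>2)) = ifd (\<lambda>v. complex_of_real ((norm (t v))\<^sup>2))"
    by (simp only: ifd_def set_integral_complex_of_real)
  also have "\<dots> = ifd (\<lambda>v. \<Sum>\<gamma>\<in>B. \<Sum>\<delta>\<in>B. (c \<gamma> * cnj (c \<delta>)) * echar (\<gamma> + - \<delta>) v)"
    by (simp only: t_def complex_norm_square sum_product cnj_sum complex_cnj_mult cnj_echar echar_plus mult_ac)
  also have "\<dots> = (\<Sum>\<gamma>\<in>B. \<Sum>\<delta>\<in>B. (c \<gamma> * cnj (c \<delta>)) * ifd (echar (\<gamma> + - \<delta>)))"
    by (simp only: ifd_sum continuous_on_sum continuous_on_mult continuous_on_const continuous_on_echar ifd_cmult)
  also have "\<dots> = (\<Sum>\<gamma>\<in>B. \<Sum>\<delta>\<in>B. if \<delta> = \<gamma> then c \<gamma> * cnj (c \<gamma>) else 0)"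
  proof (intro sum.cong refl)
    fix \<gamma> \<delta> assume "\<gamma> \<in> B" "\<delta> \<in> B"
    then have "ifd (echar (\<gamma> + - \<delta>)) = (if \<gamma> + - \<delta> = 0 then 1 else 0)"
      using B by (intro ifd_echar dual_add dual_minus) auto
    then show "c \<gamma> * cnj (c \<delta>) * ifd (echar (\<gamma> + - \<delta>)) = (if \<delta> = \<gamma> then c \<gamma> * cnj (c \<gamma>) else 0)"
      by auto
  qed
  also have "\<dots> = (\<Sum>\<gamma>\<in>B. c \<gamma> * cnj (c \<gamma>))"
    using B by simp
  also have "\<dots> = complex_of_real (\<Sum>\<gamma>\<in>B. (norm (c \<gamma>))\<^sup>2)"
    by (simp add: complex_norm_square del: of_real_power)
  finally show ?thesis
    by (simp only: of_real_eq_iff t_def)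
qed

text \<open>The ball is covered by finitely many tiles, each contributing the same amount by
  periodicity. The factor does not depend on \<open>u\<close>, so a series summable on the torus is
  summable on every ball.\<close>

lemma integral_ball_le_ifd:
  fixes u :: "'a \<Rightarrow> complex"
  assumes u: "continuous_on UNIV u" and per: "\<And>v l. l \<in> \<Lambda> \<Longrightarrow> u (v + l) = u v"
  shows "(LINT v|dvol \<Lambda>. norm (indicat_real (cball 0 R) v *\<^sub>R u v)) \<le>
    card (\<Lambda> \<inter> cball 0 (R + rfd)) * ifd (\<lambda>v. norm (u v))"
proof -
  define A where "A = \<Lambda> \<inter> cball 0 (R + rfd)"
  have A: "finite A" "A \<subseteq> \<Lambda>" unfolding A_def by (auto intro: finite_lattice_bounded)
  have cu: "continuous_on UNIV (\<lambda>v. norm (u v))" by (intro continuous_intros u)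
  have ind: "indicat_real (cball 0 R) v \<le> (\<Sum>l\<in>A. indicat_real fd (v - l))" for v
  proof (cases "v \<in> cball 0 R")
    case True
    have 1: "v - flr v \<in> fd" using fd_flr[OF flr_lattice] by blast
    have "norm (flr v) \<le> norm v + norm (v - flr v)"
      by (metis add.commute diff_add_cancel norm_minus_commute norm_triangle_sub)
    with True rfd[OF 1] have "flr v \<in> A" by (auto simp: A_def flr_lattice)
    then have "indicat_real fd (v - flr v) \<le> (\<Sum>l\<in>A. indicat_real fd (v - l))"
      by (intro member_le_sum A) auto
    with True 1 show ?thesis by simp
  qed (auto intro!: sum_nonneg)
  have int1: "integrable (dvol \<Lambda>) (\<lambda>v. indicat_real (cball 0 R) v *\<^sub>R u v)"
    unfolding integrable_dvol
    by (intro borel_integrable_compact continuous_on_subset[OF u]) auto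
  have int2: "integrable (dvol \<Lambda>) (\<lambda>v. indicat_real fd (v - l) *\<^sub>R norm (u v))" for l
  proof -
    have "continuous_on UNIV (\<lambda>v. norm (u (v + l)))"
      by (intro continuous_intros continuous_on_compose2[OF u]) auto
    from integrable_dvol_translate[OF set_integrable_fd[OF this, unfolded set_integrable_def], of "-l"]
    show ?thesis by simp
  qed
  have "(LINT v|dvol \<Lambda>. norm (indicat_real (cball 0 R) v *\<^sub>R u v)) \<le>
      (LINT v|dvol \<Lambda>. (\<Sum>l\<in>A. indicat_real fd (v - l) *\<^sub>R norm (u v)))"
  proof (rule integral_mono)
    fix v
    have "norm (indicat_real (cball 0 R) v *\<^sub>R u v) = indicat_real (cball 0 R) v * norm (u v)" by simp
    also have "\<dots> \<le> (\<Sum>l\<in>A. indicat_real fd (v - l)) * norm (u v)"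
      by (intro mult_right_mono ind) auto
    finally show "norm (indicat_real (cball 0 R) v *\<^sub>R u v) \<le> (\<Sum>l\<in>A. indicat_real fd (v - l) *\<^sub>R norm (u v))"
      by (simp add: sum_distrib_right)
  next
    show "integrable (dvol \<Lambda>) (\<lambda>v. norm (indicat_real (cball 0 R) v *\<^sub>R u v))"
      by (rule integrable_norm[OF int1])
  qed (use int2 in auto)
  also have "\<dots> = (\<Sum>l\<in>A. LINT v|dvol \<Lambda>. indicat_real fd (v - l) *\<^sub>R norm (u v))"
    by (intro Bochner_Integration.integral_sum int2)
  also have "\<dots> = (\<Sum>l\<in>A. ifd (\<lambda>v. norm (u v)))"
    by (intro sum.cong refl ifd_translate(1) cu) (simp add: per)
  finally show ?thesis by (simp add: A_def)
qed

text \<open>Frequencies are added in finite blocks whose tails of squares stay below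
  \<open>(1/4)^k\<close>. Parseval bounds the L2 norm of a block, and thus its L1 norm on the torus,
  by \<open>(1/2)^k\<close>, so the blocks sum absolutely almost everywhere and in L1 on balls.
  Against a test function the limit is compared with the absolutely convergent sum over all of
  \<open>G\<close>.\<close>

lemma riesz_fischer:
  assumes G: "G \<subseteq> dual_lattice \<Lambda>" and l2: "(\<lambda>\<gamma>. (norm (c \<gamma>))\<^sup>2) summable_on G"
  shows "\<exists>F. loc_L1 \<Lambda> F \<and> (\<forall>\<phi>. test_fun \<phi> \<longrightarrow> dist_of \<Lambda> F \<phi> = (\<Sum>\<^sub>\<infinity>\<gamma>\<in>G. c \<gamma> * ft \<phi> \<gamma>))"
proof -
  have "\<exists>A. finite A \<and> A \<subseteq> G \<and> (\<forall>B. finite B \<longrightarrow> B \<subseteq> G \<longrightarrow> B \<inter> A = {} \<longrightarrow> (\<Sum>\<gamma>\<in>B. (norm (c \<gamma>))\<^sup>2) \<le> (1/4) ^ k)" for k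
    by (rule summable_tail_small[OF l2]) auto
  then obtain A' where A': "\<And>k. finite (A' k)" "\<And>k. A' k \<subseteq> G"
    "\<And>k B. finite B \<Longrightarrow> B \<subseteq> G \<Longrightarrow> B \<inter> A' k = {} \<Longrightarrow> (\<Sum>\<gamma>\<in>B. (norm (c \<gamma>))\<^sup>2) \<le> (1/4) ^ k"
    by metis
  \<comment> \<open>The chosen sets \<open>A' k\<close> may fail to be nested; unions make them
    increasing without enlarging the tails.\<close>
  define A where "A k = (\<Union>j\<le>k. A' j)" for k
  have A: "finite (A k)" "A k \<subseteq> G" "A k \<subseteq> A (Suc k)" for k
    using A' by (auto simp: A_def intro: le_SucI)
  have tail: "(\<Sum>\<gamma>\<in>B. (norm (c \<gamma>))\<^sup>2) \<le> (1/4) ^ k" if "finite B" "B \<subseteq> G" "B \<inter> A k = {}" for k B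
    using that by (intro A'(3)) (auto simp: A_def)
  define S where "S k v = (\<Sum>\<gamma>\<in>A k. c \<gamma> * echar \<gamma> v)" for k v
  define u where "u k v = (\<Sum>\<gamma>\<in>A (Suc k) - A k. c \<gamma> * echar \<gamma> v)" for k v
  have u_eq: "u k v = S (Suc k) v - S k v" for k v
    unfolding u_def S_def using A by (simp add: sum_diff)
  have cu: "continuous_on UNIV (u k)" and cS: "continuous_on UNIV (S k)" for k
    unfolding u_def[abs_def] S_def[abs_def] by (intro continuous_intros continuous_on_echar)+
  have [measurable]: "u k \<in> borel_measurable borel" "S k \<in> borel_measurable borel" for k
    by (intro continuous_borel cu cS)+
  have per: "u k (v + l) = u k v" if "l \<in> \<Lambda>" for k v l
    unfolding u_def using that A(2)[of "Suc k"] G by (intro sum.cong) (auto simp: echar_periodic)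
  have u1: "ifd (\<lambda>v. norm (u k v)) \<le> (1/2) ^ k" for k
  proof -
    have "ifd (\<lambda>v. norm (u k v)) \<le> ifd (\<lambda>v. (2 ^ k * (norm (u k v))\<^sup>2 + (1/2) ^ k) / 2)"
      unfolding ifd_def
    proof (intro set_integral_mono set_integrable_fd continuous_intros cu)
      fix v
      \<comment> \<open>AM-GM, turning the \<open>L\<^sup>2\<close> bound \<open>4\<^sup>-\<^sup>k\<close> into an \<open>L\<^sup>1\<close> bound \<open>2\<^sup>-\<^sup>k\<close>\<close>
      have "0 \<le> (2 ^ k * norm (u k v) - 1)\<^sup>2 / (2 * 2 ^ k)" by simp
      also have "\<dots> = (2 ^ k * (norm (u k v))\<^sup>2 + (1/2) ^ k) / 2 - norm (u k v)"
        by (simp add: field_simps power2_eq_square)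
      finally show "norm (u k v) \<le> (2 ^ k * (norm (u k v))\<^sup>2 + (1/2) ^ k) / 2" by simp
    qed simp
    also have "\<dots> = (2 ^ k * ifd (\<lambda>v. (norm (u k v))\<^sup>2) + (1/2) ^ k) / 2"
    proof -
      have "ifd (\<lambda>v. 2 ^ k * (norm (u k v))\<^sup>2 + (1/2) ^ k) = 2 ^ k * ifd (\<lambda>v. (norm (u k v))\<^sup>2) + (1/2) ^ k"
        by (subst ifd_add) (auto simp: ifd_const intro!: continuous_intros cu, simp add: ifd_def)
      then show ?thesis by (simp add: ifd_def)
    qed
    also have "ifd (\<lambda>v. (norm (u k v))\<^sup>2) = (\<Sum>\<gamma>\<in>A (Suc k) - A k. (norm (c \<gamma>))\<^sup>2)"
      unfolding u_def using A(1,2)[of "Suc k"] G by (intro parseval) auto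
    also have "\<dots> \<le> (1/4) ^ k"
      using A by (intro tail) auto
    finally have "ifd (\<lambda>v. norm (u k v)) \<le> (2 ^ k * (1/4) ^ k + (1/2) ^ k) / 2"
      by simp
    also have "(2::real) ^ k * (1/4) ^ k = (1/2) ^ k"
      by (simp add: power_mult_distrib[symmetric])
    finally show ?thesis by simp
  qed
  \<comment> \<open>On the null set where the blocks diverge the value is arbitrary, which no
    integral notices.\<close>
  define F where "F v = S 0 v + (\<Sum>k. u k v)" for v
  have intR: "integrable (dvol \<Lambda>) (\<lambda>v. indicat_real (cball 0 R) v *\<^sub>R u k v)"
    "integrable (dvol \<Lambda>) (\<lambda>v. indicat_real (cball 0 R) v *\<^sub>R S k v)" for R k
    unfolding integrable_dvol
    by (intro borel_integrable_compact continuous_on_subset[OF cu] continuous_on_subset[OF cS]; simp)+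
  have sumR: "summable (\<lambda>k. LINT v|dvol \<Lambda>. norm (indicat_real (cball 0 R) v *\<^sub>R u k v))" for R
  proof (rule summable_comparison_test')
    show "summable (\<lambda>k. card (\<Lambda> \<inter> cball 0 (R + rfd)) * (1/2::real) ^ k)"
      by (intro summable_mult summable_geometric) simp
    fix k
    have "(LINT v|dvol \<Lambda>. norm (indicat_real (cball 0 R) v *\<^sub>R u k v)) \<le>
        card (\<Lambda> \<inter> cball 0 (R + rfd)) * ifd (\<lambda>v. norm (u k v))"
      by (intro integral_ball_le_ifd cu per)
    also have "\<dots> \<le> card (\<Lambda> \<inter> cball 0 (R + rfd)) * (1/2) ^ k"
      by (intro mult_left_mono u1) simp
    finally show "norm (LINT v|dvol \<Lambda>. norm (indicat_real (cball 0 R) v *\<^sub>R u k v)) \<le>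
        card (\<Lambda> \<inter> cball 0 (R + rfd)) * (1/2) ^ k"
      by (simp add: integral_nonneg_AE del: norm_scaleR)
  qed
  have aeR: "AE v in dvol \<Lambda>. summable (\<lambda>k. norm (indicat_real (cball 0 R) v *\<^sub>R u k v))" for R
    by (rule AE_summable_norm[OF intR(1) sumR])
  have loc: "loc_L1 \<Lambda> F"
    unfolding loc_L1_def
  proof (intro allI impI)
    fix K :: "'a set" assume K: "compact K"
    then obtain R where R: "K \<subseteq> cball 0 R"
      using compact_imp_bounded[OF K] by (auto simp: bounded_iff subset_iff)
    have "integrable (dvol \<Lambda>) (\<lambda>v. (\<Sum>k. indicat_real (cball 0 R) v *\<^sub>R u k v))"
      by (rule integrable_suminf[OF intR(1) aeR sumR])
    moreover have "(\<Sum>k. indicat_real (cball 0 R) v *\<^sub>R u k v) = indicat_real (cball 0 R) v *\<^sub>R (\<Sum>k. u k v)" for v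
      by (cases "v \<in> cball 0 R") auto
    ultimately have "set_integrable (dvol \<Lambda>) (cball 0 R) (\<lambda>v. \<Sum>k. u k v)"
      by (simp add: set_integrable_def)
    moreover have "set_integrable (dvol \<Lambda>) (cball 0 R) (S 0)"
      using intR(2) by (simp add: set_integrable_def)
    ultimately have "set_integrable (dvol \<Lambda>) (cball 0 R) F"
      unfolding F_def[abs_def] by (rule set_integral_add(1)[rotated])
    then show "set_integrable (dvol \<Lambda>) K F"
      using K R by (intro set_integrable_subset[of _ "cball 0 R" F K]) (auto intro: compact_imp_closed borel_closed)
  qed
  have "dist_of \<Lambda> F \<phi> = (\<Sum>\<^sub>\<infinity>\<gamma>\<in>G. c \<gamma> * ft \<phi> \<gamma>)" if t: "test_fun \<phi>" for \<phi>
  proof -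
    have c\<phi>: "continuous_on UNIV \<phi>" using t by (simp add: test_fun_iff smooth_continuous_on)
    have [measurable]: "\<phi> \<in> borel_measurable borel" by (rule continuous_borel[OF c\<phi>])
    obtain R where R: "\<And>v. norm v > R \<Longrightarrow> \<phi> v = 0" using t by (auto simp: test_fun_iff bsupp_def)
    have "compact (\<phi> ` cball 0 R)"
      by (intro compact_continuous_image continuous_on_subset[OF c\<phi>]) auto
    then obtain M where M: "\<And>v. v \<in> cball 0 R \<Longrightarrow> norm (\<phi> v) \<le> M"
      using compact_imp_bounded by (fastforce simp: bounded_iff)
    \<comment> \<open>Outside the ball the test function is zero, so L1 bounds on the ball control
      the pairing. The absolute value keeps the factor nonnegative when the ball is empty.\<close>
    have bound: "norm (u k v * \<phi> v) \<le> \<bar>M\<bar> * norm (indicat_real (cball 0 R) v *\<^sub>R u k v)" for k v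
    proof (cases "v \<in> cball 0 R")
      case True
      then show ?thesis
        using M[OF True] by (auto simp: norm_mult mult.commute intro!: mult_right_mono)
    qed (use R in auto)
    have int: "integrable (dvol \<Lambda>) (\<lambda>v. u k v * \<phi> v)" "integrable (dvol \<Lambda>) (\<lambda>v. S k v * \<phi> v)"
      "integrable (dvol \<Lambda>) (\<lambda>v. echar \<gamma> v * \<phi> v)" for k \<gamma>
      using t by (intro integrable_bsupp continuous_on_mult cu cS c\<phi> bsupp_mult_left continuous_on_echar; simp add: test_fun_iff)+
    have ae: "AE v in dvol \<Lambda>. summable (\<lambda>k. norm (u k v * \<phi> v))"
      using aeR[of R]
    proof eventually_elim
      case (elim v)
      show ?case
        by (rule summable_comparison_test'[OF summable_mult[OF elim, of "\<bar>M\<bar>"], of 0]) (use bound in simp)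
    qed
    have sm: "summable (\<lambda>k. LINT v|dvol \<Lambda>. norm (u k v * \<phi> v))"
    proof (rule summable_comparison_test'[OF summable_mult[OF sumR[of R], of "\<bar>M\<bar>"], of 0])
      fix k
      have "(LINT v|dvol \<Lambda>. norm (u k v * \<phi> v)) \<le> (LINT v|dvol \<Lambda>. \<bar>M\<bar> * norm (indicat_real (cball 0 R) v *\<^sub>R u k v))"
        using int intR bound by (intro integral_mono integrable_norm integrable_mult_right)
      then show "norm (LINT v|dvol \<Lambda>. norm (u k v * \<phi> v)) \<le> \<bar>M\<bar> * (LINT v|dvol \<Lambda>. norm (indicat_real (cball 0 R) v *\<^sub>R u k v))"
        by (simp add: integral_nonneg_AE del: norm_scaleR)
    qed
    define s where "s k = (LINT v|dvol \<Lambda>. S k v * \<phi> v)" for k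
    have s_eq: "s k = (\<Sum>\<gamma>\<in>A k. c \<gamma> * ft \<phi> \<gamma>)" for k
    proof -
      have "s k = (LINT v|dvol \<Lambda>. (\<Sum>\<gamma>\<in>A k. c \<gamma> * (echar \<gamma> v * \<phi> v)))"
        by (simp add: s_def S_def sum_distrib_right mult.assoc)
      then show ?thesis
        using int(3) by (simp add: ft_def)
    qed
    have "(\<lambda>k. LINT v|dvol \<Lambda>. u k v * \<phi> v) sums (LINT v|dvol \<Lambda>. (\<Sum>k. u k v * \<phi> v))"
      by (rule sums_integral[OF int(1) ae sm])
    moreover have "(LINT v|dvol \<Lambda>. u k v * \<phi> v) = s (Suc k) - s k" for k
      using int by (simp add: u_eq s_def left_diff_distrib)
    moreover have "(LINT v|dvol \<Lambda>. (\<Sum>k. u k v * \<phi> v)) = dist_of \<Lambda> F \<phi> - s 0"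
    proof -
      have eq: "AE v in dvol \<Lambda>. (\<Sum>k. u k v * \<phi> v) = (\<Sum>k. u k v) * \<phi> v"
        using aeR[of R]
      proof eventually_elim
        case (elim v)
        show ?case
        proof (cases "v \<in> cball 0 R")
          case True
          then have "summable (\<lambda>k. u k v)"
            using elim by (auto intro: summable_norm_cancel)
          then show ?thesis by (rule suminf_mult2[symmetric])
        next
          case False
          then show ?thesis using R[of v] by simp
        qed
      qed
      have i: "integrable (dvol \<Lambda>) (\<lambda>v. \<Sum>k. u k v * \<phi> v)"
        by (rule integrable_suminf[OF int(1) ae sm])
      have "dist_of \<Lambda> F \<phi> = (LINT v|dvol \<Lambda>. S 0 v * \<phi> v + (\<Sum>k. u k v) * \<phi> v)"
        by (simp add: dist_of_def F_def distrib_right)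
      also have "\<dots> = (LINT v|dvol \<Lambda>. S 0 v * \<phi> v + (\<Sum>k. u k v * \<phi> v))"
        using eq by (intro integral_cong_AE) auto
      also have "\<dots> = s 0 + (LINT v|dvol \<Lambda>. (\<Sum>k. u k v * \<phi> v))"
        unfolding s_def by (intro Bochner_Integration.integral_add int i)
      finally show ?thesis by simp
    qed
    ultimately have "(\<lambda>n. \<Sum>k<n. s (Suc k) - s k) \<longlonglongrightarrow> dist_of \<Lambda> F \<phi> - s 0"
      by (simp add: sums_def)
    then have "(\<lambda>n. s n - s 0) \<longlonglongrightarrow> dist_of \<Lambda> F \<phi> - s 0"
      by (simp add: sum_lessThan_telescope)
    then have lim1: "s \<longlonglongrightarrow> dist_of \<Lambda> F \<phi>"
      using tendsto_add[OF _ tendsto_const[of "s 0"]] by fastforce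
    have fts: "(\<lambda>\<gamma>. norm (ft \<phi> \<gamma>)) summable_on G"
      using ft_summable[OF t] G by (rule summable_on_subset_banach)
    \<comment> \<open>A single frequency outside \<open>A k\<close> is a tail block of its own,
      which bounds all remaining coefficients uniformly.\<close>
    have cs: "norm (c \<gamma>) \<le> (1/2) ^ k" if "\<gamma> \<in> G" "\<gamma> \<notin> A k" for \<gamma> k
    proof -
      have "(norm (c \<gamma>))\<^sup>2 \<le> (1/4) ^ k"
        using tail[of "{\<gamma>}" k] that by simp
      also have "(1/4::real) ^ k = ((1/2) ^ k)\<^sup>2"
        by (simp add: power2_eq_square power_mult_distrib[symmetric])
      finally show ?thesis by (rule power2_le_imp_le) simp
    qed
    have cfs: "(\<lambda>\<gamma>. norm (c \<gamma> * ft \<phi> \<gamma>)) summable_on (G - A k)" for k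
    proof (rule summable_on_comparison_test)
      show "(\<lambda>\<gamma>. norm (ft \<phi> \<gamma>)) summable_on (G - A k)"
        using fts by (rule summable_on_subset_banach) auto
      fix \<gamma> assume "\<gamma> \<in> G - A k"
      then have "norm (c \<gamma>) \<le> (1/2) ^ k" using cs by auto
      also have "\<dots> \<le> 1" by (simp add: power_le_one)
      finally show "norm (c \<gamma> * ft \<phi> \<gamma>) \<le> norm (ft \<phi> \<gamma>)"
        by (simp add: norm_mult mult_left_le_one_le)
    qed auto
    define L where "L = (\<Sum>\<^sub>\<infinity>\<gamma>\<in>G. c \<gamma> * ft \<phi> \<gamma>)"
    define N where "N = (\<Sum>\<^sub>\<infinity>\<gamma>\<in>G. norm (ft \<phi> \<gamma>))"
    \<comment> \<open>The uniform bound on the coefficients is factored out of the absolutely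
      convergent sum of the Fourier coefficients of \<open>\<phi>\<close>.\<close>
    have "norm (L - s k) \<le> (1/2) ^ k * N" for k
    proof -
      have "L = (\<Sum>\<^sub>\<infinity>\<gamma>\<in>A k \<union> (G - A k). c \<gamma> * ft \<phi> \<gamma>)"
        unfolding L_def using A(2)[of k] by (intro infsum_cong_neutral) auto
      also have "\<dots> = (\<Sum>\<^sub>\<infinity>\<gamma>\<in>A k. c \<gamma> * ft \<phi> \<gamma>) + (\<Sum>\<^sub>\<infinity>\<gamma>\<in>G - A k. c \<gamma> * ft \<phi> \<gamma>)"
        using A abs_summable_summable[OF cfs] by (intro infsum_Un_disjoint) auto
      finally have "L - s k = (\<Sum>\<^sub>\<infinity>\<gamma>\<in>G - A k. c \<gamma> * ft \<phi> \<gamma>)"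
        using A by (simp add: s_eq)
      also have "norm \<dots> \<le> (\<Sum>\<^sub>\<infinity>\<gamma>\<in>G - A k. norm (c \<gamma> * ft \<phi> \<gamma>))"
        by (rule norm_infsum_bound[OF cfs])
      also have "\<dots> \<le> (\<Sum>\<^sub>\<infinity>\<gamma>\<in>G. (1/2) ^ k * norm (ft \<phi> \<gamma>))"
        using cfs cs
        by (intro infsum_mono_neutral summable_on_cmult_right fts)
          (auto simp: norm_mult intro!: mult_right_mono)
      also have "\<dots> = (1/2) ^ k * N"
        unfolding N_def by (rule infsum_cmult_right) (use fts in simp)
      finally show ?thesis .
    qed
    then have "\<forall>\<^sub>F k in sequentially. norm (L - s k) \<le> (1/2) ^ k * N"
      by (intro always_eventually allI)
    moreover have "(\<lambda>k. (1/2) ^ k * N) \<longlonglongrightarrow> 0"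
      by (rule tendsto_mult_left_zero, rule LIMSEQ_power_zero) simp
    ultimately have "(\<lambda>k. L - s k) \<longlonglongrightarrow> 0"
      by (rule Lim_null_comparison)
    then have "(\<lambda>k. L - (L - s k)) \<longlonglongrightarrow> L - 0"
      by (intro tendsto_diff tendsto_const)
    then have "s \<longlonglongrightarrow> L" by simp
    with lim1 show ?thesis
      unfolding L_def by (rule LIMSEQ_unique)
  qed
  with loc show ?thesis by blast
qed

end

section \<open>Subsequences\<close>

lemma mset_nths_insert:
  "i < length X \<Longrightarrow> i \<notin> A \<Longrightarrow> mset (nths X (insert i A)) = add_mset (X ! i) (mset (nths X A))"
proof (induction X arbitrary: i A)
  case (Cons x X)
  show ?case
  proof (cases i)
    case 0
    then show ?thesis using Cons.prems by (simp add: nths_Cons)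
  next
    case (Suc j)
    then have "{k. Suc k \<in> insert i A} = insert j {k. Suc k \<in> A}" by auto
    then show ?thesis using Cons Suc by (simp add: nths_Cons)
  qed
qed simp

text \<open>An index beyond all present ones is appended to the list, the position in which
  \<open>pderivs\<close> and \<open>nablas\<close> gain an innermost operator.\<close>

lemma nths_insert_last:
  "i < length X \<Longrightarrow> (\<And>j. j \<in> A \<Longrightarrow> j < i) \<Longrightarrow> nths X (insert i A) = nths X A @ [X ! i]"
proof (induction X arbitrary: i A)
  case (Cons x X)
  show ?case
  proof (cases i)
    case 0
    then have "A = {}" using Cons.prems by auto
    then show ?thesis using 0 by (simp add: nths_Cons)
  next
    case (Suc j)
    then have eq: "{k. Suc k \<in> insert i A} = insert j {k. Suc k \<in> A}" by auto
    have "k \<in> {k. Suc k \<in> A} \<Longrightarrow> k < j" for k using Cons.prems(2)[of "Suc k"] Suc by auto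
    then have "nths X (insert j {k. Suc k \<in> A}) = nths X {k. Suc k \<in> A} @ [X ! j]"
      using Cons.prems(1) Suc by (intro Cons.IH) auto
    with eq show ?thesis
      using Suc by (simp add: nths_Cons del: insert_iff) (simp add: insert_iff)
  qed
qed simp

lemma nths_full: "{..<length X} \<subseteq> I \<Longrightarrow> nths X I = X"
  by (rule nths_all) auto

lemma set_nths_subset_idx: "I \<subseteq> {..<length X} \<Longrightarrow> set (nths X I) = (!) X ` I"
  by (auto simp: set_nths)

text \<open>Differences are built from translations, with which derivatives commute. The derivative
  taken in one step can thus move past the differences of the remaining steps and join
  \<open>pderivs\<close>.\<close>

lemma nablas_pderiv_dir: "smooth f \<Longrightarrow> nablas Y (pderiv_dir a f) = pderiv_dir a (nablas Y f)"
  by (induction Y) (simp_all add: nablas_def pderiv_dir_nabla smooth_nablas[unfolded nablas_def])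

lemma pderivs_snoc: "pderivs (Y @ [a]) f = pderivs Y (pderiv_dir a f)"
  by (simp add: pderivs_def)

lemma nablas_snoc: "nablas (Y @ [a]) f = nablas Y (nabla a f)"
  by (simp add: nablas_def)

section \<open>Admissible subspaces and the regrouping of infinite sums\<close>

lemma finite_adm_subspaces: "finite (adm_subspaces X)"
proof -
  have "adm_subspaces X = (\<lambda>I. span (set (nths X I))) ` Pow {..<length X}"
    by (auto simp: adm_subspaces_def)
  then show ?thesis by simp
qed

text \<open>An admissible subspace is recovered from the indices it contains; this makes the strata
  of the dual lattice disjoint.\<close>

lemma adm_subspace_span_idx_in:
  assumes "s \<in> adm_subspaces X"
  shows "s = span ((!) X ` idx_in X s)"
proof -
  obtain I where I: "I \<subseteq> {..<length X}" "s = span (set (nths X I))"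
    using assms by (auto simp: adm_subspaces_def)
  have "set (nths X I) \<subseteq> (!) X ` idx_in X s"
    using I by (auto simp: set_nths_subset_idx idx_in_def intro!: span_base)
  then have "s \<subseteq> span ((!) X ` idx_in X s)"
    unfolding I(2) by (rule span_mono)
  moreover have "span ((!) X ` idx_in X s) \<subseteq> s"
    by (rule span_minimal) (auto simp: idx_in_def I(2))
  ultimately show ?thesis by blast
qed

lemma infsum_UN_finite:
  fixes f :: "'a \<Rightarrow> 'b::{banach}"
  assumes "finite S" "\<And>s. s \<in> S \<Longrightarrow> f summable_on A s" "disjoint_family_on A S"
  shows "infsum f (\<Union>s\<in>S. A s) = (\<Sum>s\<in>S. infsum f (A s))" and "f summable_on (\<Union>s\<in>S. A s)"
proof -
  have "infsum f (\<Union>s\<in>S. A s) = (\<Sum>s\<in>S. infsum f (A s)) \<and> f summable_on (\<Union>s\<in>S. A s)"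
    using assms
  proof (induction S rule: finite_induct)
    case (insert s S)
    have IH: "infsum f (\<Union>s\<in>S. A s) = (\<Sum>s\<in>S. infsum f (A s))" "f summable_on (\<Union>s\<in>S. A s)"
      using insert.IH insert.prems disjoint_family_on_mono[of S "insert s S" A] by auto
    have d: "A s \<inter> (\<Union>s\<in>S. A s) = {}"
      using insert.prems(2) insert.hyps(2) by (auto simp: disjoint_family_on_def)
    show ?case
      using IH insert d by (simp add: infsum_Un_disjoint summable_on_Un_disjoint)
  qed simp
  then show "infsum f (\<Union>s\<in>S. A s) = (\<Sum>s\<in>S. infsum f (A s))" "f summable_on (\<Union>s\<in>S. A s)" by auto
qed

lemma infsum_finite_sum:
  fixes f :: "'i \<Rightarrow> 'a \<Rightarrow> 'b::banach"
  assumes "finite S" "\<And>s. s \<in> S \<Longrightarrow> f s summable_on A"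
  shows "infsum (\<lambda>x. \<Sum>s\<in>S. f s x) A = (\<Sum>s\<in>S. infsum (f s) A)"
proof -
  have "infsum (\<lambda>x. \<Sum>s\<in>S. f s x) A = (\<Sum>s\<in>S. infsum (f s) A) \<and> (\<lambda>x. \<Sum>s\<in>S. f s x) summable_on A"
    using assms by (induction S rule: finite_induct) (auto simp: infsum_add summable_on_add)
  then show ?thesis ..
qed

section \<open>The Bernoulli series\<close>

context euclidean_lattice
begin

lemma conv_c_eq: "conv_c \<Lambda> Y F \<phi> = (LINT v|dvol \<Lambda>. F v * spl Y \<phi> v)"
  by (simp add: conv_c_def box_spline_shift)

definition bcoef :: "'a list \<Rightarrow> 'a set \<Rightarrow> ('a \<Rightarrow>\<^sub>L real) \<Rightarrow> complex" where
  "bcoef X s \<gamma> = 1 / (\<Prod>i\<in>idx_out X s. 2 * \<i> * of_real pi * of_real (blinfun_apply \<gamma> (X ! i)))"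

lemma W_series_eq: "W_series \<Lambda> X s \<phi> = (\<Sum>\<^sub>\<infinity>\<gamma>\<in>Gamma_reg \<Lambda> X s. bcoef X s \<gamma> * ft \<phi> \<gamma>)"
proof -
  have "dist_of \<Lambda> (\<lambda>v. exp (2 * \<i> * of_real pi * of_real (blinfun_apply \<gamma> v)) /
      (\<Prod>i\<in>idx_out X s. 2 * \<i> * of_real pi * of_real (blinfun_apply \<gamma> (X ! i)))) \<phi> = bcoef X s \<gamma> * ft \<phi> \<gamma>" for \<gamma>
    by (simp add: dist_of_def bcoef_def ft_def echar_def)
  then show ?thesis unfolding W_series_def by simp
qed

lemma finite_idx_out: "finite (idx_out X s)"
  by (simp add: idx_out_def)

lemma Gamma_reg_subset: "Gamma_reg \<Lambda> X s \<subseteq> dual_lattice \<Lambda>"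
  by (auto simp: Gamma_reg_def)

lemma Gamma_reg_ge_1:
  assumes "set X \<subseteq> \<Lambda>" "\<gamma> \<in> Gamma_reg \<Lambda> X s" "i \<in> idx_out X s"
  shows "1 \<le> \<bar>blinfun_apply \<gamma> (X ! i)\<bar>"
proof -
  have "X ! i \<in> \<Lambda>" using assms(1,3) by (auto simp: idx_out_def)
  then have "blinfun_apply \<gamma> (X ! i) \<in> \<int>" "blinfun_apply \<gamma> (X ! i) \<noteq> 0"
    using assms(2,3) by (auto simp: Gamma_reg_def dual_lattice_def)
  then show ?thesis by (rule Ints_nonzero_abs_ge1)
qed

text \<open>Regular frequencies take integer values of modulus at least 1 on the vectors outside the
  subspace, where the linear factor dominates the square root. Squaring then gives the summand of
  \<open>summable_on_linear_forms\<close>.\<close>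

lemma norm_factor_ge:
  fixes x :: real
  assumes "1 \<le> \<bar>x\<bar>"
  shows "sqrt (1 + x\<^sup>2) \<le> norm (2 * \<i> * of_real pi * of_real x)"
proof (rule real_le_lsqrt)
  have "1 \<le> x\<^sup>2" using assms by (simp add: abs_le_square_iff[of 1 x, simplified])
  have "1 \<le> pi\<^sup>2" using pi_ge_two by (simp add: one_le_power)
  then have "4 * x\<^sup>2 * 1 \<le> 4 * x\<^sup>2 * pi\<^sup>2" by (intro mult_left_mono) auto
  moreover have "1 + x\<^sup>2 \<le> 4 * x\<^sup>2" using \<open>1 \<le> x\<^sup>2\<close> by linarith
  ultimately have "1 + x\<^sup>2 \<le> 4 * x\<^sup>2 * pi\<^sup>2" by linarith
  then show "1 + x\<^sup>2 \<le> (norm (2 * \<i> * of_real pi * of_real x))\<^sup>2"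
    by (simp add: norm_mult power_mult_distrib mult_ac)
qed simp

text \<open>Squares are what makes the product summable over the stratum; the first powers alone may
  diverge like harmonic sums.\<close>

lemma norm_bcoef_sq_le:
  assumes "set X \<subseteq> \<Lambda>" "\<gamma> \<in> Gamma_reg \<Lambda> X s"
  shows "(norm (bcoef X s \<gamma>))\<^sup>2 \<le> (\<Prod>i\<in>idx_out X s. 1 / (1 + (blinfun_apply \<gamma> (X ! i))\<^sup>2))"
proof -
  have "(norm (bcoef X s \<gamma>))\<^sup>2 =
      (\<Prod>i\<in>idx_out X s. (1 / norm (2 * \<i> * of_real pi * of_real (blinfun_apply \<gamma> (X ! i))))\<^sup>2)"
    unfolding bcoef_def norm_divide norm_one prod_norm[symmetric] prod_dividef
    by (simp only: prod_power_distrib[symmetric] prod_dividef prod.neutral_const)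
  also have "\<dots> \<le> (\<Prod>i\<in>idx_out X s. (1 / sqrt (1 + (blinfun_apply \<gamma> (X ! i))\<^sup>2))\<^sup>2)"
  proof (intro prod_mono conjI power_mono divide_left_mono mult_pos_pos)
    fix i assume "i \<in> idx_out X s"
    then have ge: "sqrt (1 + (blinfun_apply \<gamma> (X ! i))\<^sup>2) \<le> norm (2 * \<i> * of_real pi * of_real (blinfun_apply \<gamma> (X ! i)))"
      by (intro norm_factor_ge Gamma_reg_ge_1[OF assms])
    show "0 < sqrt (1 + (blinfun_apply \<gamma> (X ! i))\<^sup>2)" by (simp add: add_pos_nonneg)
    with ge show "0 < norm (2 * \<i> * of_real pi * of_real (blinfun_apply \<gamma> (X ! i)))" by (rule less_le_trans[rotated])
    show "sqrt (1 + (blinfun_apply \<gamma> (X ! i))\<^sup>2) \<le> norm (2 * \<i> * of_real pi * of_real (blinfun_apply \<gamma> (X ! i)))"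
      by (rule ge)
  qed auto
  also have "\<dots> = (\<Prod>i\<in>idx_out X s. 1 / (1 + (blinfun_apply \<gamma> (X ! i))\<^sup>2))"
    by (simp add: power_divide add_nonneg_nonneg)
  finally show ?thesis .
qed

lemma norm_bcoef_le_1:
  assumes "set X \<subseteq> \<Lambda>" "\<gamma> \<in> Gamma_reg \<Lambda> X s"
  shows "norm (bcoef X s \<gamma>) \<le> 1"
proof -
  have "(\<Prod>i\<in>idx_out X s. 1 / (1 + (blinfun_apply \<gamma> (X ! i))\<^sup>2)) \<le> (\<Prod>i\<in>idx_out X s. 1)"
    by (intro prod_mono) (auto simp: add_nonneg_nonneg divide_le_eq add_pos_nonneg)
  with norm_bcoef_sq_le[OF assms] have "(norm (bcoef X s \<gamma>))\<^sup>2 \<le> 1\<^sup>2" by simp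
  then show ?thesis by (rule power2_le_imp_le) simp
qed

text \<open>\<open>W\<close> is a choice, so its properties rest on the existence of a representing
  function, supplied by \<open>riesz_fischer\<close>. A regular frequency vanishes on
  \<open>s\<close>, so its values on the vectors outside \<open>s\<close> already fix it on a
  spanning set.\<close>

lemma W_represents:
  assumes X: "set X \<subseteq> \<Lambda>" "span (set X) = UNIV"
  shows "loc_L1 \<Lambda> (W \<Lambda> X s)"
    and "test_fun \<phi> \<Longrightarrow> dist_of \<Lambda> (W \<Lambda> X s) \<phi> = (\<Sum>\<^sub>\<infinity>\<gamma>\<in>Gamma_reg \<Lambda> X s. bcoef X s \<gamma> * ft \<phi> \<gamma>)"
proof -
  have "(\<lambda>\<gamma>. \<Prod>i\<in>idx_out X s. 1 / (1 + (blinfun_apply \<gamma> (X ! i))\<^sup>2)) summable_on Gamma_reg \<Lambda> X s"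
  proof (rule summable_on_linear_forms[OF finite_idx_out])
    fix \<gamma> i assume "\<gamma> \<in> Gamma_reg \<Lambda> X s" "i \<in> idx_out X s"
    moreover from this have "X ! i \<in> \<Lambda>" using X(1) by (auto simp: idx_out_def)
    ultimately show "blinfun_apply \<gamma> (X ! i) \<in> \<int>"
      by (simp add: Gamma_reg_def dual_lattice_def)
  next
    fix \<gamma> \<delta> assume g: "\<gamma> \<in> Gamma_reg \<Lambda> X s" "\<delta> \<in> Gamma_reg \<Lambda> X s"
      and eq: "\<And>i. i \<in> idx_out X s \<Longrightarrow> blinfun_apply \<gamma> (X ! i) = blinfun_apply \<delta> (X ! i)"
    have "blinfun_apply \<gamma> x = blinfun_apply \<delta> x" if "x \<in> set X" for x
    proof (cases "x \<in> s")
      case True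
      then show ?thesis using g by (auto simp: Gamma_reg_def)
    next
      case False
      with that obtain i where "i \<in> idx_out X s" "x = X ! i"
        by (auto simp: in_set_conv_nth idx_out_def)
      then show ?thesis using eq by simp
    qed
    then have "blinfun_apply \<gamma> v = blinfun_apply \<delta> v" for v
      using real_vector.linear_eq_on_span[of "blinfun_apply \<gamma>" "blinfun_apply \<delta>" "set X"] X(2)
        bounded_linear.linear[OF blinfun.bounded_linear_right] by auto
    then show "\<gamma> = \<delta>" by (rule blinfun_eqI)
  qed
  then have "(\<lambda>\<gamma>. (norm (bcoef X s \<gamma>))\<^sup>2) summable_on Gamma_reg \<Lambda> X s"
    by (rule summable_on_comparison_test) (use norm_bcoef_sq_le[OF X(1)] in auto)
  from riesz_fischer[OF Gamma_reg_subset this]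
  have "\<exists>F. loc_L1 \<Lambda> F \<and> (\<forall>\<phi>. test_fun \<phi> \<longrightarrow> dist_of \<Lambda> F \<phi> = W_series \<Lambda> X s \<phi>)"
    by (simp add: W_series_eq)
  from someI_ex[OF this]
  show "loc_L1 \<Lambda> (W \<Lambda> X s)"
    and "test_fun \<phi> \<Longrightarrow> dist_of \<Lambda> (W \<Lambda> X s) \<phi> = (\<Sum>\<^sub>\<infinity>\<gamma>\<in>Gamma_reg \<Lambda> X s. bcoef X s \<gamma> * ft \<phi> \<gamma>)"
    unfolding W_def by (auto simp: W_series_eq)
qed

section \<open>Summation by parts along the sequence\<close>

lemma ft_avg_step:
  assumes G: "smooth G" and \<Phi>: "test_fun \<Phi>" and \<gamma>: "\<gamma> \<in> dual_lattice \<Lambda>" and a: "a \<in> \<Lambda>"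
  shows "2 * \<i> * of_real pi * of_real (blinfun_apply \<gamma> a) * ft (\<lambda>v. G v * avg a \<Phi> v) \<gamma> =
    ft (\<lambda>v. nabla a G v * \<Phi> v) \<gamma> - ft (\<lambda>v. pderiv_dir a G v * avg a \<Phi> v) \<gamma>"
proof -
  let ?c = "2 * \<i> * of_real pi * complex_of_real (blinfun_apply \<gamma> a)"
  have s\<Phi>: "smooth \<Phi>" using \<Phi> by (simp add: test_fun_iff)
  have ta: "test_fun (avg a \<Phi>)" using test_fun_spl[OF \<Phi>, of "[a]"] by simp
  have int: "integrable (dvol \<Lambda>) (\<lambda>v. echar \<gamma> v * (H v * \<Psi> v))" if "smooth H" "test_fun \<Psi>" for H \<Psi>
    using that by (intro integrable_test test_fun_mult smooth_echar)
  have "(LINT v|dvol \<Lambda>. (echar \<gamma> v * G v) * pderiv_dir a (avg a \<Phi>) v) =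
      - (LINT v|dvol \<Lambda>. pderiv_dir a (\<lambda>v. echar \<gamma> v * G v) v * avg a \<Phi> v)"
    by (rule integral_by_parts[OF smooth_mult[OF smooth_echar G] ta])
  also have "(\<lambda>v. pderiv_dir a (\<lambda>v. echar \<gamma> v * G v) v * avg a \<Phi> v) =
      (\<lambda>v. echar \<gamma> v * (pderiv_dir a G v * avg a \<Phi> v) + ?c * (echar \<gamma> v * (G v * avg a \<Phi> v)))"
    by (simp add: pderiv_dir_mult smooth_echar G pderiv_dir_echar algebra_simps)
  also have "(LINT v|dvol \<Lambda>. \<dots> v) = ft (\<lambda>v. pderiv_dir a G v * avg a \<Phi> v) \<gamma> + ?c * ft (\<lambda>v. G v * avg a \<Phi> v) \<gamma>"
    unfolding ft_def
    by (subst Bochner_Integration.integral_add)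
      (auto intro!: int ta G smooth_pderiv_dir integrable_mult_right)
  finally have 1: "?c * ft (\<lambda>v. G v * avg a \<Phi> v) \<gamma> = - (LINT v|dvol \<Lambda>. (echar \<gamma> v * G v) * pderiv_dir a (avg a \<Phi>) v) -
      ft (\<lambda>v. pderiv_dir a G v * avg a \<Phi> v) \<gamma>"
    by simp
  have "(LINT v|dvol \<Lambda>. (echar \<gamma> v * G v) * pderiv_dir a (avg a \<Phi>) v) =
      (LINT v|dvol \<Lambda>. echar \<gamma> v * (G v * \<Phi> (v + a)) - echar \<gamma> v * (G v * \<Phi> v))"
    by (simp add: pderiv_dir_avg s\<Phi> avg_pderiv_dir algebra_simps)
  also have "\<dots> = (LINT v|dvol \<Lambda>. echar \<gamma> v * (G v * \<Phi> (v + a))) - ft (\<lambda>v. G v * \<Phi> v) \<gamma>"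
    unfolding ft_def by (intro Bochner_Integration.integral_diff int G \<Phi> test_fun_translate)
  \<comment> \<open>Translation by \<open>- a\<close> moves the shift from the test function to
    \<open>G\<close>; the character is unaffected because \<open>a\<close> is a lattice vector and
    \<open>\<gamma>\<close> lies in the dual lattice.\<close>
  also have "(LINT v|dvol \<Lambda>. echar \<gamma> v * (G v * \<Phi> (v + a))) =
      (LINT v|dvol \<Lambda>. echar \<gamma> (v + - a) * (G (v + - a) * \<Phi> (v + - a + a)))"
    by (rule integral_dvol_translate[symmetric])
      (intro continuous_borel continuous_on_mult continuous_on_echar smooth_continuous_on G smooth_translate s\<Phi>)
  also have "\<dots> = ft (\<lambda>v. G (v - a) * \<Phi> v) \<gamma>"
    using echar_periodic[OF \<gamma> lattice_minus[OF a]] by (simp add: ft_def)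
  finally have 2: "(LINT v|dvol \<Lambda>. (echar \<gamma> v * G v) * pderiv_dir a (avg a \<Phi>) v) =
      ft (\<lambda>v. G (v - a) * \<Phi> v) \<gamma> - ft (\<lambda>v. G v * \<Phi> v) \<gamma>" .
  have "smooth (\<lambda>v. G (v - a))" using smooth_translate[OF G, of "-a"] by simp
  then have "ft (\<lambda>v. G v * \<Phi> v) \<gamma> - ft (\<lambda>v. G (v - a) * \<Phi> v) \<gamma> =
      (LINT v|dvol \<Lambda>. echar \<gamma> v * (G v * \<Phi> v) - echar \<gamma> v * (G (v - a) * \<Phi> v))"
    unfolding ft_def by (intro Bochner_Integration.integral_diff[symmetric] int G \<Phi>)
  then have "ft (\<lambda>v. nabla a G v * \<Phi> v) \<gamma> = ft (\<lambda>v. G v * \<Phi> v) \<gamma> - ft (\<lambda>v. G (v - a) * \<Phi> v) \<gamma>"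
    by (simp add: ft_def nabla_def left_diff_distrib right_diff_distrib)
  with 1 2 show ?thesis by simp
qed

text \<open>The largest index is treated first: derivatives then accumulate in list order, and no symmetry of
  mixed partial derivatives is needed.\<close>

lemma ft_spl_expand:
  assumes "finite Q" "Q \<subseteq> {..<length X}" "K \<inter> Q = {}" "set X \<subseteq> \<Lambda>"
    and "smooth G" "test_fun \<phi>" and \<gamma>: "\<gamma> \<in> dual_lattice \<Lambda>"
  shows "(\<Prod>i\<in>Q. 2 * \<i> * of_real pi * of_real (blinfun_apply \<gamma> (X ! i))) * ft (\<lambda>v. G v * spl (nths X (K \<union> Q)) \<phi> v) \<gamma> =
    (\<Sum>I\<in>Pow Q. (-1) ^ card I * ft (\<lambda>v. pderivs (nths X I) (nablas (nths X (Q - I)) G) v * spl (nths X (K \<union> I)) \<phi> v) \<gamma>)"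
  using assms(1,2,3,5)
proof (induction Q arbitrary: K G rule: finite_linorder_max_induct)
  case empty
  then show ?case by (simp add: pderivs_def nablas_def)
next
  case (insert i Q)
  let ?c = "\<lambda>i. 2 * \<i> * of_real pi * complex_of_real (blinfun_apply \<gamma> (X ! i))"
  let ?T = "\<lambda>K I J G. ft (\<lambda>v. pderivs (nths X I) (nablas (nths X J) G) v * spl (nths X (K \<union> I)) \<phi> v) \<gamma>"
  let ?S = "\<lambda>K A G. ft (\<lambda>v. G v * spl (nths X (K \<union> A)) \<phi> v) \<gamma>"
  have i: "i < length X" "i \<notin> Q" "i \<notin> K" "X ! i \<in> \<Lambda>" using insert assms(4) by auto
  have cphi: "continuous_on UNIV \<phi>" using assms(6) by (simp add: test_fun_iff smooth_continuous_on)
  have spl: "spl (nths X (K \<union> insert i Q)) \<phi> = avg (X ! i) (spl (nths X (K \<union> Q)) \<phi>)"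
    using spl_mset[OF cphi, of "nths X (K \<union> insert i Q)" "X ! i # nths X (K \<union> Q)"]
      mset_nths_insert[of i X "K \<union> Q"] i by simp
  have "(\<Prod>i\<in>insert i Q. ?c i) * ?S K (insert i Q) G =
      (\<Prod>i\<in>Q. ?c i) * (?c i * ft (\<lambda>v. G v * avg (X ! i) (spl (nths X (K \<union> Q)) \<phi>) v) \<gamma>)"
    unfolding spl using insert.hyps i by (simp add: mult_ac)
  \<comment> \<open>A difference removes the \<open>i\<close>-th average, a derivative keeps it; in
    the second case \<open>i\<close> therefore joins \<open>K\<close>, the indices whose averages
    stay.\<close>
  also have "?c i * ft (\<lambda>v. G v * avg (X ! i) (spl (nths X (K \<union> Q)) \<phi>) v) \<gamma> =
      ?S K Q (nabla (X ! i) G) -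
      ?S (insert i K) Q (pderiv_dir (X ! i) G)"
    using ft_avg_step[OF insert.prems(3) test_fun_spl[OF assms(6)] \<gamma> i(4)] spl by simp
  also have "(\<Prod>i\<in>Q. ?c i) * \<dots> =
      (\<Prod>i\<in>Q. ?c i) * ?S K Q (nabla (X ! i) G) -
      (\<Prod>i\<in>Q. ?c i) * ?S (insert i K) Q (pderiv_dir (X ! i) G)"
    by (rule right_diff_distrib)
  also have "(\<Prod>i\<in>Q. ?c i) * ?S K Q (nabla (X ! i) G) =
      (\<Sum>I\<in>Pow Q. (-1) ^ card I * ?T K I (Q - I) (nabla (X ! i) G))"
    using insert.prems by (intro insert.IH smooth_nabla) auto
  also have "\<dots> = (\<Sum>I\<in>Pow Q. (-1) ^ card I * ?T K I (insert i Q - I) G)"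
  proof (intro sum.cong refl)
    fix I assume I: "I \<in> Pow Q"
    then have "insert i Q - I = insert i (Q - I)" using i by auto
    then have "nths X (insert i Q - I) = nths X (Q - I) @ [X ! i]"
      using i(1) insert.hyps(2) by (simp only:) (rule nths_insert_last, auto)
    then show "(-1) ^ card I * ?T K I (Q - I) (nabla (X ! i) G) =
        (-1) ^ card I * ?T K I (insert i Q - I) G"
      by (simp add: nablas_snoc)
  qed
  also have "(\<Prod>i\<in>Q. ?c i) * ?S (insert i K) Q (pderiv_dir (X ! i) G) =
      (\<Sum>I\<in>Pow Q. (-1) ^ card I * ?T (insert i K) I (Q - I) (pderiv_dir (X ! i) G))"
    using insert.prems i by (intro insert.IH smooth_pderiv_dir) auto
  \<comment> \<open>Choosing the derivative at \<open>i\<close> puts \<open>i\<close> into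
    \<open>I\<close>; the minus sign of the integration by parts becomes the change of parity of
    \<open>card I\<close>.\<close>
  also have "\<dots> = - (\<Sum>I\<in>insert i ` Pow Q. (-1) ^ card I * ?T K I (insert i Q - I) G)"
  proof -
    have "inj_on (insert i) (Pow Q)" using i by (auto intro!: inj_onI)
    then have "(\<Sum>I\<in>insert i ` Pow Q. (-1) ^ card I * ?T K I (insert i Q - I) G)
      = (\<Sum>I\<in>Pow Q. (-1) ^ card (insert i I) * ?T K (insert i I) (insert i Q - insert i I) G)"
      by (simp add: sum.reindex)
    also have "\<dots> = (\<Sum>I\<in>Pow Q. - ((-1) ^ card I * ?T (insert i K) I (Q - I) (pderiv_dir (X ! i) G)))"
    proof (intro sum.cong refl)
      fix I assume I: "I \<in> Pow Q"
      then have "insert i Q - insert i I = Q - I" "i \<notin> I" "finite I" using i insert.hyps(1) finite_subset by auto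
      moreover have "nths X (insert i I) = nths X I @ [X ! i]"
        using i(1) insert.hyps(2) I by (intro nths_insert_last) auto
      ultimately show "(-1) ^ card (insert i I) * ?T K (insert i I) (insert i Q - insert i I) G =
         - ((-1) ^ card I * ?T (insert i K) I (Q - I) (pderiv_dir (X ! i) G))"
        using insert.prems by (simp add: pderivs_snoc nablas_pderiv_dir)
    qed
    finally show ?thesis by (simp add: sum_negf)
  qed
  also have "(\<Sum>I\<in>Pow Q. (-1) ^ card I * ?T K I (insert i Q - I) G) -
      - (\<Sum>I\<in>insert i ` Pow Q. (-1) ^ card I * ?T K I (insert i Q - I) G) =
      (\<Sum>I\<in>Pow (insert i Q). (-1) ^ card I * ?T K I (insert i Q - I) G)"
    unfolding Pow_insert using i insert.hyps(1)
    by (subst sum.union_disjoint) auto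
  finally show ?case .
qed

text \<open>On a stratum the factors belonging to vectors outside \<open>s\<close> are all nonzero,
  so the expansion can be divided by their product.\<close>

lemma ft_Gamma_reg:
  assumes X: "set X \<subseteq> \<Lambda>" and f: "smooth f" and \<phi>: "test_fun \<phi>" and \<gamma>: "\<gamma> \<in> Gamma_reg \<Lambda> X s"
  shows "ft (\<lambda>v. f v * spl X \<phi> v) \<gamma> =
    (\<Sum>I\<in>Pow (idx_out X s). (-1) ^ card I *
      (bcoef X s \<gamma> * ft (\<lambda>v. pderivs (nths X I) (nablas (nths X (idx_out X s - I)) f) v * spl (nths X (idx_in X s \<union> I)) \<phi> v) \<gamma>))"
proof -
  have "idx_out X s \<subseteq> {..<length X}" "idx_in X s \<inter> idx_out X s = {}"
    by (auto simp: idx_in_def idx_out_def)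
  from ft_spl_expand[OF finite_idx_out this X f \<phi> subsetD[OF Gamma_reg_subset \<gamma>]]
  have *: "(\<Prod>i\<in>idx_out X s. 2 * \<i> * of_real pi * of_real (blinfun_apply \<gamma> (X ! i))) *
      ft (\<lambda>v. f v * spl (nths X (idx_in X s \<union> idx_out X s)) \<phi> v) \<gamma> =
    (\<Sum>I\<in>Pow (idx_out X s). (-1) ^ card I * ft (\<lambda>v. pderivs (nths X I) (nablas (nths X (idx_out X s - I)) f) v * spl (nths X (idx_in X s \<union> I)) \<phi> v) \<gamma>)" .
  have "nths X (idx_in X s \<union> idx_out X s) = X"
    by (rule nths_full) (auto simp: idx_in_def idx_out_def)
  moreover have "bcoef X s \<gamma> * (\<Prod>i\<in>idx_out X s. 2 * \<i> * of_real pi * of_real (blinfun_apply \<gamma> (X ! i))) = 1"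
    using \<gamma> finite_idx_out[of X s] by (auto simp: bcoef_def Gamma_reg_def)
  ultimately have "ft (\<lambda>v. f v * spl X \<phi> v) \<gamma> = bcoef X s \<gamma> * ((\<Prod>i\<in>idx_out X s. 2 * \<i> * of_real pi * of_real (blinfun_apply \<gamma> (X ! i))) *
      ft (\<lambda>v. f v * spl (nths X (idx_in X s \<union> idx_out X s)) \<phi> v) \<gamma>)"
    by (simp add: mult.assoc[symmetric])
  also have "\<dots> = (\<Sum>I\<in>Pow (idx_out X s). (-1) ^ card I *
      (bcoef X s \<gamma> * ft (\<lambda>v. pderivs (nths X I) (nablas (nths X (idx_out X s - I)) f) v * spl (nths X (idx_in X s \<union> I)) \<phi> v) \<gamma>))"
    unfolding * by (simp add: sum_distrib_left mult_ac)
  finally show ?thesis .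
qed

text \<open>Summing \<open>bcoef\<close> against the Fourier coefficients of a test function over a
  stratum gives its pairing with \<open>W\<close>. Coefficients of modulus at most 1 preserve
  absolute convergence, which permits the exchange with the finite sum over
  \<open>I\<close>.\<close>

lemma infsum_Gamma_reg:
  assumes X: "set X \<subseteq> \<Lambda>" "span (set X) = UNIV" and f: "smooth f" and \<phi>: "test_fun \<phi>"
  shows "(\<Sum>\<^sub>\<infinity>\<gamma>\<in>Gamma_reg \<Lambda> X s. ft (\<lambda>v. f v * spl X \<phi> v) \<gamma>) =
    (\<Sum>I\<in>Pow (idx_out X s). (-1) ^ card I *
       conv_c \<Lambda> (nths X (idx_in X s \<union> I))
         (\<lambda>v. W \<Lambda> X s v * pderivs (nths X I) (nablas (nths X (idx_out X s - I)) f) v) \<phi>)"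
proof -
  define \<psi> where "\<psi> I = (\<lambda>v. pderivs (nths X I) (nablas (nths X (idx_out X s - I)) f) v * spl (nths X (idx_in X s \<union> I)) \<phi> v)" for I
  have t: "test_fun (\<psi> I)" for I
    unfolding \<psi>_def by (intro test_fun_mult test_fun_spl smooth_pderivs smooth_nablas f \<phi>)
  have s: "(\<lambda>\<gamma>. bcoef X s \<gamma> * ft (\<psi> I) \<gamma>) summable_on Gamma_reg \<Lambda> X s" for I
  proof (rule abs_summable_summable, rule summable_on_comparison_test)
    show "(\<lambda>\<gamma>. norm (ft (\<psi> I) \<gamma>)) summable_on Gamma_reg \<Lambda> X s"
      by (rule summable_on_subset_banach[OF ft_summable[OF t] Gamma_reg_subset])
    fix \<gamma> assume "\<gamma> \<in> Gamma_reg \<Lambda> X s"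
    then show "norm (bcoef X s \<gamma> * ft (\<psi> I) \<gamma>) \<le> norm (ft (\<psi> I) \<gamma>)"
      using norm_bcoef_le_1[OF X(1)] by (simp add: norm_mult mult_left_le_one_le)
  qed auto
  have "(\<Sum>\<^sub>\<infinity>\<gamma>\<in>Gamma_reg \<Lambda> X s. ft (\<lambda>v. f v * spl X \<phi> v) \<gamma>) =
      (\<Sum>\<^sub>\<infinity>\<gamma>\<in>Gamma_reg \<Lambda> X s. \<Sum>I\<in>Pow (idx_out X s). (-1) ^ card I * (bcoef X s \<gamma> * ft (\<psi> I) \<gamma>))"
    unfolding \<psi>_def by (intro infsum_cong ft_Gamma_reg X f \<phi>)
  also have "\<dots> = (\<Sum>I\<in>Pow (idx_out X s). \<Sum>\<^sub>\<infinity>\<gamma>\<in>Gamma_reg \<Lambda> X s. (-1) ^ card I * (bcoef X s \<gamma> * ft (\<psi> I) \<gamma>))"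
    by (rule infsum_finite_sum) (auto intro!: summable_on_cmult_right s finite_idx_out)
  also have "\<dots> = (\<Sum>I\<in>Pow (idx_out X s). (-1) ^ card I * (\<Sum>\<^sub>\<infinity>\<gamma>\<in>Gamma_reg \<Lambda> X s. bcoef X s \<gamma> * ft (\<psi> I) \<gamma>))"
    by (intro sum.cong refl infsum_cmult_right s)
  also have "\<dots> = (\<Sum>I\<in>Pow (idx_out X s). (-1) ^ card I * dist_of \<Lambda> (W \<Lambda> X s) (\<psi> I))"
    by (simp add: W_represents(2)[OF X t])
  finally show ?thesis
    by (simp add: dist_of_def conv_c_eq \<psi>_def mult.assoc)
qed

lemma euler_maclaurin:
  assumes X: "set X \<subseteq> \<Lambda>" "span (set X) = UNIV" and f: "smooth f" and \<phi>: "test_fun \<phi>"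
  shows "conv_d \<Lambda> X f \<phi> - conv_c \<Lambda> X f \<phi> =
    (\<Sum>s\<in>adm_subspaces X - {UNIV}. \<Sum>I\<in>Pow (idx_out X s).
       (-1) ^ card I *
       conv_c \<Lambda> (nths X (idx_in X s \<union> I))
         (\<lambda>v. W \<Lambda> X s v * pderivs (nths X I) (nablas (nths X (idx_out X s - I)) f) v) \<phi>)"
proof -
  define \<psi> where "\<psi> = (\<lambda>v. f v * spl X \<phi> v)"
  have t: "test_fun \<psi>" unfolding \<psi>_def by (intro test_fun_mult test_fun_spl f \<phi>)
  have sumt: "ft \<psi> summable_on A" if "A \<subseteq> dual_lattice \<Lambda>" for A
    using abs_summable_summable[OF ft_summable[OF t]] that by (rule summable_on_subset_banach)
  have U: "UNIV \<in> adm_subspaces X"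
    using X(2) by (auto simp: adm_subspaces_def nths_full intro!: exI[of _ "{..<length X}"])
  have union: "dual_lattice \<Lambda> = (\<Union>s\<in>adm_subspaces X. Gamma_reg \<Lambda> X s)"
  proof (intro equalityI subsetI)
    fix \<gamma> assume g: "\<gamma> \<in> dual_lattice \<Lambda>"
    define I where "I = {i. i < length X \<and> blinfun_apply \<gamma> (X ! i) = 0}"
    define s where "s = span (set (nths X I))"
    have I: "I \<subseteq> {..<length X}" by (auto simp: I_def)
    have "s \<in> adm_subspaces X" using I by (auto simp: adm_subspaces_def s_def)
    moreover have "blinfun_apply \<gamma> v = 0" if "v \<in> s" for v
      using that unfolding s_def set_nths_subset_idx[OF I]
    proof (induction rule: span_induct_alt)
      case (step c x y)
      then show ?case by (auto simp: I_def blinfun.add_right blinfun.scaleR_right)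
    qed simp
    moreover have "blinfun_apply \<gamma> (X ! i) \<noteq> 0" if "i \<in> idx_out X s" for i
    proof
      assume "blinfun_apply \<gamma> (X ! i) = 0"
      then have "X ! i \<in> set (nths X I)"
        using that unfolding set_nths_subset_idx[OF I] by (auto simp: I_def idx_out_def)
      then show False using that by (auto simp: s_def idx_out_def span_base)
    qed
    ultimately show "\<gamma> \<in> (\<Union>s\<in>adm_subspaces X. Gamma_reg \<Lambda> X s)"
      using g by (auto simp: Gamma_reg_def)
  qed (use Gamma_reg_subset in blast)
  have disj: "disjoint_family_on (Gamma_reg \<Lambda> X) (adm_subspaces X)"
    unfolding disjoint_family_on_def
  proof (intro ballI impI equals0I)
    fix s r \<gamma> assume *: "s \<in> adm_subspaces X" "r \<in> adm_subspaces X" "s \<noteq> r"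
      "\<gamma> \<in> Gamma_reg \<Lambda> X s \<inter> Gamma_reg \<Lambda> X r"
    \<comment> \<open>Both index sets are the zero pattern of the common frequency, and this pattern
      determines an admissible subspace.\<close>
    have "idx_in X s = {i. i < length X \<and> blinfun_apply \<gamma> (X ! i) = 0}"
      "idx_in X r = {i. i < length X \<and> blinfun_apply \<gamma> (X ! i) = 0}"
      using *(4) by (auto simp: Gamma_reg_def idx_in_def idx_out_def)
    then have "s = r" using *(1,2) adm_subspace_span_idx_in by metis
    with *(3) show False by simp
  qed
  have "conv_d \<Lambda> X f \<phi> = (\<Sum>\<^sub>\<infinity>l\<in>\<Lambda>. \<psi> l)"
    by (simp add: conv_d_def \<psi>_def box_spline_shift)
  also have "\<dots> = (\<Sum>s\<in>adm_subspaces X. infsum (ft \<psi>) (Gamma_reg \<Lambda> X s))"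
    unfolding poisson[OF t] union
    by (rule infsum_UN_finite(1)[OF finite_adm_subspaces _ disj]) (rule sumt[OF Gamma_reg_subset])
  also have "\<dots> = infsum (ft \<psi>) (Gamma_reg \<Lambda> X UNIV) + (\<Sum>s\<in>adm_subspaces X - {UNIV}. infsum (ft \<psi>) (Gamma_reg \<Lambda> X s))"
    by (rule sum.remove[OF finite_adm_subspaces U])
  also have "Gamma_reg \<Lambda> X UNIV = {0}"
    by (auto simp: Gamma_reg_def idx_out_def dual_zero intro!: blinfun_eqI)
  also have "infsum (ft \<psi>) {0} = conv_c \<Lambda> X f \<phi>"
    by (simp add: ft_def conv_c_eq \<psi>_def)
  finally show ?thesis
    by (simp add: \<psi>_def infsum_Gamma_reg[OF X f \<phi>])
qed

end

section \<open>Box splines of bases\<close>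

text \<open>The new integral is innermost, so that an extra parameter of the integrand keeps its type in
  an induction on the list.\<close>

primrec nnl :: "'a::euclidean_space list \<Rightarrow> ('a \<Rightarrow> ennreal) \<Rightarrow> ennreal" where
  "nnl [] g = g 0"
| "nnl (b # Y) g = nnl Y (\<lambda>v. \<integral>\<^sup>+t. g (t *\<^sub>R b + v) \<partial>lborel)"

lemma nn_line_measurable:
  fixes h :: "'b::euclidean_space \<Rightarrow> 'a::euclidean_space \<Rightarrow> ennreal"
  assumes [measurable]: "(\<lambda>(x, v). h x v) \<in> borel_measurable (borel \<Otimes>\<^sub>M borel)"
  shows "(\<lambda>(x, v). \<integral>\<^sup>+t. h x (t *\<^sub>R b + v) \<partial>lborel) \<in> borel_measurable (borel \<Otimes>\<^sub>M borel)"
  by measurable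

lemma nn_line_measurable1:
  fixes g :: "'a::euclidean_space \<Rightarrow> ennreal"
  assumes [measurable]: "g \<in> borel_measurable borel"
  shows "(\<lambda>v. \<integral>\<^sup>+t. g (t *\<^sub>R b + v) \<partial>lborel) \<in> borel_measurable borel"
  by measurable

text \<open>The iterated line integrals only visit the span of \<open>Y\<close>, where the
  coordinates along missing basis vectors vanish; \<open>spl_nnl\<close> exploits this.\<close>

lemma nnl_cong:
  "(\<And>v. v \<in> span (set Y) \<Longrightarrow> f v = g v) \<Longrightarrow> nnl Y f = nnl Y g"
proof (induction Y arbitrary: f g)
  case Nil
  then show ?case by (simp add: span_zero)
next
  case (Cons b Y)
  have "f (t *\<^sub>R b + v) = g (t *\<^sub>R b + v)" if "v \<in> span (set Y)" for v t
    using that span_mono[of "set Y" "set (b # Y)"]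
    by (intro Cons.prems span_add) (auto intro: span_scale span_base)
  then show ?case
    by (simp add: Cons.IH[of "\<lambda>v. \<integral>\<^sup>+t. f (t *\<^sub>R b + v) \<partial>lborel" "\<lambda>v. \<integral>\<^sup>+t. g (t *\<^sub>R b + v) \<partial>lborel"])
qed

lemma nnl_cmult:
  "g \<in> borel_measurable borel \<Longrightarrow> nnl Y (\<lambda>v. c * g v) = c * nnl Y g"
proof (induction Y arbitrary: g)
  case (Cons b Y)
  note [measurable] = Cons.prems
  have "(\<integral>\<^sup>+t. c * g (t *\<^sub>R b + v) \<partial>lborel) = c * (\<integral>\<^sup>+t. g (t *\<^sub>R b + v) \<partial>lborel)" for v
    by (rule nn_integral_cmult) measurable
  then show ?case
    using Cons.IH[OF nn_line_measurable1[OF Cons.prems]] by simp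
qed simp

lemma nnl_swap:
  "(\<lambda>(x, v). h x v) \<in> borel_measurable (borel \<Otimes>\<^sub>M borel) \<Longrightarrow>
    nnl Y (\<lambda>v. \<integral>\<^sup>+x. h x v \<partial>lborel) = (\<integral>\<^sup>+x. nnl Y (h x) \<partial>lborel)"
  for h :: "'b::euclidean_space \<Rightarrow> 'a::euclidean_space \<Rightarrow> ennreal"
proof (induction Y arbitrary: h)
  case (Cons b Y)
  note [measurable] = Cons.prems
  have "(\<integral>\<^sup>+t. (\<integral>\<^sup>+x. h x (t *\<^sub>R b + v) \<partial>lborel) \<partial>lborel) = (\<integral>\<^sup>+x. (\<integral>\<^sup>+t. h x (t *\<^sub>R b + v) \<partial>lborel) \<partial>lborel)" for v
    by (rule lborel_pair.Fubini') measurable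
  then show ?case
    using Cons.IH[OF nn_line_measurable[OF Cons.prems, of b]] by simp
qed simp

lemma nn_integral_lborel_translate:
  fixes g :: "'a::euclidean_space \<Rightarrow> ennreal"
  assumes [measurable]: "g \<in> borel_measurable borel"
  shows "(\<integral>\<^sup>+x. g (w + x) \<partial>lborel) = (\<integral>\<^sup>+x. g x \<partial>lborel)"
proof -
  have "(\<integral>\<^sup>+x. g x \<partial>lborel) = (\<integral>\<^sup>+x. g x \<partial>distr lborel borel ((+) w))"
    by (simp add: lborel_distr_plus)
  also have "\<dots> = (\<integral>\<^sup>+x. g (w + x) \<partial>lborel)"
    by (rule nn_integral_distr) auto
  finally show ?thesis by simp
qed

text \<open>The shift is absorbed by the line integral in the same direction; full lines, unlike
  unit intervals, are invariant under it.\<close>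

lemma nnl_translate1:
  "g \<in> borel_measurable borel \<Longrightarrow> b \<in> set Y \<Longrightarrow> nnl Y (\<lambda>v. g (v + s *\<^sub>R b)) = nnl Y g"
proof (induction Y arbitrary: g)
  case (Cons a Y)
  note [measurable] = Cons.prems(1)
  show ?case
  proof (cases "b = a")
    case True
    have "(\<integral>\<^sup>+t. g (t *\<^sub>R b + v + s *\<^sub>R b) \<partial>lborel) = (\<integral>\<^sup>+t. g (t *\<^sub>R b + v) \<partial>lborel)" for v
    proof -
      have "(\<lambda>t. g (t *\<^sub>R b + v)) \<in> borel_measurable borel" by measurable
      from nn_integral_lborel_translate[OF this, of s]
      show ?thesis by (simp add: scaleR_add_left add_ac)
    qed
    then show ?thesis using True by simp
  next
    case False
    then show ?thesis
      using Cons.IH[OF nn_line_measurable1[OF Cons.prems(1), of a]] Cons.prems(2) by (simp add: add_ac)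
  qed
qed simp

lemma nnl_translate:
  assumes g: "g \<in> borel_measurable borel" and w: "w \<in> span (set Y)"
  shows "nnl Y (\<lambda>v. g (v + w)) = nnl Y g"
  using w
proof (induction rule: span_induct_alt)
  case (step c b w)
  have "(\<lambda>v. g (v + w)) \<in> borel_measurable borel"
    using g by measurable
  from nnl_translate1[OF this step(1), of c] step(2) show ?case
    by (simp add: add_ac)
qed simp

text \<open>The classical Fubini argument for the uniqueness of a translation invariant measure.\<close>

lemma nnl_unique:
  assumes f[measurable]: "f \<in> borel_measurable borel" and g[measurable]: "g \<in> borel_measurable borel"
    and Y: "span (set Y) = UNIV"
  shows "(\<integral>\<^sup>+x. f x \<partial>lborel) * nnl Y g = (\<integral>\<^sup>+x. g x \<partial>lborel) * nnl Y (\<lambda>v. f (- v))"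
proof -
  have [measurable]: "(\<lambda>v. f (- v)) \<in> borel_measurable borel" by measurable
  have "(\<integral>\<^sup>+x. f x \<partial>lborel) * nnl Y g = (\<integral>\<^sup>+x. f x * nnl Y g \<partial>lborel)"
    by (rule nn_integral_multc[symmetric]) measurable
  also have "\<dots> = (\<integral>\<^sup>+x. nnl Y (\<lambda>v. f x * g (v + x)) \<partial>lborel)"
  proof (rule nn_integral_cong)
    fix x
    have "(\<lambda>v. g (v + x)) \<in> borel_measurable borel" by measurable
    then have "nnl Y (\<lambda>v. f x * g (v + x)) = f x * nnl Y (\<lambda>v. g (v + x))" by (rule nnl_cmult)
    also have "nnl Y (\<lambda>v. g (v + x)) = nnl Y g" by (rule nnl_translate) (auto simp: Y)
    finally show "f x * nnl Y g = nnl Y (\<lambda>v. f x * g (v + x))" by simp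
  qed
  also have "\<dots> = nnl Y (\<lambda>v. \<integral>\<^sup>+x. f x * g (v + x) \<partial>lborel)"
    by (rule nnl_swap[symmetric]) measurable
  \<comment> \<open>The Lebesgue variable is shifted by \<open>v\<close>; afterwards the iterated
    integral in \<open>v\<close> is shifted by \<open>x\<close>, which leaves only the reflection of
    \<open>f\<close>.\<close>
  also have "\<dots> = nnl Y (\<lambda>v. \<integral>\<^sup>+x. f (x - v) * g x \<partial>lborel)"
  proof (rule arg_cong[where f = "nnl Y"], rule ext)
    fix v
    have "(\<lambda>x. f (x - v) * g x) \<in> borel_measurable borel" by measurable
    from nn_integral_lborel_translate[OF this, of v]
    show "(\<integral>\<^sup>+x. f x * g (v + x) \<partial>lborel) = (\<integral>\<^sup>+x. f (x - v) * g x \<partial>lborel)" by simp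
  qed
  also have "\<dots> = (\<integral>\<^sup>+x. nnl Y (\<lambda>v. f (x - v) * g x) \<partial>lborel)"
    by (rule nnl_swap) measurable
  also have "\<dots> = (\<integral>\<^sup>+x. g x * nnl Y (\<lambda>v. f (- v)) \<partial>lborel)"
  proof (rule nn_integral_cong)
    fix x
    have [measurable]: "(\<lambda>v. f (x - v)) \<in> borel_measurable borel" by measurable
    have "nnl Y (\<lambda>v. f (x - v) * g x) = g x * nnl Y (\<lambda>v. f (x - v))"
      by (simp add: mult.commute[of _ "g x"] nnl_cmult)
    also have "nnl Y (\<lambda>v. f (x - v)) = nnl Y (\<lambda>v. f (x - (v + x)))"
      by (rule nnl_translate[symmetric]) (auto simp: Y)
    also have "\<dots> = nnl Y (\<lambda>v. f (- v))" by simp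
    finally show "nnl Y (\<lambda>v. f (x - v) * g x) = g x * nnl Y (\<lambda>v. f (- v))" .
  qed
  also have "\<dots> = (\<integral>\<^sup>+x. g x \<partial>lborel) * nnl Y (\<lambda>v. f (- v))"
    by (rule nn_integral_multc) measurable
  finally show ?thesis .
qed

text \<open>Coordinates are taken in \<open>B\<close> but constrained only for \<open>A\<close>: the
  induction adds vectors to \<open>A\<close> while the coordinate system stays fixed.\<close>

definition para :: "'a::euclidean_space set \<Rightarrow> 'a set \<Rightarrow> 'a set" where
  "para B A = {v. \<forall>b\<in>A. 0 \<le> coord B b v \<and> coord B b v \<le> 1}"

lemma closed_para: "closed (para B A)"
proof -
  have "para B A = (\<Inter>b\<in>A. {v. 0 \<le> coord B b v} \<inter> {v. coord B b v \<le> 1})"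
    by (auto simp: para_def)
  also have "closed \<dots>"
    by (intro closed_INT ballI closed_Int closed_Collect_le continuous_intros)
  finally show ?thesis .
qed

lemma para_borel [measurable]: "para B A \<in> sets borel"
  by (rule borel_closed[OF closed_para])

text \<open>\<open>spl\<close> adds its new average outermost, \<open>nnl\<close> its new integral
  innermost; the two orders are reconciled here.\<close>

lemma spl_Cons_inner: "continuous_on UNIV F \<Longrightarrow> spl (b # Y) F = spl Y (avg b F)"
proof (induction Y)
  case (Cons c Y)
  have "avg b (avg c (spl Y F)) = avg c (avg b (spl Y F))"
    by (rule avg_swap) (rule continuous_on_spl[OF Cons.prems])
  with Cons show ?case by simp
qed simp

text \<open>Integrals over the unit interval become integrals over the line once the indicator of
  the parallelepiped is inserted. The real \<open>r\<close> mediates between a complex and an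
  extended nonnegative value.\<close>

lemma spl_nnl:
  fixes g :: "'a::euclidean_space \<Rightarrow> real"
  assumes B: "independent B" "span B = UNIV"
  shows "distinct Y \<Longrightarrow> set Y \<subseteq> B \<Longrightarrow> continuous_on UNIV g \<Longrightarrow> (\<And>v. 0 \<le> g v) \<Longrightarrow>
    \<exists>r\<ge>0. spl Y (\<lambda>v. of_real (g v)) 0 = of_real r \<and>
      ennreal r = nnl Y (\<lambda>v. indicator (para B (set Y)) v * ennreal (g v))"
proof (induction Y arbitrary: g)
  case Nil
  then show ?case by (auto simp: para_def intro!: exI[of _ "g 0"])
next
  case (Cons b Y)
  note [measurable] = borel_measurable_continuous_onI[OF Cons.prems(3)]
  define G where "G v = integral {0..1} (\<lambda>t. g (v + t *\<^sub>R b))" for v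
  have line: "continuous_on S (\<lambda>t. g (v + t *\<^sub>R b))" for S v
    by (rule continuous_on_line[OF Cons.prems(3)])
  have avg: "avg b (\<lambda>v. of_real (g v)) = (\<lambda>v. of_real (G v))"
  proof
    fix v
    have "(\<lambda>t. g (v + t *\<^sub>R b)) integrable_on {0..1}"
      by (rule integrable_continuous_interval[OF line])
    then have "((\<lambda>t. complex_of_real (g (v + t *\<^sub>R b))) has_integral of_real (G v)) {0..1}"
      unfolding G_def by (intro has_integral_of_real integrable_integral)
    then show "avg b (\<lambda>v. of_real (g v)) v = of_real (G v)"
      unfolding avg_def by (rule integral_unique)
  qed
  have cG: "continuous_on UNIV G"
  proof -
    have "continuous_on UNIV (\<lambda>v. Re (avg b (\<lambda>v. of_real (g v)) v))"
      by (intro continuous_intros continuous_on_avg Cons.prems)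
    then show ?thesis by (simp add: avg)
  qed
  have G0: "0 \<le> G v" for v
    unfolding G_def by (intro Henstock_Kurzweil_Integration.integral_nonneg integrable_continuous_interval line Cons.prems(4))
  obtain r where r: "0 \<le> r" "spl Y (\<lambda>v. of_real (G v)) 0 = of_real r"
    "ennreal r = nnl Y (\<lambda>v. indicator (para B (set Y)) v * ennreal (G v))"
    using Cons.IH[OF _ _ cG G0] Cons.prems(1,2) by auto
  have "spl (b # Y) (\<lambda>v. of_real (g v)) 0 = of_real r"
    using r(2) by (subst spl_Cons_inner) (auto simp: avg intro!: continuous_intros Cons.prems)
  moreover have "nnl (b # Y) (\<lambda>v. indicator (para B (set (b # Y))) v * ennreal (g v)) = ennreal r"
    unfolding r(3) nnl.simps
  proof (rule nnl_cong)
    fix v assume v: "v \<in> span (set Y)"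
    \<comment> \<open>Points of the span of \<open>Y\<close> have no component along the remaining
      basis vectors, so adding \<open>t *\<^sub>R b\<close> makes the \<open>b\<close>-coordinate
      equal to \<open>t\<close>.\<close>
    have xb: "coord B c v = 0" if "c \<in> B" "c \<notin> set Y" for c
      using v
    proof (induction rule: span_induct_alt)
      case (step r y w)
      then have "coord B c y = 0"
        using that Cons.prems(2) by (subst coord_basis[OF B]) auto
      with step show ?case by (simp add: blinfun.add_right blinfun.scaleR_right)
    qed simp
    have bB: "b \<in> B" "b \<notin> set Y" using Cons.prems by auto
    have ind: "indicator (para B (set (b # Y))) (t *\<^sub>R b + v) = (indicator {0..1} t * indicator (para B (set Y)) v :: ennreal)" for t
    proof -
      have "coord B b (t *\<^sub>R b + v) = t"
        using xb[OF bB] coord_basis[OF B bB(1), of b] by (simp add: blinfun.add_right blinfun.scaleR_right)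
      moreover have "coord B c (t *\<^sub>R b + v) = coord B c v" if "c \<in> set Y" for c
        using coord_basis[OF B bB(1), of c] bB that by (auto simp: blinfun.add_right blinfun.scaleR_right)
      ultimately have "t *\<^sub>R b + v \<in> para B (set (b # Y)) \<longleftrightarrow> t \<in> {0..1} \<and> v \<in> para B (set Y)"
        by (auto simp: para_def)
      then show ?thesis by (auto simp: indicator_def)
    qed
    have "(\<integral>\<^sup>+t. indicator (para B (set (b # Y))) (t *\<^sub>R b + v) * ennreal (g (t *\<^sub>R b + v)) \<partial>lborel) =
        (\<integral>\<^sup>+t. indicator (para B (set Y)) v * (ennreal (g (v + t *\<^sub>R b)) * indicator {0..1} t) \<partial>lborel)"
    proof (intro nn_integral_cong)
      fix t
      show "indicator (para B (set (b # Y))) (t *\<^sub>R b + v) * ennreal (g (t *\<^sub>R b + v)) =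
          indicator (para B (set Y)) v * (ennreal (g (v + t *\<^sub>R b)) * indicator {0..1} t)"
        unfolding ind by (simp add: mult_ac add.commute)
    qed
    also have "\<dots> = indicator (para B (set Y)) v * (\<integral>\<^sup>+t. ennreal (g (v + t *\<^sub>R b)) * indicator {0..1} t \<partial>lborel)"
      by (rule nn_integral_cmult) measurable
    also have "(\<integral>\<^sup>+t. ennreal (g (v + t *\<^sub>R b)) * indicator {0..1} t \<partial>lborel) = ennreal (G v)"
    proof -
      have "((\<lambda>t. g (v + t *\<^sub>R b)) has_integral G v) {0..1}"
        unfolding G_def by (intro integrable_integral integrable_continuous_interval line)
      then show ?thesis
        by (rule nn_integral_has_integral_lebesgue'[rotated]) (rule Cons.prems(4))
    qed
    finally show "(\<integral>\<^sup>+t. indicator (para B (set (b # Y))) (t *\<^sub>R b + v) * ennreal (g (t *\<^sub>R b + v)) \<partial>lborel) =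
        indicator (para B (set Y)) v * ennreal (G v)" .
  qed
  ultimately show ?case using r(1) by auto
qed

text \<open>Iterated line integration is translation invariant, hence proportional to Lebesgue
  measure; testing both on the parallelepiped gives the reciprocal of its volume as the
  constant.\<close>

lemma spl_basis_nonneg:
  fixes Y :: "'a::euclidean_space list"
  assumes Y: "distinct Y" "independent (set Y)" "span (set Y) = UNIV"
  shows "\<exists>c>0. \<forall>g. continuous_on UNIV g \<longrightarrow> (\<forall>v. 0 \<le> g v) \<longrightarrow>
    spl Y (\<lambda>v. of_real (g v)) 0 = complex_of_real (c * (LINT v|lborel. indicat_real (para (set Y) (set Y)) v * g v))"
proof -
  let ?P = "para (set Y) (set Y)"
  have bP: "bounded ?P"
    by (rule coord_bounded[OF Y(2,3), of _ 1]) (auto simp: para_def)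
  \<comment> \<open>The corner opposite to 0: the reflected parallelepiped is the translate by
    \<open>- \<sigma>\<close>, which disposes of the reflection in
    \<open>nnl_unique\<close>.\<close>
  define \<sigma> where "\<sigma> = (\<Sum>b\<in>set Y. 1 *\<^sub>R b)"
  have \<sigma>: "coord (set Y) b \<sigma> = 1" if "b \<in> set Y" for b
    unfolding \<sigma>_def by (rule coord_comb[OF Y(2,3) that])
  have 1: "nnl Y (indicator ?P) = 1"
  proof -
    obtain r where r: "0 \<le> r" "spl Y (\<lambda>v. of_real 1) 0 = complex_of_real r" "ennreal r = nnl Y (\<lambda>v. indicator ?P v * ennreal 1)"
      using spl_nnl[OF Y(2,3,1), of "\<lambda>_. 1"] by auto
    have "spl Z (\<lambda>v. c) = (\<lambda>v. c)" for Z :: "'a list" and c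
      by (induction Z) (auto simp: avg_def)
    from fun_cong[OF this[of Y 1], of 0] r(2) have "complex_of_real r = 1" by simp
    then have "r = 1" by (simp only: of_real_eq_1_iff)
    with r(3) show ?thesis by simp
  qed
  have P_neg: "indicator ?P (- v) = (indicator ?P (v + \<sigma>) :: ennreal)" for v
  proof -
    have "- v \<in> ?P \<longleftrightarrow> v + \<sigma> \<in> ?P"
      using \<sigma> by (auto simp: para_def blinfun.minus_right blinfun.add_right)
    then show ?thesis by (simp add: indicator_def)
  qed
  have nu: "emeasure lborel ?P * nnl Y g = (\<integral>\<^sup>+x. g x \<partial>lborel)" if [measurable]: "g \<in> borel_measurable borel" for g
  proof -
    have "nnl Y (\<lambda>v. indicator ?P (- v)) = nnl Y (\<lambda>v. indicator ?P (v + \<sigma>))"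
      by (simp add: P_neg)
    also have "\<dots> = nnl Y (indicator ?P)"
      by (rule nnl_translate) (auto simp: Y)
    finally have "nnl Y (\<lambda>v. indicator ?P (- v)) = 1" using 1 by simp
    moreover have "(\<integral>\<^sup>+x. indicator ?P x * 1 \<partial>lborel) = emeasure lborel ?P" by simp
    ultimately show ?thesis
      using nnl_unique[of "indicator ?P" g Y] Y(3) by simp
  qed
  define m where "m = measure lborel ?P"
  have fin: "emeasure lborel ?P = ennreal m"
    using emeasure_bounded_finite[OF bP] by (simp add: m_def emeasure_eq_ennreal_measure)
  \<comment> \<open>Were the volume 0, the proportionality would give the indicator of a ball
    integral 0.\<close>
  have "emeasure lborel ?P \<noteq> 0"
  proof
    assume "emeasure lborel ?P = 0"
    moreover have "(indicator (ball 0 1) :: 'a \<Rightarrow> ennreal) \<in> borel_measurable borel"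
      by (rule borel_measurable_indicator) simp
    ultimately have "emeasure lborel (ball (0::'a) 1) = 0"
      using nu[of "indicator (ball 0 1)"] by simp
    then have "negligible (ball (0::'a) 1)" by (simp add: negligible_iff_emeasure0)
    then show False using open_not_negligible[of "ball (0::'a) 1"] by simp
  qed
  then have m: "0 < m" using fin by (metis ennreal_0 m_def measure_nonneg order_le_less)
  show ?thesis
  proof (intro exI[of _ "1/m"] conjI allI impI)
    show "0 < 1/m" using m by simp
    fix g :: "'a \<Rightarrow> real" assume g: "continuous_on UNIV g" "\<forall>v. 0 \<le> g v"
    note [measurable] = borel_measurable_continuous_onI[OF g(1)]
    obtain r where r: "0 \<le> r" "spl Y (\<lambda>v. of_real (g v)) 0 = complex_of_real r"
      "ennreal r = nnl Y (\<lambda>v. indicator ?P v * ennreal (g v))"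
      using spl_nnl[OF Y(2,3,1) order_refl g(1)] g(2) by auto
    define I where "I = (LINT v|lborel. indicat_real ?P v * g v)"
    have "compact ?P" using bP closed_para by (simp add: compact_eq_bounded_closed)
    then have "integrable lborel (\<lambda>v. indicat_real ?P v * g v)"
      using borel_integrable_compact[of ?P g] continuous_on_subset[OF g(1)] by simp
    then have "(\<integral>\<^sup>+v. ennreal (indicat_real ?P v * g v) \<partial>lborel) = ennreal I"
      unfolding I_def using g(2) by (intro nn_integral_eq_integral) auto
    also have "(\<lambda>v. ennreal (indicat_real ?P v * g v)) = (\<lambda>v. indicator ?P v * ennreal (g v))"
      by (auto simp: indicator_def)
    finally have "ennreal m * ennreal r = ennreal I"
      using nu[of "\<lambda>v. indicator ?P v * ennreal (g v)"] by (simp add: r(3) fin)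
    moreover have "0 \<le> I" unfolding I_def using g(2) by (intro Bochner_Integration.integral_nonneg) auto
    ultimately have "m * r = I" using m r(1) by (simp add: ennreal_mult[symmetric])
    then have "r = 1/m * I" using m by (simp add: field_simps)
    with r(2) show "spl Y (\<lambda>v. of_real (g v)) 0 = complex_of_real (1/m * I)" by simp
  qed
qed

text \<open>Extension by linearity from nonnegative to complex functions: the defect
  \<open>D\<close> is additive, homogeneous and zero on nonnegative continuous functions.\<close>

lemma spl_basis:
  fixes Y :: "'a::euclidean_space list"
  assumes Y: "distinct Y" "independent (set Y)" "span (set Y) = UNIV"
  shows "\<exists>c. \<forall>\<phi>. continuous_on UNIV \<phi> \<longrightarrow>
    spl Y \<phi> 0 = complex_of_real c * (LINT v|lborel. indicat_real (para (set Y) (set Y)) v *\<^sub>R \<phi> v)"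
proof -
  let ?P = "para (set Y) (set Y)"
  obtain c where c: "\<And>g. continuous_on UNIV g \<Longrightarrow> (\<And>v. 0 \<le> g v) \<Longrightarrow>
    spl Y (\<lambda>v. of_real (g v)) 0 = complex_of_real (c * (LINT v|lborel. indicat_real ?P v * g v))"
    using spl_basis_nonneg[OF Y] by blast
  have "compact ?P"
    using coord_bounded[OF Y(2,3), of ?P 1] closed_para
    by (auto simp: compact_eq_bounded_closed para_def)
  have int: "integrable lborel (\<lambda>v. indicat_real ?P v *\<^sub>R F v)" if "continuous_on UNIV F" for F :: "'a \<Rightarrow> complex"
    by (rule borel_integrable_compact[OF \<open>compact ?P\<close> continuous_on_subset[OF that]]) simp
  define D where "D F = spl Y F 0 - complex_of_real c * (LINT v|lborel. indicat_real ?P v *\<^sub>R F v)" for F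
  have D0: "D (\<lambda>v. of_real (g v)) = 0" if g: "continuous_on UNIV g" "\<And>v. 0 \<le> g v" for g
  proof -
    have "(\<lambda>v. indicat_real ?P v *\<^sub>R complex_of_real (g v)) = (\<lambda>v. complex_of_real (indicat_real ?P v * g v))"
      by (auto simp: scaleR_conv_of_real)
    then have "(LINT v|lborel. indicat_real ?P v *\<^sub>R complex_of_real (g v)) = complex_of_real (LINT v|lborel. indicat_real ?P v * g v)"
      by (simp only: integral_complex_of_real)
    then show ?thesis by (simp add: D_def c[OF g])
  qed
  have Dadd: "D (\<lambda>v. F v + G v) = D F + D G" if F: "continuous_on UNIV F" "continuous_on UNIV G" for F G
    unfolding D_def spl_add[OF F] scaleR_add_right Bochner_Integration.integral_add[OF int[OF F(1)] int[OF F(2)]]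
    by (simp add: algebra_simps)
  have Dmult: "D (\<lambda>v. k * F v) = k * D F" for F k
  proof -
    have "(\<lambda>v. indicat_real ?P v *\<^sub>R (k * F v)) = (\<lambda>v. k * (indicat_real ?P v *\<^sub>R F v))"
      by (simp add: scaleR_conv_of_real mult_ac)
    then show ?thesis
      unfolding D_def spl_cmult by (simp only: integral_mult_right_zero right_diff_distrib mult.left_commute)
  qed
  have Dreal: "D (\<lambda>v. of_real (g v)) = 0" if g: "continuous_on UNIV g" for g
  proof -
    \<comment> \<open>A difference of two nonnegative functions that are again continuous.\<close>
    have "(\<lambda>v. complex_of_real (g v)) = (\<lambda>v. of_real (\<bar>g v\<bar> + g v) + (-1) * of_real \<bar>g v\<bar>)"
      by (rule ext) (simp only: of_real_add, simp)
    then have "D (\<lambda>v. of_real (g v)) = D (\<lambda>v. of_real (\<bar>g v\<bar> + g v) + (-1) * of_real \<bar>g v\<bar>)"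
      by (rule arg_cong)
    also have "\<dots> = D (\<lambda>v. of_real (\<bar>g v\<bar> + g v)) + D (\<lambda>v. (-1) * of_real \<bar>g v\<bar>)"
      by (rule Dadd) (intro continuous_intros g)+
    also have "\<dots> = 0"
    proof -
      have "D (\<lambda>v. of_real (\<bar>g v\<bar> + g v)) = 0" by (rule D0) (auto intro!: continuous_intros g)
      moreover have "D (\<lambda>v. of_real \<bar>g v\<bar>) = 0" by (rule D0) (auto intro!: continuous_intros g)
      ultimately show ?thesis unfolding Dmult by simp
    qed
    finally show ?thesis .
  qed
  have "D \<phi> = 0" if \<phi>: "continuous_on UNIV \<phi>" for \<phi>
  proof -
    have "\<phi> = (\<lambda>v. of_real (Re (\<phi> v)) + \<i> * of_real (Im (\<phi> v)))"
      by (simp only: complex_eq[symmetric])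
    then have "D \<phi> = D (\<lambda>v. of_real (Re (\<phi> v)) + \<i> * of_real (Im (\<phi> v)))" by (rule arg_cong)
    also have "\<dots> = D (\<lambda>v. of_real (Re (\<phi> v))) + D (\<lambda>v. \<i> * of_real (Im (\<phi> v)))"
      by (rule Dadd) (intro continuous_intros \<phi>)+
    also have "\<dots> = 0"
    proof -
      have "D (\<lambda>v. of_real (Re (\<phi> v))) = 0" by (rule Dreal) (intro continuous_intros \<phi>)
      moreover have "D (\<lambda>v. of_real (Im (\<phi> v))) = 0" by (rule Dreal) (intro continuous_intros \<phi>)
      ultimately show ?thesis unfolding Dmult by simp
    qed
    finally show ?thesis .
  qed
  then show ?thesis by (auto simp: D_def)
qed

section \<open>The recurrence for box splines\<close>

text \<open>Deletion by position, since Euler's identity sums over positions; \<open>remove1\<close>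
  deletes by value.\<close>

definition del :: "nat \<Rightarrow> 'a list \<Rightarrow> 'a list" where
  "del i Y = take i Y @ drop (Suc i) Y"

lemma del_Cons_0 [simp]: "del 0 (a # Y) = Y"
  and del_Cons_Suc [simp]: "del (Suc i) (a # Y) = a # del i Y"
  by (simp_all add: del_def)

lemma mset_del: "i < length Y \<Longrightarrow> mset Y = add_mset (Y ! i) (mset (del i Y))"
  by (simp add: del_def id_take_nth_drop[of i Y, THEN arg_cong[where f = mset]])

lemma length_del: "i < length Y \<Longrightarrow> length (del i Y) = length Y - 1"
  by (simp add: del_def)

lemma set_del_subset: "set (del i Y) \<subseteq> set Y"
  by (auto simp: del_def dest: in_set_takeD in_set_dropD)

lemma nth_mem_del:
  assumes "j < length Y" "j \<noteq> i"
  shows "Y ! j \<in> set (del i Y)"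
proof (cases "j < i")
  case True
  then have "Y ! j = take i Y ! j" "j < length (take i Y)" using assms by auto
  then have "Y ! j \<in> set (take i Y)" by (metis nth_mem)
  then show ?thesis by (simp add: del_def)
next
  case False
  then have "Y ! j = drop (Suc i) Y ! (j - Suc i)" "j - Suc i < length (drop (Suc i) Y)" using assms by auto
  then have "Y ! j \<in> set (drop (Suc i) Y)" by (metis nth_mem)
  then show ?thesis by (simp add: del_def)
qed

lemma pderiv_dir_add_dir: "smooth F \<Longrightarrow> pderiv_dir (a + b) F v = pderiv_dir a F v + pderiv_dir b F v"
  using linear_add[OF linear_pderiv_dir] .

lemma pderiv_dir_scale_dir: "smooth F \<Longrightarrow> pderiv_dir (s *\<^sub>R a) F v = of_real s * pderiv_dir a F v"
  using linear_cmul[OF linear_pderiv_dir, of F s a v] by (simp add: scaleR_conv_of_real)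

lemma pderiv_dir_Basis:
  assumes "smooth F"
  shows "pderiv_dir a F v = (\<Sum>b\<in>Basis. of_real (a \<bullet> b) * pderiv_dir b F v)"
proof -
  have "pderiv_dir a F v = pderiv_dir (\<Sum>b\<in>Basis. (a \<bullet> b) *\<^sub>R b) F v"
    by (simp add: euclidean_representation)
  also have "\<dots> = (\<Sum>b\<in>Basis. of_real (a \<bullet> b) * pderiv_dir b F v)"
    using assms by (simp add: linear_sum[OF linear_pderiv_dir] pderiv_dir_scale_dir)
  finally show ?thesis .
qed

text \<open>The direction of differentiation varies with the point; the expansion in
  \<open>Basis\<close> separates the two dependences.\<close>

lemma continuous_euler:
  assumes "smooth F"
  shows "continuous_on UNIV (\<lambda>w. pderiv_dir w F (p + w))"
proof -
  have "continuous_on UNIV (\<lambda>w. \<Sum>b\<in>Basis. of_real (w \<bullet> b) * pderiv_dir b F (p + w))"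
    by (intro continuous_intros continuous_on_compose2[OF smooth_continuous_on[OF smooth_pderiv_dir[OF assms]]]) auto
  also have "(\<lambda>w. \<Sum>b\<in>Basis. of_real (w \<bullet> b) * pderiv_dir b F (p + w)) = (\<lambda>w. pderiv_dir w F (p + w))"
    by (rule ext) (rule pderiv_dir_Basis[OF assms, symmetric])
  finally show ?thesis .
qed

text \<open>Euler's identity: the operator on the left is the derivative of the dilations.\<close>

lemma spl_euler:
  assumes F: "smooth F"
  shows "spl Y (\<lambda>w. pderiv_dir w F (p + w)) 0 = (\<Sum>i<length Y. spl (del i Y) F (p + Y ! i)) - of_nat (length Y) * spl Y F p"
proof (induction Y arbitrary: p)
  case Nil
  show ?case using linear_0[OF linear_pderiv_dir[OF F]] by simp
next
  case (Cons a Y)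
  define \<Phi> where "\<Phi> = spl Y F"
  have s\<Phi>: "smooth \<Phi>" unfolding \<Phi>_def by (rule smooth_spl[OF F])
  have cont: "continuous_on S (\<lambda>t. G (v + t *\<^sub>R a))" if "smooth G" for G v and S :: "real set"
    by (rule continuous_on_line[OF smooth_continuous_on[OF that]])
  \<comment> \<open>The base point is moved to \<open>t *\<^sub>R a\<close>; linearity in the
    direction separates the Euler term of \<open>Y\<close> from a derivative along
    \<open>a\<close>.\<close>
  have split: "spl Y (\<lambda>w. pderiv_dir w F (p + w)) (t *\<^sub>R a) =
      ((\<Sum>i<length Y. spl (del i Y) F (p + Y ! i + t *\<^sub>R a)) - of_nat (length Y) * \<Phi> (p + t *\<^sub>R a)) +
      of_real t * pderiv_dir a \<Phi> (p + t *\<^sub>R a)" for t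
  proof -
    have "spl Y (\<lambda>w. pderiv_dir w F (p + w)) (t *\<^sub>R a) = spl Y (\<lambda>w. pderiv_dir (w + t *\<^sub>R a) F (p + (w + t *\<^sub>R a))) 0"
      using spl_translate[of Y "\<lambda>w. pderiv_dir w F (p + w)" "t *\<^sub>R a"] by simp
    also have "(\<lambda>w. pderiv_dir (w + t *\<^sub>R a) F (p + (w + t *\<^sub>R a))) =
        (\<lambda>w. pderiv_dir w F (p + t *\<^sub>R a + w) + of_real t * pderiv_dir a F (w + (p + t *\<^sub>R a)))"
      by (simp add: pderiv_dir_add_dir pderiv_dir_scale_dir F add_ac)
    also have "spl Y \<dots> 0 = spl Y (\<lambda>w. pderiv_dir w F (p + t *\<^sub>R a + w)) 0 + spl Y (\<lambda>w. of_real t * pderiv_dir a F (w + (p + t *\<^sub>R a))) 0"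
    proof -
      have "continuous_on UNIV (\<lambda>w. of_real t * pderiv_dir a F (w + (p + t *\<^sub>R a)))"
        by (intro smooth_continuous_on smooth_cmult smooth_translate smooth_pderiv_dir F)
      from fun_cong[OF spl_add[OF continuous_euler[OF F, of "p + t *\<^sub>R a"] this, of Y], of 0] show ?thesis .
    qed
    also have "spl Y (\<lambda>w. pderiv_dir w F (p + t *\<^sub>R a + w)) 0 =
        (\<Sum>i<length Y. spl (del i Y) F (p + Y ! i + t *\<^sub>R a)) - of_nat (length Y) * \<Phi> (p + t *\<^sub>R a)"
      unfolding Cons.IH \<Phi>_def by (simp add: add_ac)
    also have "spl Y (\<lambda>w. of_real t * pderiv_dir a F (w + (p + t *\<^sub>R a))) 0 = of_real t * pderiv_dir a \<Phi> (p + t *\<^sub>R a)"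
      unfolding spl_cmult spl_translate \<Phi>_def pderiv_dir_spl[OF F] by simp
    finally show ?thesis .
  qed
  have I1: "((\<lambda>t. spl (del i Y) F (p + Y ! i + t *\<^sub>R a)) has_integral spl (a # del i Y) F (p + Y ! i)) {0..1}" for i
    unfolding spl_simps avg_def
    by (intro integrable_integral integrable_continuous_interval cont smooth_spl F)
  have I2: "((\<lambda>t. \<Phi> (p + t *\<^sub>R a)) has_integral spl (a # Y) F p) {0..1}"
    unfolding spl_simps avg_def \<Phi>_def[symmetric]
    by (intro integrable_integral integrable_continuous_interval cont s\<Phi>)
  \<comment> \<open>Integration by parts in \<open>t\<close>, through the derivative of
    \<open>t * \<Phi> (p + t *\<^sub>R a)\<close>. It yields the new deletion term and raises the
    length factor by one.\<close>
  have I3: "((\<lambda>t. of_real t * pderiv_dir a \<Phi> (p + t *\<^sub>R a)) has_integral (\<Phi> (p + a) - spl (a # Y) F p)) {0..1}"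
  proof -
    have "((\<lambda>t. of_real t * pderiv_dir a \<Phi> (p + t *\<^sub>R a) + \<Phi> (p + t *\<^sub>R a)) has_integral
        (of_real 1 * \<Phi> (p + 1 *\<^sub>R a) - of_real 0 * \<Phi> (p + 0 *\<^sub>R a))) {0..1}"
    proof (rule fundamental_theorem_of_calculus)
      fix t :: real
      have "((\<lambda>t. complex_of_real t) has_vector_derivative 1) (at t within {0..1})"
        using has_vector_derivative_of_real[OF DERIV_ident] by (simp add: has_vector_derivative_at_within)
      from has_vector_derivative_mult[OF this smooth_has_vector_derivative_line[OF s\<Phi>]]
      show "((\<lambda>t. of_real t * \<Phi> (p + t *\<^sub>R a)) has_vector_derivative
          of_real t * pderiv_dir a \<Phi> (p + t *\<^sub>R a) + \<Phi> (p + t *\<^sub>R a)) (at t within {0..1})"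
        by (simp add: add.commute)
    qed simp
    from has_integral_diff[OF this I2] show ?thesis by simp
  qed
  have "((\<lambda>t. spl Y (\<lambda>w. pderiv_dir w F (p + w)) (0 + t *\<^sub>R a)) has_integral
      ((\<Sum>i<length Y. spl (a # del i Y) F (p + Y ! i)) - of_nat (length Y) * spl (a # Y) F p) +
       (\<Phi> (p + a) - spl (a # Y) F p)) {0..1}"
    unfolding add_0_left split
    by (intro has_integral_add has_integral_diff has_integral_sum has_integral_mult_right I1 I2 I3) simp
  then have "spl (a # Y) (\<lambda>w. pderiv_dir w F (p + w)) 0 =
      ((\<Sum>i<length Y. spl (a # del i Y) F (p + Y ! i)) - of_nat (length Y) * spl (a # Y) F p) + (\<Phi> (p + a) - spl (a # Y) F p)"
    by (subst spl_simps) (simp only: avg_def integral_unique)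
  also have "\<dots> = (\<Sum>i<length (a # Y). spl (del i (a # Y)) F (p + (a # Y) ! i)) - of_nat (length (a # Y)) * spl (a # Y) F p"
    by (simp add: sum.lessThan_Suc_shift \<Phi>_def algebra_simps del: sum.lessThan_Suc)
  finally show ?case .
qed

definition cx :: "('a::euclidean_space \<Rightarrow>\<^sub>L real) \<Rightarrow> 'a \<Rightarrow> complex" where
  "cx \<gamma> v = of_real (blinfun_apply \<gamma> v)"

lemma bounded_linear_cx: "bounded_linear (cx \<gamma>)"
  unfolding cx_def[abs_def]
  by (rule bounded_linear_compose[OF bounded_linear_of_real blinfun.bounded_linear_right])

lemma smooth_cx: "smooth (cx \<gamma>)"
  by (rule smooth_bounded_linear[OF bounded_linear_cx])

text \<open>Along directions in the kernel of \<open>\<gamma>\<close> the factor is constant and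
  leaves the average. This settles the case in which a deletion destroys spanning.\<close>

lemma spl_cx_kernel:
  assumes "\<And>z. z \<in> set Z \<Longrightarrow> blinfun_apply \<gamma> z = 0"
  shows "spl Z (\<lambda>v. cx \<gamma> v * F v) = (\<lambda>v. cx \<gamma> v * spl Z F v)"
  using assms
proof (induction Z)
  case (Cons z Z)
  have "avg z (\<lambda>v. cx \<gamma> v * spl Z F v) v = cx \<gamma> v * avg z (spl Z F) v" for v
    using Cons.prems[of z] by (simp add: avg_def cx_def blinfun.add_right blinfun.scaleR_right)
  with Cons show ?case by simp
qed simp

lemma spl_remove1:
  assumes "continuous_on UNIV F" "b \<in> set Y"
  shows "spl Y F = avg b (spl (remove1 b Y) F)"
  using spl_mset[OF assms(1), of Y "b # remove1 b Y"] assms(2) by simp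

text \<open>A derivative along a vector of \<open>Y\<close> cancels one average along it.\<close>

lemma spl_pderiv_mem:
  assumes F: "smooth F" and b: "b \<in> set Y"
  shows "spl Y (pderiv_dir b F) 0 = spl (remove1 b Y) F b - spl (remove1 b Y) F 0"
  using spl_remove1[OF smooth_continuous_on[OF smooth_pderiv_dir[OF F]] b, of b]
  by (simp add: pderiv_dir_spl[OF F, symmetric] avg_pderiv_dir smooth_spl F)

text \<open>The recurrence of de Boor and Hoellig, tested against \<open>F\<close>.\<close>

lemma spl_recurrence:
  fixes Y :: "'a::euclidean_space list"
  assumes F: "smooth F" and B: "independent B" "span B = UNIV" "B \<subseteq> set Y"
  shows "of_real (real (length Y) - real DIM('a)) * spl Y F 0 =
    (\<Sum>i<length Y. spl (del i Y) F (Y ! i)) -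
    (\<Sum>b\<in>B. spl (remove1 b Y) (\<lambda>v. cx (coord B b) v * F v) b - spl (remove1 b Y) (\<lambda>v. cx (coord B b) v * F v) 0)"
proof -
  have finB: "finite B" using B(1) by (rule independent_imp_finite)
  have cardB: "card B = DIM('a)" using B by (metis dim_UNIV dim_eq_card dim_span)
  \<comment> \<open>The Euler field is expanded along \<open>B\<close>, whose vectors occur in
    \<open>Y\<close>, so that each derivative can be integrated out.\<close>
  have "spl Y (\<lambda>w. pderiv_dir w F (0 + w)) 0 = spl Y (\<lambda>w. \<Sum>b\<in>B. cx (coord B b) w * pderiv_dir b F w) 0"
  proof -
    have "pderiv_dir w F w = (\<Sum>b\<in>B. cx (coord B b) w * pderiv_dir b F w)" for w
    proof -
      have "pderiv_dir w F w = pderiv_dir (\<Sum>b\<in>B. coord B b w *\<^sub>R b) F w"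
        by (simp add: coord_sum[OF B(1,2)])
      then show ?thesis
        by (simp add: linear_sum[OF linear_pderiv_dir] F pderiv_dir_scale_dir cx_def)
    qed
    then show ?thesis by simp
  qed
  also have "\<dots> = (\<Sum>b\<in>B. spl Y (\<lambda>w. cx (coord B b) w * pderiv_dir b F w) 0)"
    by (subst spl_sum[OF finB]) (auto intro!: smooth_continuous_on smooth_mult smooth_cx smooth_pderiv_dir F)
  \<comment> \<open>Moving the coordinate inside the derivative costs one copy of
    \<open>spl Y F 0\<close> per basis vector; these copies produce the dimension in the factor on
    the left.\<close>
  also have "\<dots> = (\<Sum>b\<in>B. (spl (remove1 b Y) (\<lambda>v. cx (coord B b) v * F v) b - spl (remove1 b Y) (\<lambda>v. cx (coord B b) v * F v) 0) - spl Y F 0)"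
  proof (intro sum.cong refl)
    fix b assume b: "b \<in> B"
    have sm: "smooth (\<lambda>v. cx (coord B b) v * F v)" by (intro smooth_mult smooth_cx F)
    have "pderiv_dir b (\<lambda>v. cx (coord B b) v * F v) = (\<lambda>w. cx (coord B b) w * pderiv_dir b F w + F w)"
    proof
      fix w
      have "cx (coord B b) b = 1" using coord_basis[OF B(1,2) b, of b] by (simp add: cx_def)
      then show "pderiv_dir b (\<lambda>v. cx (coord B b) v * F v) w = cx (coord B b) w * pderiv_dir b F w + F w"
        by (simp add: pderiv_dir_mult[OF smooth_cx F] pderiv_dir_bounded_linear[OF bounded_linear_cx])
    qed
    then have "spl Y (pderiv_dir b (\<lambda>v. cx (coord B b) v * F v)) 0 = spl Y (\<lambda>w. cx (coord B b) w * pderiv_dir b F w) 0 + spl Y F 0"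
      by (simp add: spl_add smooth_continuous_on smooth_mult smooth_cx smooth_pderiv_dir F)
    then show "spl Y (\<lambda>w. cx (coord B b) w * pderiv_dir b F w) 0 =
        (spl (remove1 b Y) (\<lambda>v. cx (coord B b) v * F v) b - spl (remove1 b Y) (\<lambda>v. cx (coord B b) v * F v) 0) - spl Y F 0"
      using spl_pderiv_mem[OF sm subsetD[OF B(3) b]] by (simp add: algebra_simps)
  qed
  also have "\<dots> = (\<Sum>b\<in>B. spl (remove1 b Y) (\<lambda>v. cx (coord B b) v * F v) b - spl (remove1 b Y) (\<lambda>v. cx (coord B b) v * F v) 0) - of_nat DIM('a) * spl Y F 0"
    by (simp add: sum_subtractf cardB)
  finally show ?thesis
    unfolding spl_euler[OF F] by (simp add: algebra_simps)
qed

section \<open>Piecewise smooth densities\<close>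

context euclidean_lattice
begin

definition walls :: "'a list \<Rightarrow> 'a set" where
  "walls X = (\<Union>H\<in>adm_hyperplanes X. \<Union>l\<in>\<Lambda>. (+) l ` H)"

text \<open>Connected sets instead of topes: this form is visibly invariant under lattice translations.\<close>

definition pws :: "'a list \<Rightarrow> ('a \<Rightarrow> complex) \<Rightarrow> bool" where
  "pws X b \<longleftrightarrow> (\<forall>S. connected S \<longrightarrow> S \<subseteq> - walls X \<longrightarrow> (\<exists>g. smooth g \<and> (\<forall>v\<in>S. b v = g v)))"

lemma walls_translate:
  assumes "l \<in> \<Lambda>" "v + l \<in> walls X"
  shows "v \<in> walls X"
proof -
  obtain H m h where "H \<in> adm_hyperplanes X" "m \<in> \<Lambda>" "h \<in> H" "v + l = m + h"
    using assms(2) by (auto simp: walls_def)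
  moreover from this have "v = (m - l) + h" by (simp add: algebra_simps)
  ultimately show ?thesis
    using lattice_diff[OF _ assms(1)] unfolding walls_def by blast
qed

lemma pws_translate:
  assumes b: "pws X b" and l: "l \<in> \<Lambda>"
  shows "pws X (\<lambda>v. b (v + l))"
  unfolding pws_def
proof (intro allI impI)
  fix S assume S: "connected S" "S \<subseteq> - walls X"
  have "connected ((+) l ` S)" using S(1)
    by (intro connected_continuous_image continuous_intros)
  moreover have "(+) l ` S \<subseteq> - walls X"
    using S(2) walls_translate[OF l] by (auto simp: add.commute)
  ultimately obtain g where g: "smooth g" "\<forall>v\<in>(+) l ` S. b v = g v"
    using b unfolding pws_def by blast
  then show "\<exists>g. smooth g \<and> (\<forall>v\<in>S. b (v + l) = g v)"
    by (intro exI[of _ "\<lambda>v. g (v + l)"]) (auto simp: smooth_translate add.commute)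
qed

lemma pws_smooth: "smooth g \<Longrightarrow> pws X g"
  by (auto simp: pws_def)

lemma pws_add: "pws X b \<Longrightarrow> pws X c \<Longrightarrow> pws X (\<lambda>v. b v + c v)"
  unfolding pws_def by (metis (no_types, lifting) smooth_add)

lemma pws_mult: "pws X b \<Longrightarrow> pws X c \<Longrightarrow> pws X (\<lambda>v. b v * c v)"
  unfolding pws_def by (metis (no_types, lifting) smooth_mult)

text \<open>A class of integrable densities stable under translations, sums and continuous factors;
  bounded support makes lattice sums of translates locally finite.\<close>

definition nice :: "('a \<Rightarrow> complex) \<Rightarrow> bool" where
  "nice b \<longleftrightarrow> b \<in> borel_measurable borel \<and> (\<exists>M. \<forall>v. norm (b v) \<le> M) \<and> bsupp b"

lemma nice_mult:
  assumes b: "nice b" and c: "continuous_on UNIV c"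
  shows "nice (\<lambda>v. b v * c v)"
proof -
  obtain M where M: "\<And>v. norm (b v) \<le> M" using b by (auto simp: nice_def)
  obtain R where R: "\<And>v. norm v > R \<Longrightarrow> b v = 0" using b by (auto simp: nice_def bsupp_def)
  have [measurable]: "b \<in> borel_measurable borel" "c \<in> borel_measurable borel"
    using b continuous_borel[OF c] by (auto simp: nice_def)
  have "compact (c ` cball 0 R)"
    by (intro compact_continuous_image continuous_on_subset[OF c]) auto
  then obtain N where N: "\<And>v. v \<in> cball 0 R \<Longrightarrow> norm (c v) \<le> N"
    using compact_imp_bounded by (fastforce simp: bounded_iff)
  have "norm (b v * c v) \<le> \<bar>M\<bar> * \<bar>N\<bar>" for v
  proof (cases "v \<in> cball 0 R")
    case True
    then show ?thesis
      unfolding norm_mult using M[of v] N[of v] by (intro mult_mono) auto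
  next
    case False
    then show ?thesis using R[of v] by simp
  qed
  then show ?thesis
    unfolding nice_def using b by (auto simp: nice_def intro!: bsupp_mult_right)
qed

lemma nice_add:
  assumes "nice b" "nice c"
  shows "nice (\<lambda>v. b v + c v)"
proof -
  obtain M N where "\<And>v. norm (b v) \<le> M" "\<And>v. norm (c v) \<le> N" using assms by (auto simp: nice_def)
  then have "norm (b v + c v) \<le> M + N" for v
    by (meson add_mono norm_triangle_ineq order_trans)
  with assms show ?thesis by (auto simp: nice_def intro!: bsupp_add)
qed

lemma nice_translate:
  assumes "nice b"
  shows "nice (\<lambda>v. b (v + w))"
proof -
  have [measurable]: "b \<in> borel_measurable borel" using assms by (simp add: nice_def)
  have "(\<lambda>v. b (v + w)) \<in> borel_measurable borel" by measurable
  with assms show ?thesis by (auto simp: nice_def intro: bsupp_translate)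
qed

lemma integrable_nice:
  assumes "nice b"
  shows "integrable (dvol \<Lambda>) b"
proof -
  obtain M where M: "\<And>v. norm (b v) \<le> M" using assms by (auto simp: nice_def)
  obtain R where R: "\<And>v. norm v > R \<Longrightarrow> b v = 0" using assms by (auto simp: nice_def bsupp_def)
  show ?thesis
  proof (rule integrableI_bounded_set[where A = "cball 0 R" and B = M])
    show "emeasure (dvol \<Lambda>) (cball 0 R) < \<infinity>"
      by (rule emeasure_dvol_bounded) simp
  qed (use assms M R in \<open>auto simp: nice_def\<close>)
qed

text \<open>The induction along the recurrence runs at the level of functionals: its terms arise
  from shorter box splines by translations, coordinate factors and linear combinations.\<close>

definition rep :: "'a list \<Rightarrow> (('a \<Rightarrow> complex) \<Rightarrow> complex) \<Rightarrow> bool" where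
  "rep X D \<longleftrightarrow> (\<exists>b. nice b \<and> pws X b \<and> (\<forall>\<phi>. test_fun \<phi> \<longrightarrow> D \<phi> = (LINT v|dvol \<Lambda>. b v * \<phi> v)))"

lemma rep_cong: "rep X D \<Longrightarrow> (\<And>\<phi>. test_fun \<phi> \<Longrightarrow> D' \<phi> = D \<phi>) \<Longrightarrow> rep X D'"
  unfolding rep_def by metis

lemma rep_zero: "rep X (\<lambda>\<phi>. 0)"
  unfolding rep_def by (intro exI[of _ "\<lambda>_. 0"]) (auto simp: nice_def bsupp_def intro!: pws_smooth smooth_const)

lemma rep_add:
  assumes "rep X D" "rep X E"
  shows "rep X (\<lambda>\<phi>. D \<phi> + E \<phi>)"
proof -
  obtain b c where b: "nice b" "pws X b" "\<And>\<phi>. test_fun \<phi> \<Longrightarrow> D \<phi> = (LINT v|dvol \<Lambda>. b v * \<phi> v)"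
    and c: "nice c" "pws X c" "\<And>\<phi>. test_fun \<phi> \<Longrightarrow> E \<phi> = (LINT v|dvol \<Lambda>. c v * \<phi> v)"
    using assms unfolding rep_def by metis
  have "D \<phi> + E \<phi> = (LINT v|dvol \<Lambda>. (b v + c v) * \<phi> v)" if t: "test_fun \<phi>" for \<phi>
  proof -
    have "continuous_on UNIV \<phi>" using t by (simp add: test_fun_iff smooth_continuous_on)
    then show ?thesis
      using b(1) c(1) by (simp add: b(3) c(3) t distrib_right integrable_nice nice_mult)
  qed
  with b c show ?thesis
    unfolding rep_def by (intro exI[of _ "\<lambda>v. b v + c v"]) (auto intro: nice_add pws_add)
qed

lemma rep_smooth_mult:
  assumes "rep X D" and g: "smooth g"
  shows "rep X (\<lambda>\<phi>. D (\<lambda>v. g v * \<phi> v))"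
proof -
  obtain b where b: "nice b" "pws X b" "\<And>\<phi>. test_fun \<phi> \<Longrightarrow> D \<phi> = (LINT v|dvol \<Lambda>. b v * \<phi> v)"
    using assms unfolding rep_def by metis
  have "D (\<lambda>v. g v * \<phi> v) = (LINT v|dvol \<Lambda>. (b v * g v) * \<phi> v)" if "test_fun \<phi>" for \<phi>
    using b(3)[OF test_fun_mult[OF g that]] by (simp add: mult.assoc)
  with b show ?thesis
    unfolding rep_def
    by (intro exI[of _ "\<lambda>v. b v * g v"]) (auto intro: nice_mult pws_mult pws_smooth g smooth_continuous_on)
qed

lemma rep_cmult: "rep X D \<Longrightarrow> rep X (\<lambda>\<phi>. c * D \<phi>)"
proof -
  assume "rep X D"
  then obtain b where b: "nice b" "pws X b" "\<And>\<phi>. test_fun \<phi> \<Longrightarrow> D \<phi> = (LINT v|dvol \<Lambda>. b v * \<phi> v)"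
    unfolding rep_def by metis
  have "c * D \<phi> = (LINT v|dvol \<Lambda>. (b v * c) * \<phi> v)" if t: "test_fun \<phi>" for \<phi>
    by (simp add: b(3)[OF t] mult.assoc mult.left_commute[of _ c])
  with b show ?thesis
    unfolding rep_def
    by (intro exI[of _ "\<lambda>v. b v * c"] conjI nice_mult pws_mult[OF _ pws_smooth[OF smooth_const]]) auto
qed

lemma rep_diff: "rep X D \<Longrightarrow> rep X E \<Longrightarrow> rep X (\<lambda>\<phi>. D \<phi> - E \<phi>)"
  using rep_add[OF _ rep_cmult[of X E "-1"], of D] by simp

lemma rep_sum: "(\<And>i. i \<in> A \<Longrightarrow> rep X (D i)) \<Longrightarrow> rep X (\<lambda>\<phi>. \<Sum>i\<in>A. D i \<phi>)"
  by (induction A rule: infinite_finite_induct) (auto intro: rep_zero rep_add)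

lemma rep_translate:
  assumes "rep X D" and l: "l \<in> \<Lambda>"
  shows "rep X (\<lambda>\<phi>. D (\<lambda>v. \<phi> (v + l)))"
proof -
  obtain b where b: "nice b" "pws X b" "\<And>\<phi>. test_fun \<phi> \<Longrightarrow> D \<phi> = (LINT v|dvol \<Lambda>. b v * \<phi> v)"
    using assms unfolding rep_def by metis
  have [measurable]: "b \<in> borel_measurable borel" using b by (simp add: nice_def)
  have "D (\<lambda>v. \<phi> (v + l)) = (LINT v|dvol \<Lambda>. b (v + - l) * \<phi> v)" if t: "test_fun \<phi>" for \<phi>
  proof -
    have [measurable]: "\<phi> \<in> borel_measurable borel"
      using t by (intro continuous_borel) (simp add: test_fun_iff smooth_continuous_on)
    have "(LINT v|dvol \<Lambda>. b (v + l + - l) * \<phi> (v + l)) = (LINT v|dvol \<Lambda>. b (v + - l) * \<phi> v)"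
      by (rule integral_dvol_translate) measurable
    then show ?thesis using b(3)[OF test_fun_translate[OF t]] by simp
  qed
  with b show ?thesis
    unfolding rep_def
    by (intro exI[of _ "\<lambda>v. b (v + - l)"]) (auto intro!: nice_translate pws_translate lattice_minus l simp del: add_uminus_conv_diff)
qed

text \<open>The points with \<open>b\<close>-coordinate \<open>k\<close> form the translate by
  \<open>k *\<^sub>R b\<close> of the hyperplane spanned by the other basis vectors; for an integer
  \<open>k\<close> this is a wall, because \<open>b\<close> is a lattice vector.\<close>

lemma coord_avoids_Ints:
  assumes X: "set X \<subseteq> \<Lambda>" and B: "independent B" "span B = UNIV" "B \<subseteq> set X" and b: "b \<in> B"
    and v: "v \<notin> walls X"
  shows "coord B b v \<notin> \<int>"
proof
  assume "coord B b v \<in> \<int>"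
  then obtain k where k: "coord B b v = of_int k" by (auto elim: Ints_cases)
  define I where "I = {i. i < length X \<and> X ! i \<in> B - {b}}"
  have "set (nths X I) = B - {b}"
  proof
    show "B - {b} \<subseteq> set (nths X I)"
      using B(3) unfolding set_nths I_def by (auto simp: subset_iff) (metis in_set_conv_nth)
  qed (auto simp: set_nths I_def)
  then have "span (B - {b}) = span (set (nths X I)) \<and> I \<subseteq> {..<length X}"
    by (auto simp: I_def)
  then have "span (B - {b}) \<in> adm_subspaces X"
    unfolding adm_subspaces_def mem_Collect_eq by (rule exI)
  moreover have "dim (span (B - {b})) + 1 = DIM('a)"
  proof -
    have "independent (B - {b})" using B(1) by (rule independent_mono) auto
    then have "dim (span (B - {b})) = card (B - {b})" by (simp add: dim_eq_card_independent)
    moreover have "card B = DIM('a)" using B by (metis dim_UNIV dim_eq_card dim_span)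
    ultimately show ?thesis
      using b independent_imp_finite[OF B(1)] by (simp add: card_Diff_singleton_if)
  qed
  ultimately have H: "span (B - {b}) \<in> adm_hyperplanes X" by (simp add: adm_hyperplanes_def)
  have veq: "v = of_int k *\<^sub>R b + (\<Sum>c\<in>B - {b}. coord B c v *\<^sub>R c)"
    using coord_sum[OF B(1,2), of v] independent_imp_finite[OF B(1)] b k by (simp add: sum.remove)
  have "(\<Sum>c\<in>B - {b}. coord B c v *\<^sub>R c) \<in> span (B - {b})"
    by (intro span_sum span_scale span_base) auto
  then have "v \<in> (+) (of_int k *\<^sub>R b) ` span (B - {b})"
    by (subst veq) (rule imageI)
  moreover have "of_int k *\<^sub>R b \<in> \<Lambda>"
    using X B(3) b by (intro lattice_scale) auto
  ultimately have "v \<in> (\<Union>l\<in>\<Lambda>. (+) l ` span (B - {b}))"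
    by (rule UN_I[rotated])
  then have "v \<in> walls X" unfolding walls_def by (rule UN_I[OF H])
  with v show False by simp
qed

text \<open>A connected set of reals without integers lies between two consecutive integers.\<close>

lemma coord_connected:
  assumes X: "set X \<subseteq> \<Lambda>" and B: "independent B" "span B = UNIV" "B \<subseteq> set X" and b: "b \<in> B"
    and S: "connected S" "S \<subseteq> - walls X" and vw: "v \<in> S" "w \<in> S"
  shows "\<lfloor>coord B b v\<rfloor> = \<lfloor>coord B b w\<rfloor>"
proof -
  let ?x = "blinfun_apply (coord B b)"
  have conn: "connected (?x ` S)"
    by (intro connected_continuous_image S continuous_intros)
  have *: "\<lfloor>?x v\<rfloor> \<le> \<lfloor>?x w\<rfloor>" if "v \<in> S" "w \<in> S" for v w
  proof (rule ccontr)
    assume "\<not> \<lfloor>?x v\<rfloor> \<le> \<lfloor>?x w\<rfloor>"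
    then have "?x w \<le> of_int \<lfloor>?x v\<rfloor>" "of_int \<lfloor>?x v\<rfloor> \<le> ?x v"
      by linarith+
    then have "of_int \<lfloor>?x v\<rfloor> \<in> ?x ` S"
      using connectedD_interval[OF conn, of "?x w" "?x v" "of_int \<lfloor>?x v\<rfloor>"] that by auto
    then show False
    proof (rule imageE)
      fix u assume "of_int \<lfloor>?x v\<rfloor> = ?x u" "u \<in> S"
      then show False
        using coord_avoids_Ints[OF X B b, of u] S(2) by (metis ComplD Ints_of_int subsetD)
    qed
  qed
  from *[OF vw] *[OF vw(2,1)] show ?thesis by simp
qed

lemma ex_basis:
  assumes "span (set Y) = (UNIV :: 'a set)"
  obtains B where "B \<subseteq> set Y" "independent B" "span B = UNIV"
proof -
  obtain B where "B \<subseteq> set Y" "independent B" "set Y \<subseteq> span B"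
    using maximal_independent_subset[of "set Y"] by blast
  moreover from this have "span B = UNIV"
    using span_minimal[OF \<open>set Y \<subseteq> span B\<close>] assms by auto
  ultimately show ?thesis using that by blast
qed

text \<open>All coordinates are confined to unit intervals. On such a set a lattice sum of compactly
  supported densities has one finite range.\<close>

lemma connected_bounded:
  assumes X: "set X \<subseteq> \<Lambda>" "span (set X) = UNIV" and S: "connected S" "S \<subseteq> - walls X"
  shows "bounded S"
proof (cases "S = {}")
  case False
  then obtain v0 where v0: "v0 \<in> S" by auto
  obtain B where B: "B \<subseteq> set X" "independent B" "span B = UNIV" using ex_basis[OF X(2)] .
  have finB: "finite B" using B(2) by (rule independent_imp_finite)
  define R where "R = (\<Sum>b\<in>B. \<bar>coord B b v0\<bar> + 1)"
  show ?thesis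
  proof (rule coord_bounded[OF B(2,3)])
    fix v b assume v: "v \<in> S" and b: "b \<in> B"
    have "\<lfloor>coord B b v\<rfloor> = \<lfloor>coord B b v0\<rfloor>"
      by (rule coord_connected[OF X(1) B(2,3,1) b S v v0])
    then have "\<bar>coord B b v\<bar> \<le> \<bar>coord B b v0\<bar> + 1" by linarith
    also have "\<dots> \<le> R"
      unfolding R_def using finB b by (intro member_le_sum) auto
    finally show "\<bar>coord B b v\<bar> \<le> R" .
  qed
qed simp

text \<open>Off the walls, membership in the parallelepiped is read off from the integer parts of
  the coordinates, so the density is constant on connected sets.\<close>

lemma rep_basis:
  assumes X: "set X \<subseteq> \<Lambda>" and Y: "set Y \<subseteq> set X" "span (set Y) = UNIV" "length Y = DIM('a)"
  shows "rep X (\<lambda>\<phi>. spl Y \<phi> 0)"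
proof -
  have "card (set Y) \<le> DIM('a)" using card_length[of Y] Y(3) by simp
  then have ind: "independent (set Y)"
    using card_le_dim_spanning[of "set Y" UNIV] Y(2) by simp
  then have "card (set Y) = DIM('a)" using Y(2) by (metis dim_UNIV dim_eq_card dim_span)
  then have dist: "distinct Y" using Y(3) by (simp add: card_distinct)
  let ?P = "para (set Y) (set Y)"
  obtain c where c: "\<And>\<phi>. continuous_on UNIV \<phi> \<Longrightarrow>
    spl Y \<phi> 0 = complex_of_real c * (LINT v|lborel. indicat_real ?P v *\<^sub>R \<phi> v)"
    using spl_basis[OF dist ind Y(2)] by blast
  \<comment> \<open>The factor \<open>covolume \<Lambda>\<close> compensates the normalisation of
    \<open>dvol \<Lambda>\<close> against \<open>lborel\<close>.\<close>
  define b where "b v = complex_of_real (c * covolume \<Lambda> * indicat_real ?P v)" for v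
  have "bounded ?P"
    by (rule coord_bounded[OF ind Y(2), of _ 1]) (auto simp: para_def)
  then obtain R where R: "\<And>v. v \<in> ?P \<Longrightarrow> norm v \<le> R" by (auto simp: bounded_iff)
  have "nice b"
    unfolding nice_def
  proof (intro conjI exI allI)
    show "b \<in> borel_measurable borel" unfolding b_def[abs_def] by measurable
    show "norm (b v) \<le> \<bar>c * covolume \<Lambda>\<bar>" for v
      by (auto simp: b_def norm_mult indicator_def)
    show "bsupp b"
      unfolding bsupp_def using R by (intro exI[of _ R]) (auto simp: b_def indicator_def dest: R)
  qed
  moreover have "pws X b"
    unfolding pws_def
  proof (intro allI impI)
    fix S assume S: "connected S" "S \<subseteq> - walls X"
    show "\<exists>g. smooth g \<and> (\<forall>v\<in>S. b v = g v)"
    proof (cases "S = {}")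
      case True
      then show ?thesis using smooth_const by blast
    next
      case False
      then obtain v0 where v0: "v0 \<in> S" by auto
      \<comment> \<open>The coordinate 1 belongs to the closed parallelepiped but is excluded off
        the walls, so the floor is 0 exactly inside.\<close>
      have iff: "0 \<le> coord (set Y) a v \<and> coord (set Y) a v \<le> 1 \<longleftrightarrow>
        \<lfloor>coord (set Y) a v\<rfloor> = 0" if "v \<in> S" "a \<in> set Y" for v a
      proof -
        have "coord (set Y) a v \<notin> \<int>"
          using coord_avoids_Ints[OF X ind Y(2,1) that(2)] S(2) that(1) by auto
        then have "coord (set Y) a v \<noteq> 1" by auto
        then show ?thesis by (auto simp: floor_eq_iff)
      qed
      have "v \<in> ?P \<longleftrightarrow> v0 \<in> ?P" if v: "v \<in> S" for v
        unfolding para_def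
        using iff[OF v] iff[OF v0] coord_connected[OF X ind Y(2,1) _ S v v0] by simp
      then have "\<forall>v\<in>S. b v = (\<lambda>_. b v0) v" by (auto simp: b_def indicator_def)
      then show ?thesis using smooth_const by blast
    qed
  qed
  moreover have "spl Y \<phi> 0 = (LINT v|dvol \<Lambda>. b v * \<phi> v)" if t: "test_fun \<phi>" for \<phi>
  proof -
    have c\<phi>: "continuous_on UNIV \<phi>" using t by (simp add: test_fun_iff smooth_continuous_on)
    then have [measurable]: "\<phi> \<in> borel_measurable borel" by (rule continuous_borel)
    have "(LINT v|dvol \<Lambda>. b v * \<phi> v) = (1 / covolume \<Lambda>) *\<^sub>R (LINT v|lborel. b v * \<phi> v)"
      by (rule integral_dvol) (simp add: b_def[abs_def])
    also have "(LINT v|lborel. b v * \<phi> v) = (LINT v|lborel. of_real (c * covolume \<Lambda>) * (indicat_real ?P v *\<^sub>R \<phi> v))"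
      by (simp add: b_def scaleR_conv_of_real mult_ac)
    also have "\<dots> = of_real (c * covolume \<Lambda>) * (LINT v|lborel. indicat_real ?P v *\<^sub>R \<phi> v)"
      by (rule integral_mult_right_zero)
    finally show ?thesis
      using covolume_pos by (simp add: c[OF c\<phi>] scaleR_conv_of_real)
  qed
  ultimately show ?thesis unfolding rep_def by blast
qed

text \<open>Strong induction on the length, ending at bases. Deletions outside a fixed copy of
  \<open>B\<close> preserve spanning; the others are paired with the boundary terms of the same
  vector.\<close>

lemma rep_spl:
  assumes X: "set X \<subseteq> \<Lambda>"
  shows "set Y \<subseteq> set X \<Longrightarrow> span (set Y) = UNIV \<Longrightarrow> rep X (\<lambda>\<phi>. spl Y \<phi> 0)"
proof (induction "length Y" arbitrary: Y rule: less_induct)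
  case less
  obtain B where B: "B \<subseteq> set Y" "independent B" "span B = UNIV" using ex_basis[OF less.prems(2)] .
  have finB: "finite B" using B(2) by (rule independent_imp_finite)
  have cardB: "card B = DIM('a)" using B by (metis dim_UNIV dim_eq_card dim_span)
  have "card B \<le> length Y"
    using card_mono[OF _ B(1)] card_length[of Y] by auto
  then consider "length Y = DIM('a)" | "DIM('a) < length Y" using cardB by linarith
  then show ?case
  proof cases
    case 1
    then show ?thesis by (rule rep_basis[OF X less.prems])
  next
    case 2
    have memL: "y \<in> \<Lambda>" if "y \<in> set Y" for y using that less.prems(1) X by auto
    \<comment> \<open>One position per vector of \<open>B\<close>: a vector may occur several times
      in \<open>Y\<close>, and only the chosen copy has to be protected.\<close>
    define ix where "ix b = (SOME i. i < length Y \<and> Y ! i = b)" for b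
    have ix: "ix b < length Y" "Y ! ix b = b" if "b \<in> B" for b
      using someI_ex[of "\<lambda>i. i < length Y \<and> Y ! i = b"] that B(1) unfolding ix_def
      by (auto simp: in_set_conv_nth subset_iff)
    have inj: "inj_on ix B" using ix by (metis inj_onI)
    have IH: "rep X (\<lambda>\<phi>. spl Z \<phi> 0)" if "length Z < length Y" "set Z \<subseteq> set Y" "span (set Z) = UNIV" for Z
      using that less.prems(1) by (intro less.hyps) auto
    have shift: "rep X (\<lambda>\<phi>. spl Z \<phi> y)" if "rep X (\<lambda>\<phi>. spl Z \<phi> 0)" "y \<in> \<Lambda>" for Z y
      using rep_translate[OF that] by (simp add: spl_translate)
    have r1: "rep X (\<lambda>\<phi>. spl (del i Y) \<phi> (Y ! i))" if i: "i < length Y" "i \<notin> ix ` B" for i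
    proof (rule shift, rule IH)
      have "B \<subseteq> set (del i Y)"
      proof
        fix b assume b: "b \<in> B"
        have "ix b \<noteq> i" using i b by auto
        then show "b \<in> set (del i Y)"
          using nth_mem_del[of "ix b" Y i] ix[OF b] by simp
      qed
      then show "span (set (del i Y)) = UNIV" using B(3) span_mono by blast
    qed (use i memL in \<open>auto simp: length_del dest: set_del_subset[THEN subsetD]\<close>)
    have r2: "rep X (\<lambda>\<phi>. spl (remove1 b Y) \<phi> b -
        (spl (remove1 b Y) (\<lambda>v. cx (coord B b) v * \<phi> v) b - spl (remove1 b Y) (\<lambda>v. cx (coord B b) v * \<phi> v) 0))"
      if b: "b \<in> B" for b
    proof (cases "\<forall>z\<in>set (remove1 b Y). coord B b z = 0")
      case True \<comment> \<open>the box spline of \<open>remove1 b Y\<close> is singular, but lives on the kernel of the coordinate\<close>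
      have "spl (remove1 b Y) (\<lambda>v. cx (coord B b) v * \<phi> v) b - spl (remove1 b Y) (\<lambda>v. cx (coord B b) v * \<phi> v) 0 =
          spl (remove1 b Y) \<phi> b" for \<phi>
        using spl_cx_kernel[of "remove1 b Y" "coord B b" \<phi>] True coord_basis[OF B(2,3) b, of b]
        by (simp add: cx_def)
      then show ?thesis using rep_zero by simp
    next
      case False
      then obtain z where z: "z \<in> set (remove1 b Y)" "coord B b z \<noteq> 0" by auto
      let ?Z = "remove1 b Y"
      have sub: "c \<in> set ?Z" if "c \<in> B - {b}" for c using that B(1) by auto
      have "(\<Sum>c\<in>B - {b}. coord B c z *\<^sub>R c) \<in> span (set ?Z)"
        by (intro span_sum span_scale span_base sub)
      \<comment> \<open>Solved for \<open>b\<close>, this equation shows that \<open>b\<close> is in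
        the span of the shortened sequence, which therefore still spans.\<close>
      moreover have "z = coord B b z *\<^sub>R b + (\<Sum>c\<in>B - {b}. coord B c z *\<^sub>R c)"
        using coord_sum[OF B(2,3), of z] finB b by (simp add: sum.remove)
      ultimately have "coord B b z *\<^sub>R b \<in> span (set ?Z)"
        using span_diff[OF span_base[OF z(1)]] by (metis add_diff_cancel_right')
      then have "b \<in> span (set ?Z)"
        using z(2) span_scale[of "coord B b z *\<^sub>R b" _ "1 / coord B b z"] by simp
      then have "B \<subseteq> span (set ?Z)" using sub span_base by blast
      then have "span (set ?Z) = UNIV" using B(3) span_minimal by (metis subspace_span top.extremum_uniqueI)
      then have r: "rep X (\<lambda>\<phi>. spl ?Z \<phi> 0)"
      proof (rule IH[rotated 2])
        have "b \<in> set Y" using b B(1) by auto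
        then show "length ?Z < length Y"
          using length_pos_if_in_set[of b Y] by (simp add: length_remove1)
      qed (rule set_remove1_subset)
      have bL: "b \<in> \<Lambda>" using b B(1) memL by auto
      show ?thesis
        by (intro rep_diff shift[OF r bL] rep_smooth_mult[OF shift[OF r bL]] rep_smooth_mult[OF r] smooth_cx)
    qed
    \<comment> \<open>The recurrence is divided by the excess of the length over the dimension,
      positive in this case.\<close>
    have "rep X (\<lambda>\<phi>. (1 / of_real (real (length Y) - real DIM('a))) *
        ((\<Sum>i\<in>{..<length Y} - ix ` B. spl (del i Y) \<phi> (Y ! i)) +
         (\<Sum>b\<in>B. spl (remove1 b Y) \<phi> b -
        (spl (remove1 b Y) (\<lambda>v. cx (coord B b) v * \<phi> v) b - spl (remove1 b Y) (\<lambda>v. cx (coord B b) v * \<phi> v) 0))))"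
      by (intro rep_cmult rep_add rep_sum r1 r2) auto
    then show ?thesis
    proof (rule rep_cong)
      fix \<phi> :: "'a \<Rightarrow> complex" assume t: "test_fun \<phi>"
      then have s: "smooth \<phi>" by (simp add: test_fun_iff)
      \<comment> \<open>The protected positions are split off and renamed by their basis vectors, to
        meet the boundary terms indexed by \<open>B\<close>.\<close>
      have "(\<Sum>i<length Y. spl (del i Y) \<phi> (Y ! i)) =
          (\<Sum>i\<in>{..<length Y} - ix ` B. spl (del i Y) \<phi> (Y ! i)) + (\<Sum>i\<in>ix ` B. spl (del i Y) \<phi> (Y ! i))"
        using ix by (intro sum.subset_diff) auto
      also have "(\<Sum>i\<in>ix ` B. spl (del i Y) \<phi> (Y ! i)) = (\<Sum>b\<in>B. spl (del (ix b) Y) \<phi> (Y ! ix b))"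
        by (simp add: sum.reindex[OF inj])
      also have "\<dots> = (\<Sum>b\<in>B. spl (remove1 b Y) \<phi> b)"
      proof (intro sum.cong refl)
        fix b assume b: "b \<in> B"
        have "mset (del (ix b) Y) = mset (remove1 b Y)"
          using mset_del[OF ix(1)[OF b]] ix(2)[OF b] by simp
        then show "spl (del (ix b) Y) \<phi> (Y ! ix b) = spl (remove1 b Y) \<phi> b"
          using spl_mset[OF smooth_continuous_on[OF s]] ix(2)[OF b] by metis
      qed
      finally have "(\<Sum>i<length Y. spl (del i Y) \<phi> (Y ! i)) = (\<Sum>i\<in>{..<length Y} - ix ` B. spl (del i Y) \<phi> (Y ! i)) + (\<Sum>b\<in>B. spl (remove1 b Y) \<phi> b)" .
      with spl_recurrence[OF s B(2,3,1)]
      have eq: "of_real (real (length Y) - real DIM('a)) * spl Y \<phi> 0 = ((\<Sum>i\<in>{..<length Y} - ix ` B. spl (del i Y) \<phi> (Y ! i)) +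
         (\<Sum>b\<in>B. spl (remove1 b Y) \<phi> b -
        (spl (remove1 b Y) (\<lambda>v. cx (coord B b) v * \<phi> v) b - spl (remove1 b Y) (\<lambda>v. cx (coord B b) v * \<phi> v) 0)))"
        by (simp only: sum_subtractf add_diff_eq)
      have "of_real (real (length Y) - real DIM('a)) \<noteq> (0::complex)" using 2 by (simp only: of_real_eq_0_iff)
      then show "spl Y \<phi> 0 = (1 / of_real (real (length Y) - real DIM('a))) *
        ((\<Sum>i\<in>{..<length Y} - ix ` B. spl (del i Y) \<phi> (Y ! i)) +
         (\<Sum>b\<in>B. spl (remove1 b Y) \<phi> b -
        (spl (remove1 b Y) (\<lambda>v. cx (coord B b) v * \<phi> v) b - spl (remove1 b Y) (\<lambda>v. cx (coord B b) v * \<phi> v) 0)))"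
        unfolding eq[symmetric] by simp
    qed
  qed
qed


section \<open>Densities of the two convolutions\<close>

lemma loc_L1_continuous:
  assumes "continuous_on UNIV F"
  shows "loc_L1 \<Lambda> F"
  unfolding loc_L1_def set_integrable_def integrable_dvol
  by (intro allI impI borel_integrable_compact continuous_on_subset[OF assms]) auto

text \<open>Fubini and a translation by \<open>t *\<^sub>R (- a)\<close>: the adjoint of averaging
  forwards is averaging backwards.\<close>

lemma integral_avg_adjoint:
  assumes F: "continuous_on UNIV F" and P: "continuous_on UNIV \<Phi>" "bsupp \<Phi>"
  shows "(LINT v|dvol \<Lambda>. F v * avg a \<Phi> v) = (LINT v|dvol \<Lambda>. avg (- a) F v * \<Phi> v)"
proof -
  obtain R where R: "\<forall>v. norm v > R \<longrightarrow> \<Phi> v = 0" using P(2) by (auto simp: bsupp_def)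
  have Rt: "\<Phi> (v + t *\<^sub>R a) = 0" if t: "t \<in> {0..1}" "norm v > R + norm a" for v t
  proof (rule bsupp_shift[OF R])
    have "\<bar>t\<bar> * norm a \<le> norm a" using t by (simp add: mult_left_le_one_le)
    with t show "R + norm (t *\<^sub>R a) < norm v" by simp
  qed
  have "(LINT v|dvol \<Lambda>. F v * avg a \<Phi> v) = (LINT v|dvol \<Lambda>. integral {0..1} (\<lambda>t. F v * \<Phi> (v + t *\<^sub>R a)))"
    by (simp add: avg_def)
  also have "\<dots> = integral {0..1} (\<lambda>t. LINT v|dvol \<Lambda>. F v * \<Phi> (v + t *\<^sub>R a))"
  proof (rule integral_dvol_swap[where R = "R + norm a"])
    show "continuous_on UNIV (\<lambda>(v, t). F v * \<Phi> (v + t *\<^sub>R a))"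
      by (auto intro!: continuous_intros continuous_on_compose2[OF F] continuous_on_compose2[OF P(1)] simp: case_prod_beta)
  qed (use Rt in auto)
  also have "\<dots> = integral {0..1} (\<lambda>t. LINT v|dvol \<Lambda>. F (v + t *\<^sub>R (- a)) * \<Phi> v)"
  proof (rule Henstock_Kurzweil_Integration.integral_cong)
    fix t :: real
    have "(\<lambda>v. F v * \<Phi> (v + t *\<^sub>R a)) \<in> borel_measurable borel"
      by (intro continuous_borel continuous_intros F continuous_on_compose2[OF P(1)]) auto
    from integral_dvol_translate[OF this, of "t *\<^sub>R (- a)"]
    show "(LINT v|dvol \<Lambda>. F v * \<Phi> (v + t *\<^sub>R a)) = (LINT v|dvol \<Lambda>. F (v + t *\<^sub>R (- a)) * \<Phi> v)"
      by simp
  qed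
  also have "\<dots> = (LINT v|dvol \<Lambda>. integral {0..1} (\<lambda>t. F (v + t *\<^sub>R (- a)) * \<Phi> v))"
  proof (rule integral_dvol_swap[where R = R, symmetric])
    show "continuous_on UNIV (\<lambda>(v, t). F (v + t *\<^sub>R (- a)) * \<Phi> v)"
      by (auto intro!: continuous_intros continuous_on_compose2[OF F] continuous_on_compose2[OF P(1)] simp: case_prod_beta)
  qed (use R in auto)
  finally show ?thesis by (simp add: avg_def)
qed

text \<open>The averages are moved one by one from the test function onto \<open>F\<close>, where
  averages of a smooth function stay smooth.\<close>

lemma conv_c_density:
  "smooth F \<Longrightarrow> \<exists>h. smooth h \<and> (\<forall>\<phi>. test_fun \<phi> \<longrightarrow> conv_c \<Lambda> Y F \<phi> = dist_of \<Lambda> h \<phi>)"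
proof (induction Y arbitrary: F)
  case Nil
  then show ?case by (auto simp: conv_c_eq dist_of_def)
next
  case (Cons a Y)
  obtain h where h: "smooth h" "\<And>\<phi>. test_fun \<phi> \<Longrightarrow> conv_c \<Lambda> Y (avg (- a) F) \<phi> = dist_of \<Lambda> h \<phi>"
    using Cons.IH[OF smooth_avg[OF Cons.prems]] by blast
  have "conv_c \<Lambda> (a # Y) F \<phi> = conv_c \<Lambda> Y (avg (- a) F) \<phi>" if t: "test_fun \<phi>" for \<phi>
    using test_fun_spl[OF t, of Y] Cons.prems
    by (simp add: conv_c_eq integral_avg_adjoint smooth_continuous_on test_fun_iff)
  with h show ?case by auto
qed

text \<open>The density superposes lattice translates of the box spline density, weighted by the
  values of \<open>f\<close>. Walls are invariant under the lattice, so every translate is smooth on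
  the same connected sets.\<close>

lemma conv_d_density:
  assumes X: "set X \<subseteq> \<Lambda>" "span (set X) = UNIV" and f: "smooth f"
  shows "\<exists>h. loc_L1 \<Lambda> h \<and> pws X h \<and> (\<forall>\<phi>. test_fun \<phi> \<longrightarrow> conv_d \<Lambda> X f \<phi> = dist_of \<Lambda> h \<phi>)"
proof -
  obtain b where b: "nice b" "pws X b" "\<And>\<phi>. test_fun \<phi> \<Longrightarrow> spl X \<phi> 0 = (LINT v|dvol \<Lambda>. b v * \<phi> v)"
    using rep_spl[OF X(1) order_refl X(2)] unfolding rep_def by blast
  have [measurable]: "b \<in> borel_measurable borel" using b(1) by (simp add: nice_def)
  obtain R where R: "\<And>v. norm v > R \<Longrightarrow> b v = 0" using b(1) by (auto simp: nice_def bsupp_def)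
  \<comment> \<open>For \<open>norm v \<le> S\<close> only these lattice vectors can bring
    \<open>v\<close> into the ball of radius \<open>R\<close> that supports
    \<open>b\<close>.\<close>
  define L where "L S = \<Lambda> \<inter> cball 0 (R + S)" for S
  have L: "finite (L S)" "L S \<subseteq> \<Lambda>" for S unfolding L_def by (auto intro: finite_lattice_bounded)
  have b0: "b (v + - l) = 0" if "norm v \<le> S" "l \<in> \<Lambda>" "l \<notin> L S" for v l S
  proof (rule R)
    have "norm l \<le> norm (v + - l) + norm v"
      by (metis add_uminus_conv_diff norm_minus_commute norm_triangle_sub add.commute)
    with that show "R < norm (v + - l)" by (auto simp: L_def)
  qed
  define h where "h v = (\<Sum>\<^sub>\<infinity>l\<in>\<Lambda>. f l * b (v + - l))" for v
  have h: "h v = (\<Sum>l\<in>L S. f l * b (v + - l))" if "norm v \<le> S" for v S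
  proof -
    have "h v = (\<Sum>\<^sub>\<infinity>l\<in>L S. f l * b (v + - l))"
      unfolding h_def using b0[OF that] L(2)[of S] by (intro infsum_cong_neutral) auto
    then show ?thesis using L(1) by simp
  qed
  have int: "integrable (dvol \<Lambda>) (\<lambda>v. f l * b (v + - l))" for l
    by (intro integrable_mult_right integrable_nice nice_translate b)
  have "loc_L1 \<Lambda> h"
    unfolding loc_L1_def
  proof (intro allI impI)
    fix K :: "'a set" assume K: "compact K"
    then obtain S where S: "\<And>v. v \<in> K \<Longrightarrow> norm v \<le> S" using compact_imp_bounded[OF K] by (auto simp: bounded_iff)
    have "integrable (dvol \<Lambda>) (\<lambda>v. indicat_real K v *\<^sub>R (\<Sum>l\<in>L S. f l * b (v + - l)))"
      using K by (intro integrable_mult_indicator Bochner_Integration.integrable_sum int) (simp add: borel_compact)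
    moreover have "(\<lambda>v. indicat_real K v *\<^sub>R (\<Sum>l\<in>L S. f l * b (v + - l))) = (\<lambda>v. indicat_real K v *\<^sub>R h v)"
    proof
      fix v
      show "indicat_real K v *\<^sub>R (\<Sum>l\<in>L S. f l * b (v + - l)) = indicat_real K v *\<^sub>R h v"
        using h[OF S, of v] by (cases "v \<in> K") simp_all
    qed
    ultimately show "set_integrable (dvol \<Lambda>) K h" by (simp add: set_integrable_def)
  qed
  moreover have "pws X h"
    unfolding pws_def
  proof (intro allI impI)
    fix T assume T: "connected T" "T \<subseteq> - walls X"
    \<comment> \<open>Boundedness of \<open>T\<close> fixes one finite index set for the whole of
      \<open>T\<close>, so the smooth extensions of the translates can be added.\<close>
    obtain S where S: "\<And>v. v \<in> T \<Longrightarrow> norm v \<le> S"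
      using connected_bounded[OF X T] by (auto simp: bounded_iff)
    have "\<exists>g. smooth g \<and> (\<forall>v\<in>T. b (v + - l) = g v)" if "l \<in> \<Lambda>" for l
      using pws_translate[OF b(2) lattice_minus[OF that]] T unfolding pws_def by blast
    then obtain g where g: "\<And>l. l \<in> \<Lambda> \<Longrightarrow> smooth (g l)" "\<And>l v. l \<in> \<Lambda> \<Longrightarrow> v \<in> T \<Longrightarrow> b (v + - l) = g l v"
      by metis
    show "\<exists>g. smooth g \<and> (\<forall>v\<in>T. h v = g v)"
    proof (intro exI conjI ballI)
      show "smooth (\<lambda>v. \<Sum>l\<in>L S. f l * g l v)"
        using L(2) by (intro smooth_sum smooth_cmult g) auto
      fix v assume v: "v \<in> T"
      show "h v = (\<Sum>l\<in>L S. f l * g l v)"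
        unfolding h[OF S[OF v]] using L(2) g(2)[OF _ v] by (intro sum.cong) auto
    qed
  qed
  moreover have "conv_d \<Lambda> X f \<phi> = dist_of \<Lambda> h \<phi>" if t: "test_fun \<phi>" for \<phi>
  proof -
    have c\<phi>: "continuous_on UNIV \<phi>" using t by (simp add: test_fun_iff smooth_continuous_on)
    then have [measurable]: "\<phi> \<in> borel_measurable borel" by (rule continuous_borel)
    obtain S where S: "\<And>v. norm v > S \<Longrightarrow> \<phi> v = 0" using t by (auto simp: test_fun_iff bsupp_def)
    have spl: "spl X \<phi> l = (LINT v|dvol \<Lambda>. b (v + - l) * \<phi> v)" for l
    proof -
      have "spl X \<phi> l = (LINT v|dvol \<Lambda>. b (v + l + - l) * \<phi> (v + l))"
        using b(3)[OF test_fun_translate[OF t, of l]] by (simp add: spl_translate)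
      also have "\<dots> = (LINT v|dvol \<Lambda>. b (v + - l) * \<phi> v)"
        by (rule integral_dvol_translate) measurable
      finally show ?thesis .
    qed
    have "spl X \<phi> l = 0" if l: "l \<in> \<Lambda>" "l \<notin> L S" for l
    proof -
      have "b (v + - l) * \<phi> v = 0" for v
        using b0[OF _ l] S by (cases "norm v \<le> S") auto
      then have "(\<lambda>v. b (v + - l) * \<phi> v) = (\<lambda>_. 0)" by (rule ext)
      then show ?thesis by (simp only: spl) simp
    qed
    then have "conv_d \<Lambda> X f \<phi> = (\<Sum>\<^sub>\<infinity>l\<in>L S. f l * spl X \<phi> l)"
      unfolding conv_d_def box_spline_shift using L(2)[of S] by (intro infsum_cong_neutral) auto
    also have "\<dots> = (\<Sum>l\<in>L S. LINT v|dvol \<Lambda>. f l * b (v + - l) * \<phi> v)"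
      using L(1) by (simp add: spl mult.assoc)
    also have "\<dots> = (LINT v|dvol \<Lambda>. (\<Sum>l\<in>L S. f l * b (v + - l) * \<phi> v))"
    proof (rule Bochner_Integration.integral_sum[symmetric])
      fix l
      have "integrable (dvol \<Lambda>) (\<lambda>v. f l * (b (v + - l) * \<phi> v))"
        by (intro integrable_mult_right integrable_nice nice_mult nice_translate b c\<phi>)
      then show "integrable (dvol \<Lambda>) (\<lambda>v. f l * b (v + - l) * \<phi> v)" by (simp add: mult.assoc)
    qed
    also have "\<dots> = dist_of \<Lambda> h \<phi>"
      unfolding dist_of_def
    proof (rule Bochner_Integration.integral_cong)
      fix v
      show "(\<Sum>l\<in>L S. f l * b (v + - l) * \<phi> v) = h v * \<phi> v"
        using h[of v S] S[of v] by (cases "norm v \<le> S") (auto simp: sum_distrib_right)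
    qed simp
    finally show ?thesis .
  qed
  ultimately show ?thesis by blast
qed

lemma pws_pw_smooth:
  assumes "loc_L1 \<Lambda> b" "pws X b"
  shows "pw_smooth \<Lambda> X b"
  unfolding pw_smooth_def topes_def
proof (intro conjI ballI assms)
  fix \<tau> assume "\<tau> \<in> components (- (\<Union>H\<in>adm_hyperplanes X. \<Union>l\<in>\<Lambda>. (+) l ` H))"
  then have "\<tau> \<in> components (- walls X)" by (simp only: walls_def)
  then have "connected \<tau>" "\<tau> \<subseteq> - walls X"
    by (rule in_components_connected, rule in_components_subset)
  then show "\<exists>g. smooth g \<and> (\<forall>v\<in>\<tau>. b v = g v)"
    using assms(2) by (simp add: pws_def)
qed

lemma pw_smooth_dist_conv_diff:
  assumes X: "set X \<subseteq> \<Lambda>" "span (set X) = UNIV" and f: "smooth f"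
  shows "pw_smooth_dist \<Lambda> X (\<lambda>\<phi>. conv_d \<Lambda> X f \<phi> - conv_c \<Lambda> X f \<phi>)"
proof -
  obtain h where h: "loc_L1 \<Lambda> h" "pws X h" "\<And>\<phi>. test_fun \<phi> \<Longrightarrow> conv_d \<Lambda> X f \<phi> = dist_of \<Lambda> h \<phi>"
    using conv_d_density[OF assms] by blast
  obtain g where g: "smooth g" "\<And>\<phi>. test_fun \<phi> \<Longrightarrow> conv_c \<Lambda> X f \<phi> = dist_of \<Lambda> g \<phi>"
    using conv_c_density[OF f] by blast
  have lg: "loc_L1 \<Lambda> g" by (rule loc_L1_continuous[OF smooth_continuous_on[OF g(1)]])
  \<comment> \<open>Local integrability is enough: the test function confines the product to a ball,
    on which it is bounded.\<close>
  have int: "integrable (dvol \<Lambda>) (\<lambda>v. F v * \<phi> v)" if F: "loc_L1 \<Lambda> F" and t: "test_fun \<phi>" for F \<phi>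
  proof -
    have c\<phi>: "continuous_on UNIV \<phi>" using t by (simp add: test_fun_iff smooth_continuous_on)
    obtain R where R: "\<And>v. norm v > R \<Longrightarrow> \<phi> v = 0" using t by (auto simp: test_fun_iff bsupp_def)
    have "compact (\<phi> ` cball 0 R)"
      by (intro compact_continuous_image continuous_on_subset[OF c\<phi>]) auto
    then obtain M where M: "\<And>v. v \<in> cball 0 R \<Longrightarrow> norm (\<phi> v) \<le> M"
      using compact_imp_bounded by (fastforce simp: bounded_iff)
    have i: "integrable (dvol \<Lambda>) (\<lambda>v. indicat_real (cball 0 R) v *\<^sub>R F v)"
      using F by (auto simp: loc_L1_def set_integrable_def)
    have [measurable]: "\<phi> \<in> borel_measurable borel" by (rule continuous_borel[OF c\<phi>])
    have [measurable]: "(\<lambda>v. indicat_real (cball 0 R) v *\<^sub>R F v) \<in> borel_measurable borel"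
      using borel_measurable_integrable[OF i] by simp
    have eq: "(\<lambda>v. F v * \<phi> v) = (\<lambda>v. (indicat_real (cball 0 R) v *\<^sub>R F v) * \<phi> v)"
      using R by (auto simp: indicator_def)
    show ?thesis
      unfolding eq
    proof (rule Bochner_Integration.integrable_bound)
      show "integrable (dvol \<Lambda>) (\<lambda>v. \<bar>M\<bar> * norm (indicat_real (cball 0 R) v *\<^sub>R F v))"
        by (intro integrable_mult_right integrable_norm i)
      show "AE v in dvol \<Lambda>. norm ((indicat_real (cball 0 R) v *\<^sub>R F v) * \<phi> v) \<le> norm (\<bar>M\<bar> * norm (indicat_real (cball 0 R) v *\<^sub>R F v))"
      proof (rule AE_I2)
        fix v
        show "norm ((indicat_real (cball 0 R) v *\<^sub>R F v) * \<phi> v) \<le> norm (\<bar>M\<bar> * norm (indicat_real (cball 0 R) v *\<^sub>R F v))"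
        proof (cases "v \<in> cball 0 R")
          case True
          have "norm (F v) * norm (\<phi> v) \<le> norm (F v) * \<bar>M\<bar>"
            using M[OF True] by (intro mult_left_mono) auto
          then show ?thesis using True by (simp add: norm_mult mult.commute)
        qed auto
      qed
    qed (unfold measurable_dvol, measurable)
  qed
  have "pw_smooth \<Lambda> X (\<lambda>v. h v + (-1) * g v)"
  proof (rule pws_pw_smooth)
    show "pws X (\<lambda>v. h v + (-1) * g v)"
      by (intro pws_add h pws_smooth smooth_cmult g)
    show "loc_L1 \<Lambda> (\<lambda>v. h v + (-1) * g v)"
      using h(1) lg unfolding loc_L1_def by (auto intro: set_integral_diff(1))
  qed
  moreover have "conv_d \<Lambda> X f \<phi> - conv_c \<Lambda> X f \<phi> = dist_of \<Lambda> (\<lambda>v. h v + (-1) * g v) \<phi>" if t: "test_fun \<phi>" for \<phi>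
    using int[OF h(1) t] int[OF lg t] by (simp add: h(3)[OF t] g(2)[OF t] dist_of_def left_diff_distrib)
  ultimately show ?thesis unfolding pw_smooth_dist_def by blast
qed

end

theorem theorem4p1:
  fixes \<Lambda> :: "'a::euclidean_space set"
    and X :: "'a list"
    and f :: "'a \<Rightarrow> complex"
  assumes "is_lattice \<Lambda>"
    and "set X \<subseteq> \<Lambda>"
    and "0 \<notin> set X"
    and "span (set X) = UNIV"
    and "smooth f"
  shows "eq_pw_smooth_dist \<Lambda> X
    (\<lambda>\<phi>. conv_d \<Lambda> X f \<phi> - conv_c \<Lambda> X f \<phi>)
    (\<lambda>\<phi>. \<Sum>\<ss>\<in>adm_subspaces X - {UNIV}. \<Sum>I\<in>Pow (idx_out X \<ss>).
       (-1) ^ card I *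
       conv_c \<Lambda> (nths X (idx_in X \<ss> \<union> I))
         (\<lambda>v. W \<Lambda> X \<ss> v *
              pderivs (nths X I) (nablas (nths X (idx_out X \<ss> - I)) f) v) \<phi>)"
proof -
  interpret euclidean_lattice \<Lambda> by standard (rule assms(1))
  note eq = euler_maclaurin[OF assms(2,4,5)]
  have "pw_smooth_dist \<Lambda> X (\<lambda>\<phi>. conv_d \<Lambda> X f \<phi> - conv_c \<Lambda> X f \<phi>)"
    by (rule pw_smooth_dist_conv_diff[OF assms(2,4,5)])
  \<comment> \<open>The two functionals agree on test functions, so the density found for the left
    one represents the right one too.\<close>
  then show ?thesis
    unfolding eq_pw_smooth_dist_def pw_smooth_dist_def by (auto simp: eq)
qed

end
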